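(* The following formulas are derivable in $FO\lambda^{\Delta\mathbb{N}}$ using the definition $\mathcal{D}(nat)\cup\mathcal{D}_{list}(atm)\cup\mathcal{D}(intuit)$: Specialization: $\forall i\forall b\forall l(nat\,i\supset seq_{(s\,i)}\,l\,(\bigwedge b)\supset\forall x\,seq_i\,l\,(b\,x))$; Cut: $\forall a\forall b\forall l(\vdash_{(a::l)} b\supset\ \vdash_l\langle a\rangle\supset\ \vdash_l b)$; Structural rules: $\forall i\forall b\forall l\forall l'(nat\,i\supset\forall a(element\,a\,l\supset element\,a\,l')\supset seq_i\,l\,b\supset seq_i\,l'\,b)$.
   Context: $FO\lambda^{\Delta\mathbb{N}}$ is the following intuitionistic sequent calculus. Terms are simply typed $\lambda$-terms (up to $\alpha\beta\eta$-conversion) over a signature of typed constants; $o$ is the type of formulas, and quantifiers range only over types not containing $o$. Formulas are built from atomic formulas with $\bot,\top,\land,\lor,\supset$ (right-associative), $\forall,\exists$. There is a type $nt$ with constants $z:nt$, $s:nt\to nt$ and a predicate $nat: nt\to o$. Sequents are $\Gamma\longrightarrow B$, $\Gamma$ a finite multiset. Rules: $\bot,\Gamma\longrightarrow B$ and $\Gamma\longrightarrow\top$ are axioms; the usual intuitionistic left and right rules for $\land,\lor,\supset,\forall,\exists$ (with the usual eigenvariable conditions); initial sequents $A,\Gamma\longrightarrow A$ for atomic $A$; left contraction; cut. For $nat$: $\Gamma\longrightarrow nat\,z$; from $\Gamma\longrightarrow nat\,I$ infer $\Gamma\longrightarrow nat\,(s\,I)$; induction: for $B:nt\to o$ and eigenvariable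 $j$ not free in $B$, from $\longrightarrow B\,z$, $B\,j\longrightarrow B\,(s\,j)$, $B\,I,\Gamma\longrightarrow C$ infer $nat\,I,\Gamma\longrightarrow C$. Relative to a definition (set of clauses $\forall\bar x[p\,\bar t\triangleq B]$, free variables of $B$ occurring in $\bar t$, satisfying a level condition): right rule: from $\Gamma\longrightarrow B\theta$ infer $\Gamma\longrightarrow p\,\bar u$ when $p\,\bar u=(p\,\bar t)\theta$; left rule: infer $p\,\bar u,\Gamma\longrightarrow C$ from the premises $B\theta,\Gamma\theta\longrightarrow C\theta$ for every clause (renamed apart) and every $\theta$ in a complete set of unifiers of $p\,\bar u$ and $p\,\bar t$ (a predicate with no clauses thus admits the left rule with zero premises). A formula is derivable using a definition if $\longrightarrow F$ has a derivation. $\mathcal{D}(nat)$: predicates $=,<,\le: nt\to nt\to o$, $sum: nt\to nt\to nt\to o$; clauses $I=I\triangleq\top$; $sum\,z\,J\,J\triangleq nat\,J$; $sum\,(s\,I)\,J\,(s\,K)\triangleq sum\,I\,J\,K$; $z<(s\,J)\triangleq nat\,J$; $(s\,I)<(s\,J)\triangleq I<J$; $I\le I\triangleq\top$; $I\le J\triangleq I<J$. Object logic: types $i$, $atm$, $prp$, constants $\langle\cdot\rangle: atm\to prp$, $tt: prp$, $\&: prp\to prp\to prp$, $\Rightarrow: atm\to prp\to prp$, $\bigwedge: (i\to prp)\to prp$. $atmlst$ is the list type over $atm$ with $nil$ and infix $::$. $\mathcal{D}_{list}(atm)$ has clauses $length\,nil\,z\triangleq\top$; $length\,(X::L)\,(s\,I)\triangleq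 length\,L\,I$; $list\,L\triangleq\exists i(nat\,i\land length\,L\,i)$; $element\,X\,(X::L)\triangleq\top$; $element\,X\,(Y::L)\triangleq element\,X\,L$; $split\,nil\,nil\,nil\triangleq\top$; $split\,(X::L_1)\,(X::L_2)\,L_3\triangleq split\,L_1\,L_2\,L_3$; $split\,(X::L_1)\,L_2\,(X::L_3)\triangleq split\,L_1\,L_2\,L_3$; $permute\,nil\,nil\triangleq\top$; $permute\,(X::L_1)\,L_2\triangleq\exists l_{22}(split\,L_2\,(X::nil)\,l_{22}\land permute\,L_1\,l_{22})$. With $prog: atm\to prp\to o$ and $seq: nt\to atmlst\to prp\to o$ (first argument as subscript), $\mathcal{D}(intuit)$ is: $seq_I\,(A'::L)\,\langle A\rangle\triangleq element\,A\,(A'::L)$; $seq_I\,L\,tt\triangleq\top$; $seq_{(s I)}\,L\,(B\,\&\,C)\triangleq seq_I\,L\,B\land seq_I\,L\,C$; $seq_{(s I)}\,L\,(A\Rightarrow B)\triangleq seq_I\,(A::L)\,B$; $seq_{(s I)}\,L\,(\bigwedge B)\triangleq\forall x\,seq_I\,L\,(B\,x)$; $seq_{(s I)}\,L\,\langle A\rangle\triangleq\exists b(prog\,A\,b\land seq_I\,L\,b)$. $\vdash_L B$ abbreviates $\exists i(nat\,i\land seq_i\,L\,B)$. *)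

theory Defs
  imports "HOL-Library.Multiset"
begin

section \<open>Simply typed terms up to conversion\<close>

datatype 'b ty = Prop | Nt | Base 'b | Fun "'b ty" "'b ty" (infixr \<open>\<rightarrow>\<^sub>t\<close> 65)

primrec ofree :: "'b ty \<Rightarrow> bool" where
  "ofree Prop = False"
| "ofree Nt = True"
| "ofree (Base b) = True"
| "ofree (\<sigma> \<rightarrow>\<^sub>t \<tau>) = (ofree \<sigma> \<and> ofree \<tau>)"

text \<open>The constants fixed by the logic; \<open>NL\<close> embeds those of the signature.\<close>

datatype ('b, 'c) const =
    LBot | LTop | LAnd | LOr | LImp | LAll "'b ty" | LEx "'b ty"
  | Zr | Sc | NatP
  | NL 'c

type_synonym 'b var = "nat \<times> 'b ty"

text \<open>Bound variables are de Bruijn indices, so that alpha-equivalent terms are equal.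
  Free variables are named and carry their type.\<close>

datatype ('b, 'c) tm =
    Var "'b var"
  | Bnd nat
  | Con "('b, 'c) const"
  | App "('b, 'c) tm" "('b, 'c) tm"
  | Lam "('b, 'c) tm"

primrec fvs :: "('b, 'c) tm \<Rightarrow> 'b var set" where
  "fvs (Var v) = {v}"
| "fvs (Bnd i) = {}"
| "fvs (Con c) = {}"
| "fvs (App t u) = fvs t \<union> fvs u"
| "fvs (Lam t) = fvs t"

primrec lift :: "nat \<Rightarrow> ('b, 'c) tm \<Rightarrow> ('b, 'c) tm" where
  "lift k (Var v) = Var v"
| "lift k (Bnd i) = Bnd (if i < k then i else Suc i)"
| "lift k (Con c) = Con c"
| "lift k (App t u) = App (lift k t) (lift k u)"
| "lift k (Lam t) = Lam (lift (Suc k) t)"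

primrec inst :: "nat \<Rightarrow> ('b, 'c) tm \<Rightarrow> ('b, 'c) tm \<Rightarrow> ('b, 'c) tm" where
  "inst k u (Var v) = Var v"
| "inst k u (Bnd i) = (if i < k then Bnd i else if i = k then u else Bnd (i - 1))"
| "inst k u (Con c) = Con c"
| "inst k u (App s t) = App (inst k u s) (inst k u t)"
| "inst k u (Lam t) = Lam (inst (Suc k) (lift 0 u) t)"

primrec close :: "nat \<Rightarrow> 'b var \<Rightarrow> ('b, 'c) tm \<Rightarrow> ('b, 'c) tm" where
  "close k v (Var w) = (if w = v then Bnd k else Var w)"
| "close k v (Bnd i) = Bnd (if i < k then i else Suc i)"
| "close k v (Con c) = Con c"
| "close k v (App t u) = App (close k v t) (close k v u)"
| "close k v (Lam t) = Lam (close (Suc k) v t)"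

definition lam :: "'b var \<Rightarrow> ('b, 'c) tm \<Rightarrow> ('b, 'c) tm" where
  "lam v t = Lam (close 0 v t)"

inductive conv :: "('b, 'c) tm \<Rightarrow> ('b, 'c) tm \<Rightarrow> bool" (infix \<open>\<approx>\<close> 50) where
  conv_beta: "App (Lam t) u \<approx> inst 0 u t"
| conv_eta: "Lam (App (lift 0 t) (Bnd 0)) \<approx> t"
| conv_refl: "t \<approx> t"
| conv_sym: "t \<approx> u \<Longrightarrow> u \<approx> t"
| conv_trans: "s \<approx> t \<Longrightarrow> t \<approx> u \<Longrightarrow> s \<approx> u"
| conv_App: "s \<approx> s' \<Longrightarrow> t \<approx> t' \<Longrightarrow> App s t \<approx> App s' t'"
| conv_Lam: "t \<approx> t' \<Longrightarrow> Lam t \<approx> Lam t'"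

text \<open>A signature assigns types to (some of) the non-logical constants.\<close>

primrec ctype :: "('c \<Rightarrow> 'b ty option) \<Rightarrow> ('b, 'c) const \<Rightarrow> 'b ty option" where
  "ctype sg LBot = Some Prop"
| "ctype sg LTop = Some Prop"
| "ctype sg LAnd = Some (Prop \<rightarrow>\<^sub>t Prop \<rightarrow>\<^sub>t Prop)"
| "ctype sg LOr = Some (Prop \<rightarrow>\<^sub>t Prop \<rightarrow>\<^sub>t Prop)"
| "ctype sg LImp = Some (Prop \<rightarrow>\<^sub>t Prop \<rightarrow>\<^sub>t Prop)"
| "ctype sg (LAll \<tau>) = (if ofree \<tau> then Some ((\<tau> \<rightarrow>\<^sub>t Prop) \<rightarrow>\<^sub>t Prop) else None)"
| "ctype sg (LEx \<tau>) = (if ofree \<tau> then Some ((\<tau> \<rightarrow>\<^sub>t Prop) \<rightarrow>\<^sub>t Prop) else None)"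
| "ctype sg Zr = Some Nt"
| "ctype sg Sc = Some (Nt \<rightarrow>\<^sub>t Nt)"
| "ctype sg NatP = Some (Nt \<rightarrow>\<^sub>t Prop)"
| "ctype sg (NL c) = sg c"

text \<open>Curry-style typing. Named variables are those that quantifiers and eigenvariables
  range over, hence only the ones of a type not containing \<open>Prop\<close> are typable. The calculus uses
  conversion only between well-typed terms.\<close>

inductive has_ty :: "('c \<Rightarrow> 'b ty option) \<Rightarrow> 'b ty list \<Rightarrow> ('b, 'c) tm \<Rightarrow> 'b ty \<Rightarrow> bool" for sg where
  ty_Var: "ofree (snd v) \<Longrightarrow> has_ty sg \<Delta> (Var v) (snd v)"
| ty_Bnd: "i < length \<Delta> \<Longrightarrow> has_ty sg \<Delta> (Bnd i) (\<Delta> ! i)"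
| ty_Con: "ctype sg c = Some \<tau> \<Longrightarrow> has_ty sg \<Delta> (Con c) \<tau>"
| ty_App: "has_ty sg \<Delta> t (\<sigma> \<rightarrow>\<^sub>t \<tau>) \<Longrightarrow> has_ty sg \<Delta> u \<sigma> \<Longrightarrow> has_ty sg \<Delta> (App t u) \<tau>"
| ty_Lam: "has_ty sg (\<sigma> # \<Delta>) t \<tau> \<Longrightarrow> has_ty sg \<Delta> (Lam t) (\<sigma> \<rightarrow>\<^sub>t \<tau>)"

definition fm :: "('c \<Rightarrow> 'b ty option) \<Rightarrow> ('b, 'c) tm \<Rightarrow> bool" where
  "fm sg A \<longleftrightarrow> has_ty sg [] A Prop"

section \<open>Substitutions and unifiers\<close>

type_synonym ('b, 'c) sub = "'b var \<Rightarrow> ('b, 'c) tm"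

primrec subst :: "('b, 'c) sub \<Rightarrow> ('b, 'c) tm \<Rightarrow> ('b, 'c) tm" where
  "subst \<theta> (Var v) = \<theta> v"
| "subst \<theta> (Bnd i) = Bnd i"
| "subst \<theta> (Con c) = Con c"
| "subst \<theta> (App t u) = App (subst \<theta> t) (subst \<theta> u)"
| "subst \<theta> (Lam t) = Lam (subst \<theta> t)"

definition is_subst :: "('c \<Rightarrow> 'b ty option) \<Rightarrow> ('b, 'c) sub \<Rightarrow> bool" where
  "is_subst sg \<theta> \<longleftrightarrow>
     (\<forall>v. ofree (snd v) \<longrightarrow> has_ty sg [] (\<theta> v) (snd v)) \<and> finite {v. \<theta> v \<noteq> Var v}"

definition unifier :: "('c \<Rightarrow> 'b ty option) \<Rightarrow> ('b, 'c) sub \<Rightarrow> ('b, 'c) tm \<Rightarrow> ('b, 'c) tm \<Rightarrow> bool" where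
  "unifier sg \<theta> t u \<longleftrightarrow> is_subst sg \<theta> \<and> subst \<theta> t \<approx> subst \<theta> u"

text \<open>Completeness is relative to a set \<open>W\<close> of variables, as is usual for higher-order
  unification, because unifiers may introduce auxiliary variables. In the left rule for
  definitions \<open>W\<close> has to contain the variables of the whole sequent, not only those of the
  two unified atoms: the unifiers are applied to the whole sequent.\<close>

definition csu ::
  "('c \<Rightarrow> 'b ty option) \<Rightarrow> 'b var set \<Rightarrow> ('b, 'c) tm \<Rightarrow> ('b, 'c) tm \<Rightarrow> ('b, 'c) sub set \<Rightarrow> bool" where
  "csu sg W t u S \<longleftrightarrow>
     (\<forall>\<theta>\<in>S. unifier sg \<theta> t u) \<and>
     (\<forall>\<rho>. unifier sg \<rho> t u \<longrightarrow>
        (\<exists>\<theta>\<in>S. \<exists>\<theta>'. is_subst sg \<theta>' \<and> (\<forall>v\<in>W. \<rho> v \<approx> subst \<theta>' (\<theta> v))))"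

definition renaming :: "('b var \<Rightarrow> 'b var) \<Rightarrow> bool" where
  "renaming \<pi> \<longleftrightarrow> inj \<pi> \<and> (\<forall>v. snd (\<pi> v) = snd v)"

section \<open>Formulas and definitions\<close>

abbreviation fBot :: "('b, 'c) tm" (\<open>\<^bold>\<bottom>\<close>) where "\<^bold>\<bottom> \<equiv> Con LBot"
abbreviation fTop :: "('b, 'c) tm" (\<open>\<^bold>\<top>\<close>) where "\<^bold>\<top> \<equiv> Con LTop"
abbreviation fAnd :: "('b, 'c) tm \<Rightarrow> ('b, 'c) tm \<Rightarrow> ('b, 'c) tm" (infixr \<open>\<^bold>\<and>\<close> 55)
  where "A \<^bold>\<and> B \<equiv> App (App (Con LAnd) A) B"
abbreviation fOr :: "('b, 'c) tm \<Rightarrow> ('b, 'c) tm \<Rightarrow> ('b, 'c) tm" (infixr \<open>\<^bold>\<or>\<close> 54)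
  where "A \<^bold>\<or> B \<equiv> App (App (Con LOr) A) B"
abbreviation fImp :: "('b, 'c) tm \<Rightarrow> ('b, 'c) tm \<Rightarrow> ('b, 'c) tm" (infixr \<open>\<^bold>\<longrightarrow>\<close> 53)
  where "A \<^bold>\<longrightarrow> B \<equiv> App (App (Con LImp) A) B"
abbreviation qAll :: "'b ty \<Rightarrow> ('b, 'c) tm \<Rightarrow> ('b, 'c) tm"
  where "qAll \<tau> B \<equiv> App (Con (LAll \<tau>)) B"
abbreviation qEx :: "'b ty \<Rightarrow> ('b, 'c) tm \<Rightarrow> ('b, 'c) tm"
  where "qEx \<tau> B \<equiv> App (Con (LEx \<tau>)) B"
abbreviation fAll :: "'b var \<Rightarrow> ('b, 'c) tm \<Rightarrow> ('b, 'c) tm" (\<open>(3\<^bold>\<forall>_\<^bold>./ _)\<close> [1000, 52] 52)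
  where "\<^bold>\<forall>v\<^bold>. A \<equiv> qAll (snd v) (lam v A)"
abbreviation fEx :: "'b var \<Rightarrow> ('b, 'c) tm \<Rightarrow> ('b, 'c) tm" (\<open>(3\<^bold>\<exists>_\<^bold>./ _)\<close> [1000, 52] 52)
  where "\<^bold>\<exists>v\<^bold>. A \<equiv> qEx (snd v) (lam v A)"
abbreviation zr :: "('b, 'c) tm" where "zr \<equiv> Con Zr"
abbreviation sc :: "('b, 'c) tm \<Rightarrow> ('b, 'c) tm" where "sc t \<equiv> App (Con Sc) t"
abbreviation natp :: "('b, 'c) tm \<Rightarrow> ('b, 'c) tm" where "natp t \<equiv> App (Con NatP) t"
abbreviation nl :: "'c \<Rightarrow> ('b, 'c) tm list \<Rightarrow> ('b, 'c) tm" (infix \<open>\<^bold>\<cdot>\<close> 90)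
  where "c \<^bold>\<cdot> ts \<equiv> foldl App (Con (NL c)) ts"

definition atomic :: "('b, 'c) tm \<Rightarrow> bool" where
  "atomic A \<longleftrightarrow> (\<exists>t. A = natp t) \<or> (\<exists>p ts. A = p \<^bold>\<cdot> ts)"

text \<open>A clause is implicitly universally quantified over its free variables.\<close>

datatype ('b, 'c) clause = Clause (cpred: 'c) (cargs: "('b, 'c) tm list") (cbody: "('b, 'c) tm")

definition chead :: "('b, 'c) clause \<Rightarrow> ('b, 'c) tm" where
  "chead c = cpred c \<^bold>\<cdot> cargs c"

text \<open>\<open>level_le lv A n\<close>: the level of the formula \<open>A\<close> is at most \<open>n\<close>, where the level of an
  atom is given by its predicate (0 for \<open>nat\<close>), the level of \<open>B \<supset> C\<close> is the maximum of
  \<open>level B + 1\<close> and \<open>level C\<close>, and the other connectives take the maximum of the levels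
  of their subformulas.\<close>

inductive level_le :: "('c \<Rightarrow> nat) \<Rightarrow> ('b, 'c) tm \<Rightarrow> nat \<Rightarrow> bool" for lv where
  level_bot: "level_le lv \<^bold>\<bottom> n"
| level_top: "level_le lv \<^bold>\<top> n"
| level_nat: "level_le lv (natp t) n"
| level_atom: "lv p \<le> n \<Longrightarrow> level_le lv (p \<^bold>\<cdot> ts) n"
| level_and: "level_le lv B n \<Longrightarrow> level_le lv C n \<Longrightarrow> level_le lv (B \<^bold>\<and> C) n"
| level_or: "level_le lv B n \<Longrightarrow> level_le lv C n \<Longrightarrow> level_le lv (B \<^bold>\<or> C) n"
| level_imp: "level_le lv B m \<Longrightarrow> m < n \<Longrightarrow> level_le lv C n \<Longrightarrow> level_le lv (B \<^bold>\<longrightarrow> C) n"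
| level_all: "level_le lv (App B (Var (y, \<tau>))) n \<Longrightarrow> (y, \<tau>) \<notin> fvs B \<Longrightarrow> level_le lv (qAll \<tau> B) n"
| level_ex: "level_le lv (App B (Var (y, \<tau>))) n \<Longrightarrow> (y, \<tau>) \<notin> fvs B \<Longrightarrow> level_le lv (qEx \<tau> B) n"
| level_conv: "level_le lv B n \<Longrightarrow> B \<approx> B' \<Longrightarrow> level_le lv B' n"

definition is_definition :: "('c \<Rightarrow> 'b ty option) \<Rightarrow> ('b, 'c) clause set \<Rightarrow> bool" where
  "is_definition sg D \<longleftrightarrow>
     (\<forall>c\<in>D. fm sg (chead c) \<and> fm sg (cbody c) \<and> fvs (cbody c) \<subseteq> fvs (chead c)) \<and>
     (\<exists>lv. \<forall>c\<in>D. level_le lv (cbody c) (lv (cpred c)))"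

section \<open>The sequent calculus\<close>

abbreviation fms :: "('c \<Rightarrow> 'b ty option) \<Rightarrow> ('b, 'c) tm multiset \<Rightarrow> bool" where
  "fms sg \<Gamma> \<equiv> \<forall>A\<in>#\<Gamma>. fm sg A"

abbreviation fvms :: "('b, 'c) tm multiset \<Rightarrow> 'b var set" where
  "fvms \<Gamma> \<equiv> \<Union>A\<in>set_mset \<Gamma>. fvs A"

text \<open>The typing premises only ensure that all sequents consist of formulas. The rules
  \<open>convL\<close> and \<open>convR\<close> identify formulas up to conversion. In \<open>defL\<close>, \<open>\<pi> c\<close> renames the
  clause \<open>c\<close> apart from the conclusion, and \<open>S c\<close> is the chosen complete set of unifiers.\<close>

inductive derives ::
  "('c \<Rightarrow> 'b ty option) \<Rightarrow> ('b, 'c) clause set \<Rightarrow> ('b, 'c) tm multiset \<Rightarrow> ('b, 'c) tm \<Rightarrow> bool"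
  for sg D where
  botL: "fms sg \<Gamma> \<Longrightarrow> fm sg B \<Longrightarrow> derives sg D (add_mset \<^bold>\<bottom> \<Gamma>) B"
| topR: "fms sg \<Gamma> \<Longrightarrow> derives sg D \<Gamma> \<^bold>\<top>"
| init: "atomic A \<Longrightarrow> fm sg A \<Longrightarrow> fms sg \<Gamma> \<Longrightarrow> derives sg D (add_mset A \<Gamma>) A"
| andL1: "derives sg D (add_mset B \<Gamma>) E \<Longrightarrow> fm sg C \<Longrightarrow> derives sg D (add_mset (B \<^bold>\<and> C) \<Gamma>) E"
| andL2: "derives sg D (add_mset C \<Gamma>) E \<Longrightarrow> fm sg B \<Longrightarrow> derives sg D (add_mset (B \<^bold>\<and> C) \<Gamma>) E"
| andR: "derives sg D \<Gamma> B \<Longrightarrow> derives sg D \<Gamma> C \<Longrightarrow> derives sg D \<Gamma> (B \<^bold>\<and> C)"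
| orL: "derives sg D (add_mset B \<Gamma>) E \<Longrightarrow> derives sg D (add_mset C \<Gamma>) E \<Longrightarrow>
    derives sg D (add_mset (B \<^bold>\<or> C) \<Gamma>) E"
| orR1: "derives sg D \<Gamma> B \<Longrightarrow> fm sg C \<Longrightarrow> derives sg D \<Gamma> (B \<^bold>\<or> C)"
| orR2: "derives sg D \<Gamma> C \<Longrightarrow> fm sg B \<Longrightarrow> derives sg D \<Gamma> (B \<^bold>\<or> C)"
| impL: "derives sg D \<Gamma> B \<Longrightarrow> derives sg D (add_mset C \<Gamma>) E \<Longrightarrow>
    derives sg D (add_mset (B \<^bold>\<longrightarrow> C) \<Gamma>) E"
| impR: "derives sg D (add_mset B \<Gamma>) C \<Longrightarrow> derives sg D \<Gamma> (B \<^bold>\<longrightarrow> C)"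
| allL: "derives sg D (add_mset (App B t) \<Gamma>) C \<Longrightarrow> ofree \<tau> \<Longrightarrow> has_ty sg [] B (\<tau> \<rightarrow>\<^sub>t Prop) \<Longrightarrow>
    has_ty sg [] t \<tau> \<Longrightarrow> derives sg D (add_mset (qAll \<tau> B) \<Gamma>) C"
| allR: "derives sg D \<Gamma> (App B (Var (y, \<tau>))) \<Longrightarrow> ofree \<tau> \<Longrightarrow> has_ty sg [] B (\<tau> \<rightarrow>\<^sub>t Prop) \<Longrightarrow>
    (y, \<tau>) \<notin> fvms \<Gamma> \<union> fvs B \<Longrightarrow> derives sg D \<Gamma> (qAll \<tau> B)"
| exL: "derives sg D (add_mset (App B (Var (y, \<tau>))) \<Gamma>) C \<Longrightarrow> ofree \<tau> \<Longrightarrow>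
    has_ty sg [] B (\<tau> \<rightarrow>\<^sub>t Prop) \<Longrightarrow> (y, \<tau>) \<notin> fvms \<Gamma> \<union> fvs B \<union> fvs C \<Longrightarrow>
    derives sg D (add_mset (qEx \<tau> B) \<Gamma>) C"
| exR: "derives sg D \<Gamma> (App B t) \<Longrightarrow> ofree \<tau> \<Longrightarrow> has_ty sg [] B (\<tau> \<rightarrow>\<^sub>t Prop) \<Longrightarrow>
    has_ty sg [] t \<tau> \<Longrightarrow> derives sg D \<Gamma> (qEx \<tau> B)"
| contrL: "derives sg D (add_mset B (add_mset B \<Gamma>)) C \<Longrightarrow> derives sg D (add_mset B \<Gamma>) C"
| cut: "derives sg D \<Delta> B \<Longrightarrow> derives sg D (add_mset B \<Gamma>) C \<Longrightarrow> derives sg D (\<Delta> + \<Gamma>) C"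
| natR_z: "fms sg \<Gamma> \<Longrightarrow> derives sg D \<Gamma> (natp zr)"
| natR_s: "derives sg D \<Gamma> (natp I) \<Longrightarrow> derives sg D \<Gamma> (natp (sc I))"
| natL: "has_ty sg [] B (Nt \<rightarrow>\<^sub>t Prop) \<Longrightarrow> has_ty sg [] I Nt \<Longrightarrow> (j, Nt) \<notin> fvs B \<Longrightarrow>
    derives sg D {#} (App B zr) \<Longrightarrow>
    derives sg D {#App B (Var (j, Nt))#} (App B (sc (Var (j, Nt)))) \<Longrightarrow>
    derives sg D (add_mset (App B I) \<Gamma>) C \<Longrightarrow>
    derives sg D (add_mset (natp I) \<Gamma>) C"
| defR: "c \<in> D \<Longrightarrow> is_subst sg \<theta> \<Longrightarrow> cpred c = p \<Longrightarrow> p \<^bold>\<cdot> us \<approx> subst \<theta> (chead c) \<Longrightarrow>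
    fm sg (p \<^bold>\<cdot> us) \<Longrightarrow> derives sg D \<Gamma> (subst \<theta> (cbody c)) \<Longrightarrow> derives sg D \<Gamma> (p \<^bold>\<cdot> us)"
| defL: "fm sg (p \<^bold>\<cdot> us) \<Longrightarrow> fms sg \<Gamma> \<Longrightarrow> fm sg C \<Longrightarrow>
    W = fvs (p \<^bold>\<cdot> us) \<union> fvms \<Gamma> \<union> fvs C \<Longrightarrow>
    (\<And>c. c \<in> D \<Longrightarrow> cpred c = p \<Longrightarrow> renaming (\<pi> c)) \<Longrightarrow>
    (\<And>c. c \<in> D \<Longrightarrow> cpred c = p \<Longrightarrow> \<pi> c ` (fvs (chead c) \<union> fvs (cbody c)) \<inter> W = {}) \<Longrightarrow>
    (\<And>c. c \<in> D \<Longrightarrow> cpred c = p \<Longrightarrow>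
       csu sg (W \<union> \<pi> c ` (fvs (chead c) \<union> fvs (cbody c)))
         (p \<^bold>\<cdot> us) (subst (Var \<circ> \<pi> c) (chead c)) (S c)) \<Longrightarrow>
    (\<And>c \<theta>. c \<in> D \<Longrightarrow> cpred c = p \<Longrightarrow> \<theta> \<in> S c \<Longrightarrow>
       derives sg D
         (add_mset (subst \<theta> (subst (Var \<circ> \<pi> c) (cbody c))) (image_mset (subst \<theta>) \<Gamma>))
         (subst \<theta> C)) \<Longrightarrow>
    derives sg D (add_mset (p \<^bold>\<cdot> us) \<Gamma>) C"
| convL: "derives sg D (add_mset B \<Gamma>) C \<Longrightarrow> B \<approx> B' \<Longrightarrow> fm sg B' \<Longrightarrow> derives sg D (add_mset B' \<Gamma>) C"
| convR: "derives sg D \<Gamma> C \<Longrightarrow> C \<approx> C' \<Longrightarrow> fm sg C' \<Longrightarrow> derives sg D \<Gamma> C'"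

definition derivable_using ::
  "('c \<Rightarrow> 'b ty option) \<Rightarrow> ('b, 'c) clause set \<Rightarrow> ('b, 'c) tm \<Rightarrow> bool" where
  "derivable_using sg D F \<longleftrightarrow> is_definition sg D \<and> fm sg F \<and> derives sg D {#} F"

section \<open>The signature\<close>

datatype sort = Ind | Atm | Prp | AtmLst

text \<open>\<open>Ext\<close> stands for further constants of the signature, for instance the function and
  predicate symbols of the object language.\<close>

datatype 'k ocon =
    Eq | Lt | Le | Sum
  | Ang | TT | Amp | Arrow | BigAnd
  | LNil | LCons
  | Length | IsList | Element | Split | Permute
  | Prog | Seq
  | Ext 'k

abbreviation "ind \<equiv> Base Ind"
abbreviation "atm \<equiv> Base Atm"
abbreviation "prp \<equiv> Base Prp"
abbreviation "atmlst \<equiv> Base AtmLst"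

primrec osig :: "('k \<Rightarrow> sort ty option) \<Rightarrow> 'k ocon \<Rightarrow> sort ty option" where
  "osig ext Eq = Some (Nt \<rightarrow>\<^sub>t Nt \<rightarrow>\<^sub>t Prop)"
| "osig ext Lt = Some (Nt \<rightarrow>\<^sub>t Nt \<rightarrow>\<^sub>t Prop)"
| "osig ext Le = Some (Nt \<rightarrow>\<^sub>t Nt \<rightarrow>\<^sub>t Prop)"
| "osig ext Sum = Some (Nt \<rightarrow>\<^sub>t Nt \<rightarrow>\<^sub>t Nt \<rightarrow>\<^sub>t Prop)"
| "osig ext Ang = Some (atm \<rightarrow>\<^sub>t prp)"
| "osig ext TT = Some prp"
| "osig ext Amp = Some (prp \<rightarrow>\<^sub>t prp \<rightarrow>\<^sub>t prp)"
| "osig ext Arrow = Some (atm \<rightarrow>\<^sub>t prp \<rightarrow>\<^sub>t prp)"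
| "osig ext BigAnd = Some ((ind \<rightarrow>\<^sub>t prp) \<rightarrow>\<^sub>t prp)"
| "osig ext LNil = Some atmlst"
| "osig ext LCons = Some (atm \<rightarrow>\<^sub>t atmlst \<rightarrow>\<^sub>t atmlst)"
| "osig ext Length = Some (atmlst \<rightarrow>\<^sub>t Nt \<rightarrow>\<^sub>t Prop)"
| "osig ext IsList = Some (atmlst \<rightarrow>\<^sub>t Prop)"
| "osig ext Element = Some (atm \<rightarrow>\<^sub>t atmlst \<rightarrow>\<^sub>t Prop)"
| "osig ext Split = Some (atmlst \<rightarrow>\<^sub>t atmlst \<rightarrow>\<^sub>t atmlst \<rightarrow>\<^sub>t Prop)"
| "osig ext Permute = Some (atmlst \<rightarrow>\<^sub>t atmlst \<rightarrow>\<^sub>t Prop)"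
| "osig ext Prog = Some (atm \<rightarrow>\<^sub>t prp \<rightarrow>\<^sub>t Prop)"
| "osig ext Seq = Some (Nt \<rightarrow>\<^sub>t atmlst \<rightarrow>\<^sub>t prp \<rightarrow>\<^sub>t Prop)"
| "osig ext (Ext k) = ext k"

type_synonym 'k otm = "(sort, 'k ocon) tm"
type_synonym 'k oclause = "(sort, 'k ocon) clause"

abbreviation lnil :: "'k otm" where "lnil \<equiv> LNil \<^bold>\<cdot> []"
abbreviation lcons :: "'k otm \<Rightarrow> 'k otm \<Rightarrow> 'k otm" (infixr \<open>\<^bold>:\<^bold>:\<close> 92)
  where "X \<^bold>:\<^bold>: L \<equiv> LCons \<^bold>\<cdot> [X, L]"

section \<open>The definitions\<close>

definition D_nat :: "'k oclause set" where
  "D_nat = (let I = Var (0, Nt); J = Var (1, Nt); K = Var (2, Nt) in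
   { Clause Eq [I, I] \<^bold>\<top>,
     Clause Sum [zr, J, J] (natp J),
     Clause Sum [sc I, J, sc K] (Sum \<^bold>\<cdot> [I, J, K]),
     Clause Lt [zr, sc J] (natp J),
     Clause Lt [sc I, sc J] (Lt \<^bold>\<cdot> [I, J]),
     Clause Le [I, I] \<^bold>\<top>,
     Clause Le [I, J] (Lt \<^bold>\<cdot> [I, J]) })"

definition D_list :: "'k oclause set" where
  "D_list = (let I = Var (0, Nt); X = Var (0, atm); Y = Var (1, atm); L = Var (0, atmlst);
     L1 = Var (1, atmlst); L2 = Var (2, atmlst); L3 = Var (3, atmlst);
     i = (1, Nt); l22 = (4, atmlst) in
   { Clause Length [lnil, zr] \<^bold>\<top>,
     Clause Length [X \<^bold>:\<^bold>: L, sc I] (Length \<^bold>\<cdot> [L, I]),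
     Clause IsList [L] (\<^bold>\<exists>i\<^bold>. natp (Var i) \<^bold>\<and> Length \<^bold>\<cdot> [L, Var i]),
     Clause Element [X, X \<^bold>:\<^bold>: L] \<^bold>\<top>,
     Clause Element [X, Y \<^bold>:\<^bold>: L] (Element \<^bold>\<cdot> [X, L]),
     Clause Split [lnil, lnil, lnil] \<^bold>\<top>,
     Clause Split [X \<^bold>:\<^bold>: L1, X \<^bold>:\<^bold>: L2, L3] (Split \<^bold>\<cdot> [L1, L2, L3]),
     Clause Split [X \<^bold>:\<^bold>: L1, L2, X \<^bold>:\<^bold>: L3] (Split \<^bold>\<cdot> [L1, L2, L3]),
     Clause Permute [lnil, lnil] \<^bold>\<top>,
     Clause Permute [X \<^bold>:\<^bold>: L1, L2]
       (\<^bold>\<exists>l22\<^bold>. Split \<^bold>\<cdot> [L2, X \<^bold>:\<^bold>: lnil, Var l22] \<^bold>\<and> Permute \<^bold>\<cdot> [L1, Var l22]) })"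

definition D_intuit :: "'k oclause set" where
  "D_intuit = (let I = Var (0, Nt); A = Var (0, atm); A' = Var (1, atm); L = Var (0, atmlst);
     B = Var (0, prp); C = Var (1, prp); F = Var (0, ind \<rightarrow>\<^sub>t prp); x = (0, ind); b = (2, prp) in
   { Clause Seq [I, A' \<^bold>:\<^bold>: L, Ang \<^bold>\<cdot> [A]] (Element \<^bold>\<cdot> [A, A' \<^bold>:\<^bold>: L]),
     Clause Seq [I, L, TT \<^bold>\<cdot> []] \<^bold>\<top>,
     Clause Seq [sc I, L, Amp \<^bold>\<cdot> [B, C]] (Seq \<^bold>\<cdot> [I, L, B] \<^bold>\<and> Seq \<^bold>\<cdot> [I, L, C]),
     Clause Seq [sc I, L, Arrow \<^bold>\<cdot> [A, B]] (Seq \<^bold>\<cdot> [I, A \<^bold>:\<^bold>: L, B]),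
     Clause Seq [sc I, L, BigAnd \<^bold>\<cdot> [F]] (\<^bold>\<forall>x\<^bold>. Seq \<^bold>\<cdot> [I, L, App F (Var x)]),
     Clause Seq [sc I, L, Ang \<^bold>\<cdot> [A]] (\<^bold>\<exists>b\<^bold>. Prog \<^bold>\<cdot> [A, Var b] \<^bold>\<and> Seq \<^bold>\<cdot> [I, L, Var b]) })"

text \<open>\<open>\<turnstile>\<^sub>L B\<close>. The arguments are lifted over the quantifier so that no variable of theirs
  is captured.\<close>

definition prv :: "'k otm \<Rightarrow> 'k otm \<Rightarrow> 'k otm" where
  "prv L B = qEx Nt (Lam (natp (Bnd 0) \<^bold>\<and> Seq \<^bold>\<cdot> [Bnd 0, lift 0 L, lift 0 B]))"

section \<open>The object-level properties\<close>

definition specialization :: "'k otm" where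
  "specialization = (let i = (0, Nt); b = (0, ind \<rightarrow>\<^sub>t prp); l = (0, atmlst); x = (0, ind) in
     \<^bold>\<forall>i\<^bold>. \<^bold>\<forall>b\<^bold>. \<^bold>\<forall>l\<^bold>. (natp (Var i) \<^bold>\<longrightarrow>
       Seq \<^bold>\<cdot> [sc (Var i), Var l, BigAnd \<^bold>\<cdot> [Var b]] \<^bold>\<longrightarrow>
       (\<^bold>\<forall>x\<^bold>. Seq \<^bold>\<cdot> [Var i, Var l, App (Var b) (Var x)])))"

definition object_cut :: "'k otm" where
  "object_cut = (let a = (0, atm); b = (0, prp); l = (0, atmlst) in
     \<^bold>\<forall>a\<^bold>. \<^bold>\<forall>b\<^bold>. \<^bold>\<forall>l\<^bold>. (prv (Var a \<^bold>:\<^bold>: Var l) (Var b) \<^bold>\<longrightarrow>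
       prv (Var l) (Ang \<^bold>\<cdot> [Var a]) \<^bold>\<longrightarrow> prv (Var l) (Var b)))"

definition structural_rules :: "'k otm" where
  "structural_rules = (let i = (0, Nt); a = (0, atm); b = (0, prp); l = (0, atmlst); l' = (1, atmlst) in
     \<^bold>\<forall>i\<^bold>. \<^bold>\<forall>b\<^bold>. \<^bold>\<forall>l\<^bold>. \<^bold>\<forall>l'\<^bold>. (natp (Var i) \<^bold>\<longrightarrow>
       (\<^bold>\<forall>a\<^bold>. (Element \<^bold>\<cdot> [Var a, Var l] \<^bold>\<longrightarrow> Element \<^bold>\<cdot> [Var a, Var l'])) \<^bold>\<longrightarrow>
       Seq \<^bold>\<cdot> [Var i, Var l, Var b] \<^bold>\<longrightarrow> Seq \<^bold>\<cdot> [Var i, Var l', Var b]))"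

end

theory Submission
  imports Defs
begin

text \<open>
  By confluence of untyped beta-eta reduction, applications of constants are convertible only if
  the constants agree and the arguments are convertible. Hence the left rule for definitions, used
  with the set of all unifiers, is an inversion principle for clauses.

  All three properties then rest on one formula, \<open>transfer j i k\<close>:
  \<open>\<forall>b l l'. (\<forall>a. element a l \<supset> seq\<^sub>j l' \<langle>a\<rangle>) \<supset> seq\<^sub>i l b \<supset> seq\<^sub>k l' b\<close>.
  A case analysis on the last clause shows that \<open>transfer j i k\<close> implies
  \<open>transfer j (s i) (s k)\<close> as soon as \<open>transfer z j j\<close> and \<open>transfer z j (s k)\<close> hold. Induction
  gives \<open>transfer z i i\<close>, the structural rules, and \<open>transfer z i (s i)\<close>, monotonicity in the
  height. A further induction on \<open>i\<close> gives, for all \<open>j\<close>, some \<open>k\<close> with \<open>transfer j i k\<close>, and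
  this is the cut property, because \<open>seq\<^sub>j l \<langle>a\<rangle>\<close> makes every element of \<open>a :: l\<close> derivable from \<open>l\<close>.
\<close>

section \<open>Confluence of conversion\<close>

text \<open>Membership in a list and derivability of an atom at height \<open>z\<close> are
  equivalent, since at that height only the initial clause reaches an atom. So for
  \<open>j = z\<close> the hypothesis of \<open>transfer\<close> is inclusion of lists, and for
  larger \<open>j\<close> it also admits a cut atom: this is how structural rules and cut become one
  statement. The two side conditions of the step have different sources:
  \<open>transfer z j j\<close> weakens the covering derivations when the clause for
  \<open>arrow\<close> extends both lists, and \<open>transfer z j (s k)\<close> raises the
  derivation that replaces an initial sequent to the height of the conclusion.

  Two features of the calculus shape the proof. The left rule for definitions applies unifiers to
  the whole sequent, so inversions run in contexts listing just the hypotheses in use, whose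
  instances are known, and are moved elsewhere by cut. The side premises of the induction rule have
  no context, so an induction formula carries its parameters and their hypotheses inside; hence the
  quantifier over \<open>j\<close>, guarded by \<open>nat j\<close>, in the bound for cut. The bound
  obtained is \<open>j + i\<close>.\<close>

lemma lift_lift: "i \<le> k \<Longrightarrow> lift (Suc k) (lift i t) = lift i (lift k t)"
  by (induction t arbitrary: i k) auto

lemma lift_inst_le: "j \<le> k \<Longrightarrow> lift k (inst j u t) = inst j (lift k u) (lift (Suc k) t)"
  by (induction t arbitrary: j k u) (auto simp: lift_lift)

lemma lift_inst_ge: "k \<le> j \<Longrightarrow> lift k (inst j u t) = inst (Suc j) (lift k u) (lift k t)"
  by (induction t arbitrary: j k u) (auto simp: lift_lift)

lemma inst_lift [simp]: "inst k u (lift k t) = t"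
  by (induction t arbitrary: k u) auto

lemma inst_Bnd_lift_Suc [simp]: "inst k (Bnd k) (lift (Suc k) t) = t"
  by (induction t arbitrary: k) auto

text \<open>The substitution lemma in indices: \<open>v\<close> is lifted past the index
  \<open>i\<close>, which is still to be removed. It makes parallel beta steps commute with
  instantiation.\<close>

lemma inst_inst:
  "i \<le> j \<Longrightarrow> inst j v (inst i u t) = inst i (inst j v u) (inst (Suc j) (lift i v) t)"
proof (induction t arbitrary: i j u v)
  case (Lam t)
  then show ?case by (simp add: lift_lift lift_inst_ge)
qed auto

lemma lift_inject [simp]: "lift k t = lift k u \<longleftrightarrow> t = u"
  by (metis inst_lift)

lemma size_lift [simp]: "size (lift k t) = size t"
  by (induction t arbitrary: k) auto

text \<open>A term that avoids two indices arises by skipping both. It serves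
  \<open>par_liftD\<close>, where a lift has to be pushed through the \<open>lift 0 r\<close> of an
  eta redex.\<close>

lemma lift_eq_lift:
  "i \<le> k \<Longrightarrow> lift (Suc k) t = lift i r \<Longrightarrow> \<exists>q. t = lift i q \<and> r = lift k q"
proof (induction t arbitrary: i k r)
  case (Var v)
  then show ?case by (cases r) (auto intro!: exI[of _ "Var v"])
next
  case (Bnd n)
  obtain m where r: "r = Bnd m" using Bnd by (cases r) auto
  show ?case
  proof (cases "n < i")
    case True
    then show ?thesis using Bnd r by (intro exI[of _ "Bnd n"]) (auto split: if_splits)
  next
    case False
    then show ?thesis using Bnd r by (intro exI[of _ "Bnd (n - 1)"]) (auto split: if_splits)
  qed
next
  case (Con c)
  then show ?case by (cases r) (auto intro!: exI[of _ "Con c"])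
next
  case (App t u)
  then obtain a b where r: "r = App a b" by (cases r) auto
  from App.IH(1)[of i k a] App.IH(2)[of i k b] App.prems
  obtain p q where "t = lift i p" "a = lift k p" "u = lift i q" "b = lift k q" by (auto simp: r)
  then show ?case by (intro exI[of _ "App p q"]) (simp add: r)
next
  case (Lam t)
  then obtain a where r: "r = Lam a" by (cases r) auto
  from Lam.IH[of "Suc i" "Suc k" a] Lam.prems
  obtain p where "t = lift (Suc i) p" "a = lift (Suc k) p" by (auto simp: r)
  then show ?case by (intro exI[of _ "Lam p"]) (simp add: r)
qed

section \<open>Parallel beta-eta reduction and its diamond property\<close>

inductive par :: "('b, 'c) tm \<Rightarrow> ('b, 'c) tm \<Rightarrow> bool" (infix \<open>\<Rrightarrow>\<close> 50) where
  par_Var: "Var v \<Rrightarrow> Var v"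
| par_Bnd: "Bnd i \<Rrightarrow> Bnd i"
| par_Con: "Con c \<Rrightarrow> Con c"
| par_App: "s \<Rrightarrow> s' \<Longrightarrow> t \<Rrightarrow> t' \<Longrightarrow> App s t \<Rrightarrow> App s' t'"
| par_Lam: "t \<Rrightarrow> t' \<Longrightarrow> Lam t \<Rrightarrow> Lam t'"
| par_beta: "t \<Rrightarrow> t' \<Longrightarrow> u \<Rrightarrow> u' \<Longrightarrow> App (Lam t) u \<Rrightarrow> inst 0 u' t'"
| par_eta: "t \<Rrightarrow> t' \<Longrightarrow> Lam (App (lift 0 t) (Bnd 0)) \<Rrightarrow> t'"

lemma par_refl [simp]: "t \<Rrightarrow> t"
  by (induction t) (auto intro: par.intros)

lemma par_lift: "t \<Rrightarrow> t' \<Longrightarrow> lift k t \<Rrightarrow> lift k t'"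
proof (induction arbitrary: k rule: par.induct)
  case (par_beta t t' u u')
  then show ?case by (simp add: lift_inst_le par.par_beta)
next
  case (par_eta t t')
  then show ?case by (simp add: lift_lift par.par_eta)
qed (auto intro: par.intros)

lemma par_inst: "t \<Rrightarrow> t' \<Longrightarrow> u \<Rrightarrow> u' \<Longrightarrow> inst k u t \<Rrightarrow> inst k u' t'"
proof (induction arbitrary: k u u' rule: par.induct)
  case (par_Lam t t')
  then show ?case by (simp add: par.par_Lam par_lift)
next
  case (par_beta t t' s s')
  then show ?case by (simp add: inst_inst par.par_beta par_lift)
next
  case (par_eta t t')
  then show ?case using par.par_eta[of "inst k u t" "inst k u' t'"]
    by (simp add: lift_inst_ge)
qed (auto intro: par.intros)

text \<open>Reduction creates no new indices, so an index absent from a term is absent from its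
  reducts. This keeps the side condition of eta intact.\<close>

lemma par_liftD: "lift k t \<Rrightarrow> u \<Longrightarrow> \<exists>t'. u = lift k t' \<and> t \<Rrightarrow> t'"
proof (induction "lift k t" u arbitrary: k t rule: par.induct)
  case (par_Var v)
  then show ?case by (intro exI[of _ t]) auto
next
  case (par_Bnd i)
  then show ?case by (intro exI[of _ t]) auto
next
  case (par_Con c)
  then show ?case by (intro exI[of _ t]) auto
next
  case (par_App r r' s s')
  then obtain a b where t: "t = App a b" by (cases t) auto
  with par_App obtain a' b' where "r' = lift k a'" "a \<Rrightarrow> a'" "s' = lift k b'" "b \<Rrightarrow> b'"
    by fastforce
  then show ?case by (intro exI[of _ "App a' b'"]) (simp add: t par.par_App)
next
  case (par_Lam r r')
  then obtain a where t: "t = Lam a" by (cases t) auto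
  with par_Lam obtain a' where "r' = lift (Suc k) a'" "a \<Rrightarrow> a'" by fastforce
  then show ?case by (intro exI[of _ "Lam a'"]) (simp add: t par.par_Lam)
next
  case (par_beta r r' s s')
  then obtain a b where t: "t = App a b" and "Lam r = lift k a" "s = lift k b" by (cases t) auto
  then obtain c where a: "a = Lam c" and "r = lift (Suc k) c" by (cases a) auto
  with par_beta \<open>s = lift k b\<close> obtain c' b' where
    "r' = lift (Suc k) c'" "c \<Rrightarrow> c'" "s' = lift k b'" "b \<Rrightarrow> b'"
    by blast
  then show ?case
    by (intro exI[of _ "inst 0 b' c'"]) (simp add: t a par.par_beta lift_inst_le)
next
  case (par_eta r r')
  then obtain a where t: "t = Lam a" by (cases t) auto
  with par_eta obtain b c where a: "a = App b c" and b: "lift (Suc k) b = lift 0 r"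
    and c: "lift (Suc k) c = Bnd 0" by (cases a) auto
  have c0: "c = Bnd 0" using c by (cases c) (auto split: if_splits)
  obtain q where q: "b = lift 0 q" "r = lift k q" using lift_eq_lift[OF _ b] by blast
  with par_eta obtain q' where "r' = lift k q'" "q \<Rrightarrow> q'" by blast
  then show ?case by (intro exI[of _ q']) (simp add: t a c0 q par.par_eta)
qed

inductive_cases par_AppE [consumes 1]: "App s t \<Rrightarrow> u"
inductive_cases par_LamE [consumes 1]: "Lam t \<Rrightarrow> u"
inductive_cases par_BndE [consumes 1]: "Bnd i \<Rrightarrow> u"

text \<open>The second alternative is the overlap of beta and eta: if \<open>r = Lam q\<close>, the
  body is itself a beta redex, and contracting it gives back a reduct of \<open>q\<close>.\<close>

lemma par_eta_bodyD:
  assumes "App (lift 0 r) (Bnd 0) \<Rrightarrow> u"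
  obtains r' where "u = App (lift 0 r') (Bnd 0)" "r \<Rrightarrow> r'"
  | q where "r = Lam q" "q \<Rrightarrow> u"
  using assms
proof (cases rule: par_AppE)
  case (1 s' t')
  then show ?thesis using that(1) par_liftD[of 0 r s'] by (auto elim: par_BndE)
next
  case (2 t t' u')
  then obtain q where q: "r = Lam q" "t = lift (Suc 0) q" by (cases r) auto
  with 2 obtain q' where "t' = lift (Suc 0) q'" "q \<Rrightarrow> q'" using par_liftD by blast
  moreover have "u' = Bnd 0" using 2 by (auto elim: par_BndE)
  ultimately have "q \<Rrightarrow> u" using 2 by simp
  with q show ?thesis using that(2) by blast
qed

text \<open>The induction is on size because the term to be joined need not be a subterm of
  \<open>s\<close>: at an eta redex it is \<open>r\<close>, while \<open>s\<close> contains
  \<open>lift 0 r\<close>, and in the overlap of beta and eta it is \<open>App r b\<close>.\<close>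

lemma par_diamond: "s \<Rrightarrow> t \<Longrightarrow> s \<Rrightarrow> u \<Longrightarrow> \<exists>v. t \<Rrightarrow> v \<and> u \<Rrightarrow> v"
proof (induction "size s" arbitrary: s t u rule: less_induct)
  case less
  note IH = less(1)
  show ?case
  proof (cases s)
    case (Var x)
    then show ?thesis using less.prems by (auto elim: par.cases)
  next
    case (Bnd x)
    then show ?thesis using less.prems by (auto elim: par.cases)
  next
    case (Con x)
    then show ?thesis using less.prems by (auto elim: par.cases)
  next
    case (App a b)
    have beta: "\<exists>v. App a1 b1 \<Rrightarrow> v \<and> inst 0 b2 c2 \<Rrightarrow> v"
      if a: "a = Lam c" and p: "Lam c \<Rrightarrow> a1" "b \<Rrightarrow> b1" "c \<Rrightarrow> c2" "b \<Rrightarrow> b2" for a1 b1 b2 c c2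
    proof -
      obtain bv where bv: "b1 \<Rrightarrow> bv" "b2 \<Rrightarrow> bv" using IH[OF _ p(2,4)] App by auto
      from p(1) show ?thesis
      proof (cases rule: par_LamE)
        case (1 c1)
        with p obtain cv where "c1 \<Rrightarrow> cv" "c2 \<Rrightarrow> cv" using IH[of c c1 c2] App a by auto
        with bv 1 show ?thesis by (metis par_beta par_inst)
      next
        case (2 r)
        from p(3)[unfolded 2(1)] show ?thesis
        proof (cases rule: par_eta_bodyD)
          case (1 r2)
          obtain rv where "a1 \<Rrightarrow> rv" "r2 \<Rrightarrow> rv"
            using IH[OF _ 2(2) 1(2)] App a 2(1) by auto
          with bv 1 show ?thesis by (auto intro!: exI[of _ "App rv bv"] par_App)
        next
          case (2 q)
          \<comment> \<open>Both reducts of \<open>s\<close> are one parallel step away from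
            \<open>App r b\<close>: one reduces its parts, the other contracts it as the redex
            \<open>App (Lam q) b\<close>.\<close>
          then have "size (App r b) < size s" using App a \<open>c = App (lift 0 r) (Bnd 0)\<close> by simp
          moreover have "App r b \<Rrightarrow> App a1 b1" using \<open>r \<Rrightarrow> a1\<close> p(2) by (rule par_App)
          moreover have "App r b \<Rrightarrow> inst 0 b2 c2" using 2 p(4) by (auto intro: par_beta)
          ultimately show ?thesis using IH by blast
        qed
      qed
    qed
    from less.prems(1)[unfolded App] show ?thesis
    proof (cases rule: par_AppE)
      case (1 a1 b1)
      note t = this
      from less.prems(2)[unfolded App] show ?thesis
      proof (cases rule: par_AppE)
        case (1 a2 b2)
        obtain av bv where "a1 \<Rrightarrow> av" "a2 \<Rrightarrow> av" "b1 \<Rrightarrow> bv" "b2 \<Rrightarrow> bv"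
          using IH[OF _ t(2) 1(2)] IH[OF _ t(3) 1(3)] App by auto
        with t 1 show ?thesis by (auto intro!: exI[of _ "App av bv"] par_App)
      next
        case (2 c c2 b2)
        with t beta[of c a1 b1 c2 b2] show ?thesis by blast
      qed
    next
      case (2 c c1 b1)
      note t = this
      from less.prems(2)[unfolded App] show ?thesis
      proof (cases rule: par_AppE)
        case (1 a2 b2)
        with t beta[of c a2 b2 c1 b1] show ?thesis by blast
      next
        case (2 d c2 b2)
        obtain cv bv where "c1 \<Rrightarrow> cv" "c2 \<Rrightarrow> cv" "b1 \<Rrightarrow> bv" "b2 \<Rrightarrow> bv"
          using IH[of c c1 c2] IH[OF _ t(4) 2(4)] t 2 App by auto
        with t 2 show ?thesis by (auto intro!: exI[of _ "inst 0 bv cv"] par_inst)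
      qed
    qed
  next
    case (Lam c)
    have eta: "\<exists>v. Lam c1 \<Rrightarrow> v \<and> r2 \<Rrightarrow> v"
      if c: "c = App (lift 0 r) (Bnd 0)" and p: "c \<Rrightarrow> c1" "r \<Rrightarrow> r2" for c1 r r2
      using p(1)[unfolded c]
    proof (cases rule: par_eta_bodyD)
      case (1 r1)
      obtain rv where "r1 \<Rrightarrow> rv" "r2 \<Rrightarrow> rv" using IH[OF _ 1(2) p(2)] Lam c by auto
      with 1 show ?thesis by (auto intro: par_eta)
    next
      case (2 q)
      then show ?thesis using IH[of r "Lam c1" r2] p(2) Lam c by (auto intro: par_Lam)
    qed
    from less.prems(1)[unfolded Lam] show ?thesis
    proof (cases rule: par_LamE)
      case (1 c1)
      note t = this
      from less.prems(2)[unfolded Lam] show ?thesis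
      proof (cases rule: par_LamE)
        case (1 c2)
        with t show ?thesis using IH[of c c1 c2] Lam by (auto intro: par_Lam)
      next
        case (2 r)
        with t eta[of r c1 u] show ?thesis by blast
      qed
    next
      case (2 r)
      note t = this
      from less.prems(2)[unfolded Lam] show ?thesis
      proof (cases rule: par_LamE)
        case (1 c2)
        with t eta[of r c2 t] show ?thesis by blast
      next
        case (2 r')
        with t show ?thesis using IH[of r t u] Lam by auto
      qed
    qed
  qed
qed

lemma par_imp_conv: "s \<Rrightarrow> t \<Longrightarrow> s \<approx> t"
proof (induction rule: par.induct)
  case (par_beta t t' u u')
  then show ?case by (meson conv_App conv_Lam conv_beta conv_trans)
next
  case (par_eta t t')
  then show ?case using conv_eta conv_trans by blast
qed (auto intro: conv.intros)

lemma pars_strip: "par\<^sup>*\<^sup>* s t \<Longrightarrow> s \<Rrightarrow> u \<Longrightarrow> \<exists>v. t \<Rrightarrow> v \<and> par\<^sup>*\<^sup>* u v"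
proof (induction arbitrary: rule: rtranclp_induct)
  case base
  then show ?case by blast
next
  case (step y z)
  then show ?case by (meson par_diamond rtranclp.rtrancl_into_rtrancl)
qed

lemma pars_confluent: "par\<^sup>*\<^sup>* s u \<Longrightarrow> par\<^sup>*\<^sup>* s t \<Longrightarrow> \<exists>v. par\<^sup>*\<^sup>* t v \<and> par\<^sup>*\<^sup>* u v"
proof (induction rule: rtranclp_induct)
  case base
  then show ?case by blast
next
  case (step y z)
  then obtain v where v: "par\<^sup>*\<^sup>* t v" "par\<^sup>*\<^sup>* y v" by blast
  then obtain w where "v \<Rrightarrow> w" "par\<^sup>*\<^sup>* z w" using pars_strip step by blast
  with v show ?case by (meson rtranclp.rtrancl_into_rtrancl)
qed

lemma pars_App: "par\<^sup>*\<^sup>* s s' \<Longrightarrow> par\<^sup>*\<^sup>* t t' \<Longrightarrow> par\<^sup>*\<^sup>* (App s t) (App s' t')"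
proof (induction rule: rtranclp_induct)
  case base
  then show ?case
    by (induction rule: rtranclp_induct) (auto intro: rtranclp.rtrancl_into_rtrancl[of par, OF _ par_App])
qed (auto intro: rtranclp.rtrancl_into_rtrancl[of par, OF _ par_App])

lemma pars_Lam: "par\<^sup>*\<^sup>* t t' \<Longrightarrow> par\<^sup>*\<^sup>* (Lam t) (Lam t')"
  by (induction rule: rtranclp_induct) (auto intro: rtranclp.rtrancl_into_rtrancl par_Lam)

theorem church_rosser: "s \<approx> t \<Longrightarrow> \<exists>u. par\<^sup>*\<^sup>* s u \<and> par\<^sup>*\<^sup>* t u"
proof (induction rule: conv.induct)
  case (conv_beta t u)
  then show ?case by (meson par_beta par_refl r_into_rtranclp rtranclp.rtrancl_refl)
next
  case (conv_eta t)
  then show ?case by (meson par_eta par_refl r_into_rtranclp rtranclp.rtrancl_refl)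
next
  case (conv_trans s t u)
  then show ?case by (meson pars_confluent rtranclp_trans)
qed (auto intro: pars_App pars_Lam)

section \<open>Constants applied to arguments behave as free constructors\<close>

lemma spine_eq_iff:
  "foldl App (Con c) ts = foldl App (Con d) us \<longleftrightarrow> c = d \<and> ts = us"
proof (induction ts arbitrary: us rule: rev_induct)
  case Nil
  then show ?case by (cases us rule: rev_cases) auto
next
  case (snoc t ts)
  then show ?case by (cases us rule: rev_cases) auto
qed

text \<open>A constant applied to arguments is never an abstraction, so its head takes part in no
  redex and only the arguments reduce.\<close>

lemma par_spineD:
  "foldl App (Con c) ts \<Rrightarrow> u \<Longrightarrow> \<exists>us. u = foldl App (Con c) us \<and> list_all2 (\<approx>) ts us"
proof (induction ts arbitrary: u rule: rev_induct)
  case Nil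
  then show ?case by (auto elim: par.cases)
next
  case (snoc t ts)
  have not_Lam: "foldl App (Con c) ts \<noteq> Lam r" for r by (cases ts rule: rev_cases) auto
  from snoc.prems have "App (foldl App (Con c) ts) t \<Rrightarrow> u" by simp
  then obtain a b where "u = App a b" "foldl App (Con c) ts \<Rrightarrow> a" "t \<Rrightarrow> b"
    by (cases rule: par_AppE) (use not_Lam in auto)
  with snoc.IH obtain us where "u = foldl App (Con c) (us @ [b])" "list_all2 (\<approx>) (ts @ [t]) (us @ [b])"
    by (fastforce simp: list_all2_appendI par_imp_conv)
  then show ?case by blast
qed

lemma list_all2_conv_trans:
  "list_all2 (\<approx>) ts us \<Longrightarrow> list_all2 (\<approx>) us vs \<Longrightarrow> list_all2 (\<approx>) ts vs"
  by (rule list_all2_trans) (auto intro: conv_trans)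

lemma list_all2_conv_sym: "list_all2 (\<approx>) ts us \<Longrightarrow> list_all2 (\<approx>) us ts"
  by (simp add: list_all2_conv_all_nth conv_sym)

lemma pars_spineD:
  assumes "par\<^sup>*\<^sup>* (foldl App (Con c) ts) u"
  shows "\<exists>us. u = foldl App (Con c) us \<and> list_all2 (\<approx>) ts us"
  using assms
proof (induction rule: rtranclp_induct)
  case base
  then show ?case by (auto simp: list.rel_refl conv_refl)
next
  case (step y z)
  then show ?case by (metis par_spineD list_all2_conv_trans)
qed

lemma conv_spine: "list_all2 (\<approx>) ts us \<Longrightarrow> foldl App t ts \<approx> foldl App t us"
proof -
  have "s \<approx> t \<Longrightarrow> foldl App s ts \<approx> foldl App t us" if "list_all2 (\<approx>) ts us" for s t
    using that by (induction arbitrary: s t rule: list_all2_induct) (auto intro: conv_App)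
  then show "list_all2 (\<approx>) ts us \<Longrightarrow> foldl App t ts \<approx> foldl App t us"
    using conv_refl by blast
qed

text \<open>The common reduct still displays the head and the arity of both sides. This yields
  injectivity and disjointness for all constructors and predicates of the definitions.\<close>

theorem conv_spine_iff:
  "foldl App (Con c) ts \<approx> foldl App (Con d) us \<longleftrightarrow> c = d \<and> list_all2 (\<approx>) ts us"
proof
  assume "foldl App (Con c) ts \<approx> foldl App (Con d) us"
  then obtain w where "par\<^sup>*\<^sup>* (foldl App (Con c) ts) w" "par\<^sup>*\<^sup>* (foldl App (Con d) us) w"
    using church_rosser by blast
  then show "c = d \<and> list_all2 (\<approx>) ts us"
    by (metis pars_spineD spine_eq_iff list_all2_conv_sym list_all2_conv_trans)
qed (auto intro: conv_spine)

section \<open>Typing and substitution\<close>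

lemma finite_fvs [simp]: "finite (fvs t)"
  by (induction t) auto

lemma has_ty_Con_iff [simp]: "has_ty sg \<Delta> (Con c) \<tau> \<longleftrightarrow> ctype sg c = Some \<tau>"
  by (auto elim: has_ty.cases intro: ty_Con)

lemma has_ty_Bnd_iff [simp]: "has_ty sg \<Delta> (Bnd i) \<tau> \<longleftrightarrow> i < length \<Delta> \<and> \<tau> = \<Delta> ! i"
  by (auto elim: has_ty.cases intro: ty_Bnd)

lemma has_ty_Var_iff [simp]: "has_ty sg \<Delta> (Var v) \<tau> \<longleftrightarrow> ofree \<tau> \<and> \<tau> = snd v"
  by (auto elim: has_ty.cases intro: ty_Var)

lemma has_ty_App_iff: "has_ty sg \<Delta> (App t u) \<tau> \<longleftrightarrow> (\<exists>\<sigma>. has_ty sg \<Delta> t (\<sigma> \<rightarrow>\<^sub>t \<tau>) \<and> has_ty sg \<Delta> u \<sigma>)"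
  by (auto elim: has_ty.cases intro: ty_App)

lemma has_ty_Lam_iff [simp]: "has_ty sg \<Delta> (Lam t) (\<sigma> \<rightarrow>\<^sub>t \<tau>) \<longleftrightarrow> has_ty sg (\<sigma> # \<Delta>) t \<tau>"
  by (auto elim: has_ty.cases intro: ty_Lam)

lemma ctype_quantifier_iff [simp]:
  "ctype sg (LAll \<tau>) = Some \<rho> \<longleftrightarrow> ofree \<tau> \<and> \<rho> = (\<tau> \<rightarrow>\<^sub>t Prop) \<rightarrow>\<^sub>t Prop"
  "ctype sg (LEx \<tau>) = Some \<rho> \<longleftrightarrow> ofree \<tau> \<and> \<rho> = (\<tau> \<rightarrow>\<^sub>t Prop) \<rightarrow>\<^sub>t Prop"
  by auto

declare ctype.simps(6,7) [simp del]

lemma has_ty_App_Con [simp]: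
  "has_ty sg \<Delta> (App (Con c) u) \<tau> \<longleftrightarrow> (\<exists>\<sigma>. ctype sg c = Some (\<sigma> \<rightarrow>\<^sub>t \<tau>) \<and> has_ty sg \<Delta> u \<sigma>)"
  "has_ty sg \<Delta> (App (App (Con c) u) v) \<tau> \<longleftrightarrow>
    (\<exists>\<rho> \<sigma>. ctype sg c = Some (\<rho> \<rightarrow>\<^sub>t \<sigma> \<rightarrow>\<^sub>t \<tau>) \<and> has_ty sg \<Delta> u \<rho> \<and> has_ty sg \<Delta> v \<sigma>)"
  "has_ty sg \<Delta> (App (App (App (Con c) u) v) w) \<tau> \<longleftrightarrow>
    (\<exists>\<pi> \<rho> \<sigma>. ctype sg c = Some (\<pi> \<rightarrow>\<^sub>t \<rho> \<rightarrow>\<^sub>t \<sigma> \<rightarrow>\<^sub>t \<tau>) \<and>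
      has_ty sg \<Delta> u \<pi> \<and> has_ty sg \<Delta> v \<rho> \<and> has_ty sg \<Delta> w \<sigma>)"
  by (auto simp: has_ty_App_iff)

lemma has_ty_append: "has_ty sg \<Delta> t \<tau> \<Longrightarrow> has_ty sg (\<Delta> @ \<Delta>') t \<tau>"
proof (induction rule: has_ty.induct)
  case (ty_Bnd i \<Delta>)
  then show ?case by (simp add: nth_append)
next
  case (ty_App \<Delta> t \<sigma> \<tau> u)
  then show ?case by (auto simp: has_ty_App_iff)
qed auto

lemma has_ty_closed: "has_ty sg [] t \<tau> \<Longrightarrow> has_ty sg (\<sigma> # \<Delta>) t \<tau>"
  using has_ty_append[of sg "[]"] by fastforce

lemma has_ty_lift: "has_ty sg \<Delta> t \<tau> \<Longrightarrow> length \<Delta> \<le> k \<Longrightarrow> lift k t = t"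
  by (induction arbitrary: k rule: has_ty.induct) auto

lemma has_ty_inst: "has_ty sg \<Delta> t \<tau> \<Longrightarrow> length \<Delta> \<le> k \<Longrightarrow> inst k u t = t"
  by (induction arbitrary: k u rule: has_ty.induct) auto

text \<open>Typing in the empty context means that no index dangles; named variables may occur. Such
  terms pass under binders unchanged, which lets later proofs erase the lifts in their
  formulas.\<close>

lemma lift_closed: "has_ty sg [] t \<tau> \<Longrightarrow> lift k t = t"
  and inst_closed: "has_ty sg [] t \<tau> \<Longrightarrow> inst k u t = t"
  by (auto intro: has_ty_lift has_ty_inst)

lemma has_ty_close:
  "has_ty sg \<Delta> t \<tau> \<Longrightarrow> has_ty sg (\<Delta> @ [snd v]) (close (length \<Delta>) v t) \<tau>"
proof (induction rule: has_ty.induct)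
  case (ty_App \<Delta> t \<sigma> \<tau> u)
  then show ?case by (auto simp: has_ty_App_iff)
qed (auto simp: nth_append)

text \<open>Links the two kinds of variables: contracting \<open>App (lam v t) x\<close> substitutes
  \<open>x\<close> for the named variable \<open>v\<close>. The lifts that \<open>inst\<close>
  applies to \<open>x\<close> under binders do nothing, as \<open>x\<close> is locally
  closed.\<close>

lemma inst_close:
  assumes "has_ty sg [] x \<sigma>"
  shows "has_ty sg \<Delta> t \<tau> \<Longrightarrow> inst (length \<Delta>) x (close (length \<Delta>) v t) = subst (Var(v := x)) t"
  by (induction rule: has_ty.induct) (auto simp: lift_closed[OF assms])

text \<open>\<open>is_subst\<close> without finite support: the substitution acting on a clause is a
  unifier composed with a renaming of all variables, and its support may be infinite.\<close>

definition typed_subst :: "('c \<Rightarrow> 'b ty option) \<Rightarrow> ('b, 'c) sub \<Rightarrow> bool" where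
  "typed_subst sg \<theta> \<longleftrightarrow> (\<forall>v. ofree (snd v) \<longrightarrow> has_ty sg [] (\<theta> v) (snd v))"

lemma is_subst_typed: "is_subst sg \<theta> \<Longrightarrow> typed_subst sg \<theta>"
  by (simp add: is_subst_def typed_subst_def)

lemma is_subst_Var: "is_subst sg Var"
  by (simp add: is_subst_def)

lemma is_subst_upd:
  assumes "is_subst sg \<theta>" "has_ty sg [] t (snd v)"
  shows "is_subst sg (\<theta>(v := t))"
proof -
  have "{w. (\<theta>(v := t)) w \<noteq> Var w} \<subseteq> insert v {w. \<theta> w \<noteq> Var w}" by auto
  then have "finite {w. (\<theta>(v := t)) w \<noteq> Var w}"
    by (rule finite_subset) (use assms(1) in \<open>simp add: is_subst_def\<close>)
  with assms show ?thesis by (auto simp: is_subst_def)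
qed

lemma has_ty_subst: "has_ty sg \<Delta> t \<tau> \<Longrightarrow> typed_subst sg \<theta> \<Longrightarrow> has_ty sg \<Delta> (subst \<theta> t) \<tau>"
proof (induction rule: has_ty.induct)
  case (ty_Var v \<Delta>)
  then have "has_ty sg [] (\<theta> v) (snd v)" by (simp add: typed_subst_def del: split_paired_All)
  then show ?case using has_ty_append[of sg "[]" _ _ \<Delta>] by simp
next
  case (ty_App \<Delta> t \<sigma> \<tau> u)
  then show ?case by (auto simp: has_ty_App_iff)
qed auto

lemma subst_Var [simp]: "subst Var t = t"
  by (induction t) auto

lemma subst_rename: "subst \<theta> (subst (Var \<circ> \<pi>) t) = subst (\<lambda>v. \<theta> (\<pi> v)) t"
  by (induction t) auto

lemma subst_spine: "subst \<theta> (foldl App t ts) = foldl App (subst \<theta> t) (map (subst \<theta>) ts)"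
  by (induction ts arbitrary: t) auto

lemma fresh_var: "finite (W :: 'b var set) \<Longrightarrow> \<exists>y. (y, \<tau>) \<notin> W"
proof -
  assume "finite W"
  then have "finite (fst ` W)" by simp
  then obtain y where "y \<notin> fst ` W" using ex_new_if_finite infinite_UNIV_nat by blast
  then show ?thesis by force
qed

lemma renaming_apart:
  assumes "finite (W :: 'b var set)"
  shows "\<exists>\<pi>. renaming \<pi> \<and> range \<pi> \<inter> W = {}"
proof -
  obtain n where n: "\<And>m. m \<in> fst ` W \<Longrightarrow> m < n"
    using assms finite_nat_set_iff_bounded[of "fst ` W"] by auto
  define \<pi> where "\<pi> = (\<lambda>v :: 'b var. (fst v + n, snd v))"
  have "renaming \<pi>" by (auto simp: renaming_def \<pi>_def inj_def)
  moreover have "range \<pi> \<inter> W = {}"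
  proof -
    have "\<pi> v \<notin> W" for v using n[of "fst v + n"] by (force simp: \<pi>_def)
    then show ?thesis by blast
  qed
  ultimately show ?thesis by blast
qed

section \<open>Natural deduction\<close>

lemma fm_simps [simp]:
  "fm sg \<^bold>\<top>" "fm sg \<^bold>\<bottom>"
  "fm sg (A \<^bold>\<and> B) \<longleftrightarrow> fm sg A \<and> fm sg B"
  "fm sg (A \<^bold>\<or> B) \<longleftrightarrow> fm sg A \<and> fm sg B"
  "fm sg (A \<^bold>\<longrightarrow> B) \<longleftrightarrow> fm sg A \<and> fm sg B"
  "fm sg (natp t) \<longleftrightarrow> has_ty sg [] t Nt"
  "fm sg (qAll \<tau> (Lam C)) \<longleftrightarrow> ofree \<tau> \<and> has_ty sg [\<tau>] C Prop"
  "fm sg (qEx \<tau> (Lam C)) \<longleftrightarrow> ofree \<tau> \<and> has_ty sg [\<tau>] C Prop"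
  by (auto simp: fm_def)

lemma fm_App_Lam: "has_ty sg [\<tau>] B Prop \<Longrightarrow> has_ty sg [] t \<tau> \<Longrightarrow> fm sg (App (Lam B) t)"
  by (auto simp: fm_def has_ty_App_iff[of _ _ "Lam _"])

lemma derives_fm: "derives sg D \<Gamma> C \<Longrightarrow> fms sg \<Gamma> \<and> fm sg C"
proof (induction rule: derives.induct)
  case (exR \<Gamma> B t \<tau>)
  then show ?case by (auto simp: fm_def)
next
  case (natR_s \<Gamma> I)
  then show ?case by (auto simp: fm_def)
qed (auto simp: fm_def)

section \<open>Admissible structural rules of the calculus\<close>

lemma subst_ground: "fvs t = {} \<Longrightarrow> subst \<theta> t = t"
  by (induction t) auto

text \<open>The calculus has no weakening rule, and adding a formula throughout a derivation can
  fail: it may contain an eigenvariable, and \<open>defL\<close> would substitute in it. Ground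
  formulas meet neither obstacle.\<close>

lemma derives_weaken_ground:
  assumes "derives sg D \<Gamma> C" "fms sg \<Delta>" "fvms \<Delta> = {}"
  shows "derives sg D (\<Gamma> + \<Delta>) C"
  using assms(1)
proof (induction rule: derives.induct)
  case (botL \<Gamma> B)
  then show ?case using derives.botL[of "\<Gamma> + \<Delta>" sg B D] assms(2) by (simp add: ball_Un)
next
  case (topR \<Gamma>)
  then show ?case using derives.topR[of "\<Gamma> + \<Delta>" sg D] assms(2) by (simp add: ball_Un)
next
  case (init A \<Gamma>)
  then show ?case using derives.init[of A sg "\<Gamma> + \<Delta>" D] assms(2) by (simp add: ball_Un)
next
  case (allR \<Gamma> B y \<tau>)
  then show ?case using derives.allR[of sg D "\<Gamma> + \<Delta>" B y \<tau>] assms(3) by auto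
next
  case (exL B y \<tau> \<Gamma> C)
  then show ?case using derives.exL[of sg D B y \<tau> "\<Gamma> + \<Delta>" C] assms(3) by auto
next
  \<comment> \<open>The contexts of a cut are added up, so the new formulas go to the right premise
    only.\<close>
  case (cut \<Gamma>' B \<Gamma> C)
  then show ?case using derives.cut[of sg D \<Gamma>' B "\<Gamma> + \<Delta>" C] by (simp add: add.assoc)
next
  case (natR_z \<Gamma>)
  then show ?case using derives.natR_z[of "\<Gamma> + \<Delta>" sg D] assms(2) by (simp add: ball_Un)
next
  \<comment> \<open>The two induction premises admit no side formulas; only the third premise is
    weakened.\<close>
  case (natL B I j \<Gamma> C)
  then show ?case using derives.natL[of sg B I j D "\<Gamma> + \<Delta>" C] by simp
next
  case (defR c \<theta> p us \<Gamma>)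
  then show ?case using derives.defR[of c D sg \<theta> p us "\<Gamma> + \<Delta>"] by blast
next
  case (defL p us \<Gamma> C W \<pi> S)
  have ground: "image_mset (subst \<theta>) \<Delta> = \<Delta>" for \<theta>
    using assms(3) by (induction \<Delta>) (auto simp: subst_ground)
  have "derives sg D (add_mset (p \<^bold>\<cdot> us) (\<Gamma> + \<Delta>)) C"
  proof (rule derives.defL[where \<pi> = \<pi> and S = S and W = W])
    show "W = fvs (p \<^bold>\<cdot> us) \<union> fvms (\<Gamma> + \<Delta>) \<union> fvs C" using defL(4) assms(3) by auto
    fix c \<theta> assume "c \<in> D" "cpred c = p" "\<theta> \<in> S c"
    then show "derives sg D (add_mset (subst \<theta> (subst (Var \<circ> \<pi> c) (cbody c)))
        (image_mset (subst \<theta>) (\<Gamma> + \<Delta>))) (subst \<theta> C)"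
      using defL.IH[of c \<theta>] by (simp add: ground)
  qed (use defL.hyps assms(2) in auto)
  then show ?case by simp
next
  case (convL B \<Gamma> C B')
  then show ?case using derives.convL[of sg D B "\<Gamma> + \<Delta>" C B'] by simp
next
  case (convR \<Gamma> C C')
  then show ?case using derives.convR[of sg D "\<Gamma> + \<Delta>" C C'] by simp
qed (unfold union_mset_add_mset_left,
    (rule derives.andL1 derives.andL2 derives.andR derives.orL derives.orR1 derives.orR2 derives.impL
      derives.impR derives.allL derives.exR derives.natR_s derives.contrL; assumption)+)

text \<open>Open formulas may clash with the eigenvariable conditions; a cut with the ground formula
  \<open>\<top>\<close> reduces them to the previous lemma.\<close>

lemma derives_weaken:
  assumes "derives sg D \<Gamma> C" "fms sg \<Delta>"
  shows "derives sg D (\<Delta> + \<Gamma>) C"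
  using cut[OF topR[OF assms(2)], of D \<Gamma> C] derives_weaken_ground[OF assms(1), of "{#\<^bold>\<top>#}"] by simp

lemma derives_contract:
  "derives sg D (\<Gamma> + \<Delta>) C \<Longrightarrow> set_mset \<Gamma> \<subseteq> set_mset \<Delta> \<Longrightarrow> derives sg D \<Delta> C"
proof (induction \<Gamma>)
  case (add x \<Gamma>)
  then obtain \<Delta>' where "\<Delta> = add_mset x \<Delta>'" by (auto dest: multi_member_split)
  with add show ?case by (auto dest: contrL)
qed simp

lemma derives_mono:
  assumes "derives sg D \<Gamma> C" "set_mset \<Gamma> \<subseteq> set_mset \<Delta>" "fms sg \<Delta>"
  shows "derives sg D \<Delta> C"
  using derives_contract[of sg D \<Gamma> \<Delta>] derives_weaken[OF assms(1,3)] assms(2)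
  by (simp add: add.commute)

lemma derives_cut:
  assumes "derives sg D \<Gamma> B" "derives sg D (add_mset B \<Gamma>) C"
  shows "derives sg D \<Gamma> C"
  using derives_contract[OF cut[OF assms]] by simp

lemma derives_trans:
  assumes "derives sg D {#A#} B" "derives sg D \<Gamma> A"
  shows "derives sg D \<Gamma> B"
  using cut[OF assms(2,1)] by simp

text \<open>Lets a proof by \<open>defL\<close> run in a small context whose substitution instances
  are known; cuts then replace its hypotheses by derivations from \<open>\<Gamma>\<close>.\<close>

lemma derives_multicut:
  assumes "derives sg D \<Delta> C" "\<And>A. A \<in># \<Delta> \<Longrightarrow> derives sg D \<Gamma> A" "fms sg \<Gamma>"
  shows "derives sg D \<Gamma> C"
proof -
  have "derives sg D (\<Delta> + \<Gamma>) C" using derives_weaken[OF assms(1,3)] by (simp add: add.commute)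
  with assms(2) derives_fm[OF assms(1)] show ?thesis
  proof (induction \<Delta>)
    case (add A \<Delta>)
    then have "derives sg D (\<Delta> + \<Gamma>) A" by (intro derives_weaken) auto
    with add.prems(3) have "derives sg D (\<Delta> + \<Gamma>) C" using derives_cut by auto
    with add show ?case by auto
  qed simp
qed

text \<open>Initial sequents are restricted to atoms, hence the identity axiom has to be established
  for each formula that is used as a lemma.\<close>

definition okf :: "('c \<Rightarrow> 'b ty option) \<Rightarrow> ('b, 'c) clause set \<Rightarrow> ('b, 'c) tm \<Rightarrow> bool" where
  "okf sg D A \<longleftrightarrow> fm sg A \<and> (\<forall>\<Gamma>. fms sg \<Gamma> \<longrightarrow> derives sg D (add_mset A \<Gamma>) A)"

lemma okfI: "derives sg D {#A#} A \<Longrightarrow> okf sg D A"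
  using derives_fm[of sg D "{#A#}" A] derives_weaken[of sg D "{#A#}" A] by (auto simp: okf_def)

lemma okf_fm: "okf sg D A \<Longrightarrow> fm sg A"
  by (simp add: okf_def)

lemma derives_assm: "okf sg D A \<Longrightarrow> fms sg \<Gamma> \<Longrightarrow> A \<in># \<Gamma> \<Longrightarrow> derives sg D \<Gamma> A"
  by (auto simp: okf_def dest!: multi_member_split)

lemma okf_atom: "fm sg (p \<^bold>\<cdot> ts) \<Longrightarrow> okf sg D (p \<^bold>\<cdot> ts)"
  using init[of "p \<^bold>\<cdot> ts" sg _ D] by (auto simp: okf_def atomic_def)

lemma okf_nat: "has_ty sg [] t Nt \<Longrightarrow> okf sg D (natp t)"
  by (auto simp: okf_def atomic_def intro!: init)

lemma okf_and: "okf sg D A \<Longrightarrow> okf sg D B \<Longrightarrow> okf sg D (A \<^bold>\<and> B)"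
  by (auto simp: okf_def intro!: andR intro: andL1 andL2)

lemma okf_imp:
  assumes "okf sg D A" "okf sg D B"
  shows "okf sg D (A \<^bold>\<longrightarrow> B)"
proof (rule okfI)
  have "derives sg D (add_mset (A \<^bold>\<longrightarrow> B) {#A#}) B"
    using assms by (intro impL) (auto simp: okf_def)
  then show "derives sg D {#A \<^bold>\<longrightarrow> B#} (A \<^bold>\<longrightarrow> B)"
    by (intro impR) (simp add: add_mset_commute)
qed

text \<open>The rule needs only one fresh variable, which is chosen here. Later proofs are uniform
  in the term anyway, so asking for all terms hides eigenvariables and beta steps from them.
  \<open>exE_term\<close> follows the same plan.\<close>

lemma allI_term:
  assumes "fms sg \<Gamma>" "fm sg (qAll \<tau> (Lam B))"
    and "\<And>x. has_ty sg [] x \<tau> \<Longrightarrow> derives sg D \<Gamma> (inst 0 x B)"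
  shows "derives sg D \<Gamma> (qAll \<tau> (Lam B))"
proof -
  obtain y where y: "(y, \<tau>) \<notin> fvms \<Gamma> \<union> fvs (Lam B)"
    using fresh_var[of "fvms \<Gamma> \<union> fvs (Lam B)"] by auto
  have "derives sg D \<Gamma> (App (Lam B) (Var (y, \<tau>)))"
    by (rule convR[OF assms(3) conv_sym[OF conv_beta]])
      (use assms(2) in \<open>auto intro: fm_App_Lam\<close>)
  then show ?thesis using assms(2) y by (intro allR) auto
qed

lemma exE_term:
  assumes "derives sg D \<Gamma> (qEx \<tau> (Lam B))" "fm sg C"
    and "\<And>x. has_ty sg [] x \<tau> \<Longrightarrow> derives sg D (add_mset (inst 0 x B) \<Gamma>) C"
  shows "derives sg D \<Gamma> C"
proof -
  have fm: "fm sg (qEx \<tau> (Lam B))" using derives_fm[OF assms(1)] by simp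
  obtain y where y: "(y, \<tau>) \<notin> fvms \<Gamma> \<union> fvs (Lam B) \<union> fvs C"
    using fresh_var[of "fvms \<Gamma> \<union> fvs (Lam B) \<union> fvs C"] by auto
  have "derives sg D (add_mset (App (Lam B) (Var (y, \<tau>))) \<Gamma>) C"
    by (rule convL[OF assms(3) conv_sym[OF conv_beta]])
      (use fm in \<open>auto intro: fm_App_Lam\<close>)
  then have "derives sg D (add_mset (qEx \<tau> (Lam B)) \<Gamma>) C" using fm y by (intro exL) auto
  then show ?thesis using derives_cut assms(1) by blast
qed

lemma allE_term:
  assumes "derives sg D \<Gamma> (qAll \<tau> (Lam B))" "has_ty sg [] t \<tau>" "okf sg D (inst 0 t B)"
  shows "derives sg D \<Gamma> (inst 0 t B)"
proof -
  have fm: "fm sg (qAll \<tau> (Lam B))" "fms sg \<Gamma>" using derives_fm[OF assms(1)] by simp_all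
  have "derives sg D (add_mset (App (Lam B) t) \<Gamma>) (inst 0 t B)"
    by (rule convL[OF _ conv_sym[OF conv_beta]])
      (use fm assms(2,3) in \<open>auto simp: okf_def intro: fm_App_Lam\<close>)
  then have "derives sg D (add_mset (qAll \<tau> (Lam B)) \<Gamma>) (inst 0 t B)"
    using fm assms(2) by (intro allL) auto
  then show ?thesis using derives_cut assms(1) by blast
qed

lemma exI_term:
  assumes "derives sg D \<Gamma> (inst 0 t B)" "has_ty sg [] t \<tau>" "fm sg (qEx \<tau> (Lam B))"
  shows "derives sg D \<Gamma> (qEx \<tau> (Lam B))"
proof -
  have "derives sg D \<Gamma> (App (Lam B) t)"
    by (rule convR[OF assms(1) conv_sym[OF conv_beta]])
      (use assms in \<open>auto intro: fm_App_Lam\<close>)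
  then show ?thesis using assms by (intro exR) auto
qed

lemma okf_all:
  assumes "fm sg (qAll \<tau> (Lam B))" "\<And>x. has_ty sg [] x \<tau> \<Longrightarrow> okf sg D (inst 0 x B)"
  shows "okf sg D (qAll \<tau> (Lam B))"
proof (rule okfI, rule allI_term)
  fix x assume x: "has_ty sg [] x \<tau>"
  have "derives sg D {#App (Lam B) x#} (inst 0 x B)"
    by (rule convL[OF _ conv_sym[OF conv_beta]])
      (use assms x in \<open>auto simp: okf_def intro: fm_App_Lam\<close>)
  then show "derives sg D {#qAll \<tau> (Lam B)#} (inst 0 x B)"
    using assms(1) x by (intro allL) auto
qed (use assms in auto)

lemma okf_ex:
  assumes fm: "fm sg (qEx \<tau> (Lam B))" and ok: "\<And>x. has_ty sg [] x \<tau> \<Longrightarrow> okf sg D (inst 0 x B)"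
  shows "okf sg D (qEx \<tau> (Lam B))"
proof (rule okfI)
  obtain y where y: "(y, \<tau>) \<notin> fvs (Lam B)"
    using fresh_var[of "fvs (Lam B)"] by auto
  have v: "has_ty sg [] (Var (y, \<tau>)) \<tau>" using fm by simp
  have "derives sg D {#inst 0 (Var (y, \<tau>)) B#} (qEx \<tau> (Lam B))"
    by (rule exI_term[OF _ v fm]) (use ok[OF v] in \<open>auto simp: okf_def\<close>)
  then have "derives sg D {#App (Lam B) (Var (y, \<tau>))#} (qEx \<tau> (Lam B))"
    by (rule convL[OF _ conv_sym[OF conv_beta]])
      (use fm in \<open>auto intro: fm_App_Lam\<close>)
  then show "derives sg D {#qEx \<tau> (Lam B)#} (qEx \<tau> (Lam B))"
    using fm y by (intro exL) auto
qed

lemma impE: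
  assumes "derives sg D \<Gamma> (A \<^bold>\<longrightarrow> B)" "derives sg D \<Gamma> A" "okf sg D B"
  shows "derives sg D \<Gamma> B"
proof -
  have "derives sg D (add_mset (A \<^bold>\<longrightarrow> B) \<Gamma>) B"
    using assms derives_fm[OF assms(2)] by (intro impL) (auto simp: okf_def)
  then show ?thesis using derives_cut assms(1) by blast
qed

lemma andE1:
  assumes "derives sg D \<Gamma> (A \<^bold>\<and> B)" "okf sg D A"
  shows "derives sg D \<Gamma> A"
proof -
  have "derives sg D (add_mset (A \<^bold>\<and> B) \<Gamma>) A"
    using assms(2) derives_fm[OF assms(1)] by (intro andL1) (auto simp: okf_def)
  then show ?thesis using derives_cut assms(1) by blast
qed

lemma andE2:
  assumes "derives sg D \<Gamma> (A \<^bold>\<and> B)" "okf sg D B"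
  shows "derives sg D \<Gamma> B"
proof -
  have "derives sg D (add_mset (A \<^bold>\<and> B) \<Gamma>) B"
    using assms(2) derives_fm[OF assms(1)] by (intro andL2) (auto simp: okf_def)
  then show ?thesis using derives_cut assms(1) by blast
qed

text \<open>\<open>natL\<close> wants an object-level abstraction, obtained by abstracting a named
  variable in \<open>P\<close>. Condition \<open>subst_P\<close> makes \<open>App B t\<close>
  convertible to \<open>P t\<close>. It also leaves no room for free parameters in \<open>P\<close>,
  so these have to be quantified inside the formula.\<close>

lemma nat_induction:
  assumes subst_P: "\<And>\<theta> t. typed_subst sg \<theta> \<Longrightarrow> has_ty sg [] t Nt \<Longrightarrow> subst \<theta> (P t) = P (subst \<theta> t)"
    and ok: "\<And>t. has_ty sg [] t Nt \<Longrightarrow> okf sg D (P t)"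
    and zero: "derives sg D {#} (P zr)"
    and Suc: "\<And>t. has_ty sg [] t Nt \<Longrightarrow> derives sg D {#P t#} (P (sc t))"
    and I: "derives sg D \<Gamma> (natp I)"
  shows "derives sg D \<Gamma> (P I)"
proof -
  define v :: "'a var" where "v = (0, Nt)"
  define B where "B = lam v (P (Var v))"
  have v: "has_ty sg [] (Var v) Nt" by (simp add: v_def)
  have fmP: "has_ty sg [] (P t) Prop" if "has_ty sg [] t Nt" for t
    using ok[OF that] by (simp add: okf_def fm_def)
  have tyB: "has_ty sg [] B (Nt \<rightarrow>\<^sub>t Prop)"
    using has_ty_close[OF fmP[OF v], of v] by (simp add: B_def lam_def v_def)
  obtain j where j: "(j, Nt) \<notin> fvs B" using fresh_var[of "fvs B"] by auto
  have fmB: "fm sg (App B t)" if "has_ty sg [] t Nt" for t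
    using that tyB by (auto simp: fm_def has_ty_App_iff)
  have conv: "App B t \<approx> P t" if t: "has_ty sg [] t Nt" for t
  proof -
    have "typed_subst sg (Var(v := t))" using t by (auto simp: typed_subst_def v_def)
    then have "subst (Var(v := t)) (P (Var v)) = P t" using subst_P[OF _ v] by simp
    then show ?thesis
      using conv_beta[of "close 0 v (P (Var v))" t] inst_close[OF t fmP[OF v], of v]
      by (simp add: B_def lam_def)
  qed
  have I_ty: "has_ty sg [] I Nt" and \<Gamma>: "fms sg \<Gamma>" using derives_fm[OF I] by auto
  have "derives sg D (add_mset (natp I) \<Gamma>) (P I)"
  proof (rule natL[OF tyB I_ty j])
    show "derives sg D {#} (App B zr)"
      by (rule convR[OF zero conv_sym[OF conv] fmB]) auto
    have "derives sg D {#P (Var (j, Nt))#} (App B (sc (Var (j, Nt))))"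
      by (rule convR[OF Suc conv_sym[OF conv] fmB]) auto
    then show "derives sg D {#App B (Var (j, Nt))#} (App B (sc (Var (j, Nt))))"
      by (rule convL[OF _ conv_sym[OF conv] fmB]) auto
    show "derives sg D (add_mset (App B I) \<Gamma>) (P I)"
      by (rule convL[OF _ conv_sym[OF conv] fmB]) (use I_ty ok[OF I_ty] \<Gamma> in \<open>auto simp: okf_def\<close>)
  qed
  then show ?thesis using derives_cut I by blast
qed

text \<open>The left rule for definitions with the set of all unifiers as complete set of unifiers;
  \<open>\<sigma>\<close> is the part of the unifier that acts on the clause, after the renaming.\<close>

lemma defL_unifiers:
  fixes D :: "('b, 'c) clause set"
  assumes "fm sg (p \<^bold>\<cdot> us)" "fms sg \<Gamma>" "fm sg C"
    and prems: "\<And>c \<theta> \<sigma>. c \<in> D \<Longrightarrow> cpred c = p \<Longrightarrow> typed_subst sg \<theta> \<Longrightarrow> typed_subst sg \<sigma> \<Longrightarrow>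
      list_all2 (\<approx>) (map (subst \<theta>) us) (map (subst \<sigma>) (cargs c)) \<Longrightarrow>
      derives sg D (add_mset (subst \<sigma> (cbody c)) (image_mset (subst \<theta>) \<Gamma>)) (subst \<theta> C)"
  shows "derives sg D (add_mset (p \<^bold>\<cdot> us) \<Gamma>) C"
proof -
  define W where "W = fvs (p \<^bold>\<cdot> us) \<union> fvms \<Gamma> \<union> fvs C"
  have "finite W" by (simp add: W_def)
  then obtain \<pi> where \<pi>: "renaming \<pi>" "range \<pi> \<inter> W = {}" using renaming_apart by blast
  define S where "S = (\<lambda>c. {\<theta>. unifier sg \<theta> (p \<^bold>\<cdot> us) (subst (Var \<circ> \<pi>) (chead c))})"
  show ?thesis
  proof (rule defL[OF assms(1-3) W_def, where \<pi> = "\<lambda>_. \<pi>" and S = S])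
    fix c :: "('b, 'c) clause"
    show "renaming \<pi>" by fact
    show "\<pi> ` (fvs (chead c) \<union> fvs (cbody c)) \<inter> W = {}" using \<pi>(2) by blast
    \<comment> \<open>Every unifier factors through itself by the identity substitution, so the set
      of all unifiers is complete.\<close>
    show "csu sg (W \<union> \<pi> ` (fvs (chead c) \<union> fvs (cbody c))) (p \<^bold>\<cdot> us) (subst (Var \<circ> \<pi>) (chead c)) (S c)"
      unfolding csu_def S_def using is_subst_Var conv_refl by (metis mem_Collect_eq subst_Var)
    fix \<theta> assume c: "c \<in> D" "cpred c = p" and "\<theta> \<in> S c"
    then have \<theta>: "typed_subst sg \<theta>"
      and "subst \<theta> (p \<^bold>\<cdot> us) \<approx> subst \<theta> (subst (Var \<circ> \<pi>) (chead c))"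
      by (auto simp: S_def unifier_def is_subst_typed)
    \<comment> \<open>The equal heads cancel. Renaming apart followed by \<open>\<theta>\<close> is
      one substitution, which plays the role of \<open>\<sigma>\<close>.\<close>
    then have "list_all2 (\<approx>) (map (subst \<theta>) us) (map (subst (\<lambda>v. \<theta> (\<pi> v))) (cargs c))"
      using c(2) by (simp add: chead_def subst_spine conv_spine_iff subst_rename[unfolded comp_def] comp_def)
    moreover have "typed_subst sg (\<lambda>v. \<theta> (\<pi> v))"
      using \<theta> \<pi>(1) unfolding typed_subst_def renaming_def by metis
    ultimately show "derives sg D (add_mset (subst \<theta> (subst (Var \<circ> \<pi>) (cbody c)))
        (image_mset (subst \<theta>) \<Gamma>)) (subst \<theta> C)"
      using prems[OF c \<theta>] by (simp add: subst_rename)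
  qed
qed

section \<open>The object logic\<close>

lemma has_ty_lift_Cons:
  "has_ty sg (\<Delta>' @ \<Delta>) t \<tau> \<Longrightarrow> has_ty sg (\<Delta>' @ \<sigma> # \<Delta>) (lift (length \<Delta>') t) \<tau>"
proof (induction "\<Delta>' @ \<Delta>" t \<tau> arbitrary: \<Delta>' rule: has_ty.induct)
  case (ty_App t \<sigma> \<tau> u)
  then show ?case by (auto simp: has_ty_App_iff)
next
  case (ty_Lam \<rho> t \<tau>)
  then show ?case using ty_Lam.hyps(2)[of "\<rho> # \<Delta>'"] by simp
qed (auto simp: nth_append Suc_diff_le)

lemma has_ty_lift_0 [simp]: "has_ty sg \<Delta> t \<tau> \<Longrightarrow> has_ty sg (\<sigma> # \<Delta>) (lift 0 t) \<tau>"
  using has_ty_lift_Cons[of sg "[]"] by simp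

lemma inst_Suc_lift [simp]: "inst (Suc k) (lift 0 u) (lift 0 t) = lift 0 (inst k u t)"
  by (simp add: lift_inst_ge)

text \<open>Opaque names for atoms and constructors, so that simplification treats them as units and
  does not unfold them into nested applications.\<close>

definition seq :: "'k otm \<Rightarrow> 'k otm \<Rightarrow> 'k otm \<Rightarrow> 'k otm" where "seq i l b = Seq \<^bold>\<cdot> [i, l, b]"
definition element :: "'k otm \<Rightarrow> 'k otm \<Rightarrow> 'k otm" where "element a l = Element \<^bold>\<cdot> [a, l]"
definition prog :: "'k otm \<Rightarrow> 'k otm \<Rightarrow> 'k otm" where "prog a b = Prog \<^bold>\<cdot> [a, b]"
definition cons :: "'k otm \<Rightarrow> 'k otm \<Rightarrow> 'k otm" where "cons a l = LCons \<^bold>\<cdot> [a, l]"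
definition ang :: "'k otm \<Rightarrow> 'k otm" where "ang a = Ang \<^bold>\<cdot> [a]"
definition ott :: "'k otm" where "ott = TT \<^bold>\<cdot> []"
definition amp :: "'k otm \<Rightarrow> 'k otm \<Rightarrow> 'k otm" where "amp b c = Amp \<^bold>\<cdot> [b, c]"
definition arrow :: "'k otm \<Rightarrow> 'k otm \<Rightarrow> 'k otm" where "arrow a b = Arrow \<^bold>\<cdot> [a, b]"
definition bigand :: "'k otm \<Rightarrow> 'k otm" where "bigand f = BigAnd \<^bold>\<cdot> [f]"

lemmas object_defs = seq_def element_def prog_def cons_def ang_def ott_def amp_def arrow_def bigand_def

lemma subst_object [simp]:
  "subst \<theta> (seq i l b) = seq (subst \<theta> i) (subst \<theta> l) (subst \<theta> b)"
  "subst \<theta> (element a l) = element (subst \<theta> a) (subst \<theta> l)"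
  "subst \<theta> (prog a b) = prog (subst \<theta> a) (subst \<theta> b)"
  "subst \<theta> (cons a l) = cons (subst \<theta> a) (subst \<theta> l)"
  "subst \<theta> (ang a) = ang (subst \<theta> a)"
  "subst \<theta> ott = ott"
  "subst \<theta> (amp b c) = amp (subst \<theta> b) (subst \<theta> c)"
  "subst \<theta> (arrow a b) = arrow (subst \<theta> a) (subst \<theta> b)"
  "subst \<theta> (bigand f) = bigand (subst \<theta> f)"
  by (simp_all add: object_defs)

lemma inst_object [simp]:
  "inst k u (seq i l b) = seq (inst k u i) (inst k u l) (inst k u b)"
  "inst k u (element a l) = element (inst k u a) (inst k u l)"
  "inst k u (prog a b) = prog (inst k u a) (inst k u b)"
  "inst k u (cons a l) = cons (inst k u a) (inst k u l)"
  "inst k u (ang a) = ang (inst k u a)"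
  "inst k u ott = ott"
  "inst k u (amp b c) = amp (inst k u b) (inst k u c)"
  "inst k u (arrow a b) = arrow (inst k u a) (inst k u b)"
  "inst k u (bigand f) = bigand (inst k u f)"
  by (simp_all add: object_defs)

lemma has_ty_object [simp]:
  "has_ty (osig ext) \<Delta> (seq i l b) \<tau> \<longleftrightarrow> \<tau> = Prop \<and> has_ty (osig ext) \<Delta> i Nt \<and>
    has_ty (osig ext) \<Delta> l atmlst \<and> has_ty (osig ext) \<Delta> b prp"
  "has_ty (osig ext) \<Delta> (element a l) \<tau> \<longleftrightarrow> \<tau> = Prop \<and> has_ty (osig ext) \<Delta> a atm \<and>
    has_ty (osig ext) \<Delta> l atmlst"
  "has_ty (osig ext) \<Delta> (prog a b) \<tau> \<longleftrightarrow> \<tau> = Prop \<and> has_ty (osig ext) \<Delta> a atm \<and>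
    has_ty (osig ext) \<Delta> b prp"
  "has_ty (osig ext) \<Delta> (cons a l) \<tau> \<longleftrightarrow> \<tau> = atmlst \<and> has_ty (osig ext) \<Delta> a atm \<and>
    has_ty (osig ext) \<Delta> l atmlst"
  "has_ty (osig ext) \<Delta> (ang a) \<tau> \<longleftrightarrow> \<tau> = prp \<and> has_ty (osig ext) \<Delta> a atm"
  "has_ty (osig ext) \<Delta> ott \<tau> \<longleftrightarrow> \<tau> = prp"
  "has_ty (osig ext) \<Delta> (amp b c) \<tau> \<longleftrightarrow> \<tau> = prp \<and> has_ty (osig ext) \<Delta> b prp \<and>
    has_ty (osig ext) \<Delta> c prp"
  "has_ty (osig ext) \<Delta> (arrow a b) \<tau> \<longleftrightarrow> \<tau> = prp \<and> has_ty (osig ext) \<Delta> a atm \<and>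
    has_ty (osig ext) \<Delta> b prp"
  "has_ty (osig ext) \<Delta> (bigand f) \<tau> \<longleftrightarrow> \<tau> = prp \<and> has_ty (osig ext) \<Delta> f (ind \<rightarrow>\<^sub>t prp)"
  by (auto simp: object_defs)

lemma fm_object [simp]:
  "fm (osig ext) (seq i l b) \<longleftrightarrow>
    has_ty (osig ext) [] i Nt \<and> has_ty (osig ext) [] l atmlst \<and> has_ty (osig ext) [] b prp"
  "fm (osig ext) (element a l) \<longleftrightarrow> has_ty (osig ext) [] a atm \<and> has_ty (osig ext) [] l atmlst"
  "fm (osig ext) (prog a b) \<longleftrightarrow> has_ty (osig ext) [] a atm \<and> has_ty (osig ext) [] b prp"
  by (simp_all add: fm_def)

lemma conv_object_cong:
  "i \<approx> i' \<Longrightarrow> l \<approx> l' \<Longrightarrow> b \<approx> b' \<Longrightarrow> seq i l b \<approx> seq i' l' b'"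
  "a \<approx> a' \<Longrightarrow> l \<approx> l' \<Longrightarrow> element a l \<approx> element a' l'"
  "a \<approx> a' \<Longrightarrow> l \<approx> l' \<Longrightarrow> cons a l \<approx> cons a' l'"
  "a \<approx> a' \<Longrightarrow> ang a \<approx> ang a'"
  by (simp_all only: object_defs conv_spine_iff) simp_all

lemma conv_nt_iff:
  "zr \<approx> sc i \<longleftrightarrow> False"
  "sc i \<approx> sc i' \<longleftrightarrow> i \<approx> i'"
  using conv_spine_iff[of Zr "[]" Sc "[i]"] conv_spine_iff[of Sc "[i]" Sc "[i']"] by simp_all

lemma conv_object_iff:
  "cons a l \<approx> cons a' l' \<longleftrightarrow> a \<approx> a' \<and> l \<approx> l'"
  "ang a \<approx> ang a' \<longleftrightarrow> a \<approx> a'"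
  "ang a \<approx> ott \<longleftrightarrow> False"
  "bigand f \<approx> ang a \<longleftrightarrow> False"
  "bigand f \<approx> ott \<longleftrightarrow> False"
  "bigand f \<approx> amp b c \<longleftrightarrow> False"
  "bigand f \<approx> arrow a b \<longleftrightarrow> False"
  "bigand f \<approx> bigand f' \<longleftrightarrow> f \<approx> f'"
  unfolding object_defs conv_spine_iff by simp_all

locale object_logic =
  fixes ext :: "'k \<Rightarrow> sort ty option"
begin

abbreviation wt :: "'k otm \<Rightarrow> sort ty \<Rightarrow> bool" where
  "wt t \<tau> \<equiv> has_ty (osig ext) [] t \<tau>"

abbreviation DD :: "'k oclause set" where
  "DD \<equiv> D_nat \<union> D_list \<union> D_intuit"

abbreviation entails :: "'k otm multiset \<Rightarrow> 'k otm \<Rightarrow> bool" (infix \<open>\<turnstile>\<close> 45) where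
  "\<Gamma> \<turnstile> C \<equiv> derives (osig ext) DD \<Gamma> C"

abbreviation ok :: "'k otm \<Rightarrow> bool" where
  "ok \<equiv> okf (osig ext) DD"

abbreviation tsub :: "(sort, 'k ocon) sub \<Rightarrow> bool" where
  "tsub \<equiv> typed_subst (osig ext)"

lemma wt_subst [simp]: "wt t \<tau> \<Longrightarrow> tsub \<theta> \<Longrightarrow> wt (subst \<theta> t) \<tau>"
  by (rule has_ty_subst)

lemma wt_App [simp]:
  "has_ty (osig ext) \<Delta> f (ind \<rightarrow>\<^sub>t prp) \<Longrightarrow> has_ty (osig ext) \<Delta> x ind \<Longrightarrow> has_ty (osig ext) \<Delta> (App f x) prp"
  by (rule ty_App)

lemma ok_object [simp]:
  "ok (seq i l b) \<longleftrightarrow> wt i Nt \<and> wt l atmlst \<and> wt b prp"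
  "ok (element a l) \<longleftrightarrow> wt a atm \<and> wt l atmlst"
  "ok (prog a b) \<longleftrightarrow> wt a atm \<and> wt b prp"
  using okf_atom[of "osig ext" Seq "[i, l, b]" DD] okf_atom[of "osig ext" Element "[a, l]" DD]
    okf_atom[of "osig ext" Prog "[a, b]" DD] fm_object[of ext] okf_fm[of "osig ext" DD]
  by (metis object_defs)+

subsection \<open>Right rules\<close>

lemma seq_R_element:
  assumes "\<Gamma> \<turnstile> element a (cons x l)" "wt i Nt"
  shows "\<Gamma> \<turnstile> seq i (cons x l) (ang a)"
proof -
  \<comment> \<open>The variables are those of the clause as named in \<open>D_intuit\<close>; the
    other right rules instantiate their clauses in the same way.\<close>
  let ?\<theta> = "Var((0, Nt) := i, (0, atm) := a, (1, atm) := x, (0, atmlst) := l)"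
  have ty: "wt a atm" "wt x atm" "wt l atmlst" using derives_fm[OF assms(1)] by auto
  have \<theta>: "is_subst (osig ext) ?\<theta>" using assms ty by (intro is_subst_upd is_subst_Var) auto
  show ?thesis unfolding seq_def
    by (rule defR[OF _ \<theta>, where c = "Clause Seq [Var (0, Nt), Var (1, atm) \<^bold>:\<^bold>: Var (0, atmlst),
          Ang \<^bold>\<cdot> [Var (0, atm)]] (Element \<^bold>\<cdot> [Var (0, atm), Var (1, atm) \<^bold>:\<^bold>: Var (0, atmlst)])"])
      (use assms ty in \<open>auto simp: D_intuit_def chead_def fm_def object_defs Let_def intro: conv_refl\<close>)
qed

lemma seq_R_tt:
  assumes "fms (osig ext) \<Gamma>" "wt i Nt" "wt l atmlst"
  shows "\<Gamma> \<turnstile> seq i l ott"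
proof -
  let ?\<theta> = "Var((0, Nt) := i, (0, atmlst) := l)"
  have \<theta>: "is_subst (osig ext) ?\<theta>" using assms by (intro is_subst_upd is_subst_Var) auto
  show ?thesis unfolding seq_def
    by (rule defR[OF _ \<theta>, where c = "Clause Seq [Var (0, Nt), Var (0, atmlst), TT \<^bold>\<cdot> []] \<^bold>\<top>"])
      (use assms in \<open>auto simp: D_intuit_def chead_def fm_def object_defs Let_def
        intro: conv_refl topR\<close>)
qed

lemma seq_R_amp:
  assumes "\<Gamma> \<turnstile> seq i l b" "\<Gamma> \<turnstile> seq i l c"
  shows "\<Gamma> \<turnstile> seq (sc i) l (amp b c)"
proof -
  let ?\<theta> = "Var((0, Nt) := i, (0, atmlst) := l, (0, prp) := b, (1, prp) := c)"
  have ty: "wt i Nt" "wt l atmlst" "wt b prp" "wt c prp"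
    using derives_fm[OF assms(1)] derives_fm[OF assms(2)] by auto
  have \<theta>: "is_subst (osig ext) ?\<theta>" using ty by (intro is_subst_upd is_subst_Var) auto
  show ?thesis unfolding seq_def
    by (rule defR[OF _ \<theta>, where c = "Clause Seq [sc (Var (0, Nt)), Var (0, atmlst),
          Amp \<^bold>\<cdot> [Var (0, prp), Var (1, prp)]]
          (Seq \<^bold>\<cdot> [Var (0, Nt), Var (0, atmlst), Var (0, prp)] \<^bold>\<and>
           Seq \<^bold>\<cdot> [Var (0, Nt), Var (0, atmlst), Var (1, prp)])"])
      (use andR[OF assms] ty in \<open>auto simp: D_intuit_def chead_def fm_def object_defs Let_def
        intro: conv_refl\<close>)
qed

lemma seq_R_arrow:
  assumes "\<Gamma> \<turnstile> seq i (cons a l) b"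
  shows "\<Gamma> \<turnstile> seq (sc i) l (arrow a b)"
proof -
  let ?\<theta> = "Var((0, Nt) := i, (0, atmlst) := l, (0, atm) := a, (0, prp) := b)"
  have ty: "wt i Nt" "wt l atmlst" "wt b prp" "wt a atm" using derives_fm[OF assms(1)] by auto
  have \<theta>: "is_subst (osig ext) ?\<theta>" using ty by (intro is_subst_upd is_subst_Var) auto
  show ?thesis unfolding seq_def
    by (rule defR[OF _ \<theta>, where c = "Clause Seq [sc (Var (0, Nt)), Var (0, atmlst),
          Arrow \<^bold>\<cdot> [Var (0, atm), Var (0, prp)]]
          (Seq \<^bold>\<cdot> [Var (0, Nt), Var (0, atm) \<^bold>:\<^bold>: Var (0, atmlst), Var (0, prp)])"])
      (use assms ty in \<open>auto simp: D_intuit_def chead_def fm_def object_defs Let_def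
        intro: conv_refl\<close>)
qed

lemma seq_R_bigand:
  assumes "fms (osig ext) \<Gamma>" "wt i Nt" "wt l atmlst" "wt f (ind \<rightarrow>\<^sub>t prp)"
    and "\<And>x. wt x ind \<Longrightarrow> \<Gamma> \<turnstile> seq i l (App f x)"
  shows "\<Gamma> \<turnstile> seq (sc i) l (bigand f)"
proof -
  let ?\<theta> = "Var((0, Nt) := i, (0, atmlst) := l, (0, ind \<rightarrow>\<^sub>t prp) := f)"
  have \<theta>: "is_subst (osig ext) ?\<theta>" using assms by (intro is_subst_upd is_subst_Var) auto
  have "\<Gamma> \<turnstile> qAll ind (Lam (seq i l (App f (Bnd 0))))"
    by (rule allI_term) (use assms in \<open>auto simp: inst_closed has_ty_closed\<close>)
  then show ?thesis unfolding seq_def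
    by (intro defR[OF _ \<theta>, where c = "Clause Seq [sc (Var (0, Nt)), Var (0, atmlst),
          BigAnd \<^bold>\<cdot> [Var (0, ind \<rightarrow>\<^sub>t prp)]]
          (\<^bold>\<forall>(0, ind)\<^bold>. Seq \<^bold>\<cdot> [Var (0, Nt), Var (0, atmlst),
            App (Var (0, ind \<rightarrow>\<^sub>t prp)) (Var (0, ind))])"])
      (use assms in \<open>auto simp: D_intuit_def chead_def fm_def object_defs lam_def Let_def
        intro: conv_refl\<close>)
qed

lemma seq_R_prog:
  assumes "\<Gamma> \<turnstile> prog a b" "\<Gamma> \<turnstile> seq i l b"
  shows "\<Gamma> \<turnstile> seq (sc i) l (ang a)"
proof -
  let ?\<theta> = "Var((0, Nt) := i, (0, atmlst) := l, (0, atm) := a)"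
  have ty: "wt i Nt" "wt l atmlst" "wt b prp" "wt a atm"
    using derives_fm[OF assms(1)] derives_fm[OF assms(2)] by auto
  have \<theta>: "is_subst (osig ext) ?\<theta>" using ty by (intro is_subst_upd is_subst_Var) auto
  have "\<Gamma> \<turnstile> qEx prp (Lam (prog a (Bnd 0) \<^bold>\<and> seq i l (Bnd 0)))"
    by (rule exI_term[where t = b])
      (use andR[OF assms] ty in \<open>auto simp: inst_closed has_ty_closed\<close>)
  then show ?thesis unfolding seq_def
    by (intro defR[OF _ \<theta>, where c = "Clause Seq [sc (Var (0, Nt)), Var (0, atmlst), Ang \<^bold>\<cdot> [Var (0, atm)]]
          (\<^bold>\<exists>(2, prp)\<^bold>. Prog \<^bold>\<cdot> [Var (0, atm), Var (2, prp)] \<^bold>\<and>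
            Seq \<^bold>\<cdot> [Var (0, Nt), Var (0, atmlst), Var (2, prp)])"])
      (use ty in \<open>auto simp: D_intuit_def chead_def fm_def object_defs lam_def Let_def
        intro: conv_refl\<close>)
qed

lemma element_R_here:
  assumes "fms (osig ext) \<Gamma>" "wt a atm" "wt l atmlst"
  shows "\<Gamma> \<turnstile> element a (cons a l)"
proof -
  let ?\<theta> = "Var((0, atm) := a, (0, atmlst) := l)"
  have \<theta>: "is_subst (osig ext) ?\<theta>" using assms by (intro is_subst_upd is_subst_Var) auto
  show ?thesis unfolding element_def
    by (rule defR[OF _ \<theta>, where c = "Clause Element [Var (0, atm), Var (0, atm) \<^bold>:\<^bold>: Var (0, atmlst)] \<^bold>\<top>"])
      (use assms in \<open>auto simp: D_list_def chead_def fm_def object_defs Let_def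
        intro: conv_refl topR\<close>)
qed

lemma element_R_there:
  assumes "\<Gamma> \<turnstile> element a l" "wt x atm"
  shows "\<Gamma> \<turnstile> element a (cons x l)"
proof -
  let ?\<theta> = "Var((0, atm) := a, (1, atm) := x, (0, atmlst) := l)"
  have ty: "wt a atm" "wt l atmlst" using derives_fm[OF assms(1)] by auto
  have \<theta>: "is_subst (osig ext) ?\<theta>" using assms ty by (intro is_subst_upd is_subst_Var) auto
  show ?thesis unfolding element_def
    by (rule defR[OF _ \<theta>, where c = "Clause Element [Var (0, atm), Var (1, atm) \<^bold>:\<^bold>: Var (0, atmlst)]
        (Element \<^bold>\<cdot> [Var (0, atm), Var (0, atmlst)])"])
      (use assms ty in \<open>auto simp: D_list_def chead_def fm_def object_defs Let_def
        intro: conv_refl\<close>)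
qed

subsection \<open>Left rules\<close>

lemma typed_substD: "tsub \<theta> \<Longrightarrow> ofree \<tau> \<Longrightarrow> wt (\<theta> (n, \<tau>)) \<tau>"
  by (auto simp: typed_subst_def)

lemma derives_weaken_top:
  assumes "\<Gamma> \<turnstile> C"
  shows "add_mset \<^bold>\<top> \<Gamma> \<turnstile> C"
  using derives_weaken[OF assms, of "{#\<^bold>\<top>#}"] by simp

text \<open>\<open>\<theta>\<close> may instantiate variables of \<open>l\<close> and of the
  context, so the shape of the list enters each case only as an equation up to conversion, next to
  the instantiated context.\<close>

lemma element_L:
  assumes ty: "wt a atm" "wt l atmlst" and \<Gamma>: "fms (osig ext) \<Gamma>" and C: "fm (osig ext) C"
    and here: "\<And>\<theta> l'. tsub \<theta> \<Longrightarrow> wt l' atmlst \<Longrightarrow> subst \<theta> l \<approx> cons (subst \<theta> a) l' \<Longrightarrow>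
      image_mset (subst \<theta>) \<Gamma> \<turnstile> subst \<theta> C"
    and there: "\<And>\<theta> x l'. tsub \<theta> \<Longrightarrow> wt x atm \<Longrightarrow> wt l' atmlst \<Longrightarrow> subst \<theta> l \<approx> cons x l' \<Longrightarrow>
      add_mset (element (subst \<theta> a) l') (image_mset (subst \<theta>) \<Gamma>) \<turnstile> subst \<theta> C"
  shows "add_mset (element a l) \<Gamma> \<turnstile> C"
  unfolding element_def
proof (rule defL_unifiers)
  fix c \<theta> \<sigma>
  assume c: "c \<in> DD" "cpred c = Element" and \<theta>: "tsub \<theta>" and \<sigma>: "tsub \<sigma>"
    and eq: "list_all2 (\<approx>) (map (subst \<theta>) [a, l]) (map (subst \<sigma>) (cargs c))"
  note [simp] = typed_substD[OF \<sigma>]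
  from c consider
    (here) "c = Clause Element [Var (0, atm), Var (0, atm) \<^bold>:\<^bold>: Var (0, atmlst)] \<^bold>\<top>"
  | (there) "c = Clause Element [Var (0, atm), Var (1, atm) \<^bold>:\<^bold>: Var (0, atmlst)]
        (Element \<^bold>\<cdot> [Var (0, atm), Var (0, atmlst)])"
    by (auto simp: D_nat_def D_list_def D_intuit_def Let_def)
  then show "add_mset (subst \<sigma> (cbody c)) (image_mset (subst \<theta>) \<Gamma>) \<turnstile> subst \<theta> C"
  proof cases
    case here
    have "subst \<theta> a \<approx> \<sigma> (0, atm)" "subst \<theta> l \<approx> cons (\<sigma> (0, atm)) (\<sigma> (0, atmlst))"
      using eq by (simp_all add: here cons_def)
    then have "subst \<theta> l \<approx> cons (subst \<theta> a) (\<sigma> (0, atmlst))"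
      by (meson conv_object_cong(3) conv_refl conv_sym conv_trans)
    then show ?thesis using assms(5)[OF \<theta>, of "\<sigma> (0, atmlst)"]
      by (simp add: here derives_weaken_top)
  next
    case there
    have "subst \<theta> a \<approx> \<sigma> (0, atm)" "subst \<theta> l \<approx> cons (\<sigma> (1, atm)) (\<sigma> (0, atmlst))"
      using eq by (simp_all add: there cons_def)
    then have "add_mset (element (\<sigma> (0, atm)) (\<sigma> (0, atmlst))) (image_mset (subst \<theta>) \<Gamma>) \<turnstile> subst \<theta> C"
      by (intro convL[OF assms(6)[OF \<theta>, of "\<sigma> (1, atm)" "\<sigma> (0, atmlst)"]] conv_object_cong conv_refl) simp_all
    then show ?thesis by (simp add: there element_def)
  qed
qed (use ty \<Gamma> C in \<open>auto simp: fm_def element_def\<close>)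

text \<open>There is one case per clause, with the list of the clause always traded for
  \<open>subst \<theta> l\<close>. In the initial clause this forgets that the list is a cons, which
  membership in it implies anyway. Two clauses, \<open>init\<close> and \<open>prog\<close>, reach
  an atom.\<close>

lemma seq_L:
  assumes ty: "wt i Nt" "wt l atmlst" "wt b prp" and \<Gamma>: "fms (osig ext) \<Gamma>" and C: "fm (osig ext) C"
    and init: "\<And>\<theta> a. tsub \<theta> \<Longrightarrow> wt a atm \<Longrightarrow> subst \<theta> b \<approx> ang a \<Longrightarrow>
      add_mset (element a (subst \<theta> l)) (image_mset (subst \<theta>) \<Gamma>) \<turnstile> subst \<theta> C"
    and tt: "\<And>\<theta>. tsub \<theta> \<Longrightarrow> subst \<theta> b \<approx> ott \<Longrightarrow> image_mset (subst \<theta>) \<Gamma> \<turnstile> subst \<theta> C"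
    and amp: "\<And>\<theta> i' b1 b2. tsub \<theta> \<Longrightarrow> wt i' Nt \<Longrightarrow> wt b1 prp \<Longrightarrow> wt b2 prp \<Longrightarrow>
      subst \<theta> i \<approx> sc i' \<Longrightarrow> subst \<theta> b \<approx> amp b1 b2 \<Longrightarrow>
      add_mset (seq i' (subst \<theta> l) b1 \<^bold>\<and> seq i' (subst \<theta> l) b2) (image_mset (subst \<theta>) \<Gamma>) \<turnstile> subst \<theta> C"
    and arrow: "\<And>\<theta> i' a b'. tsub \<theta> \<Longrightarrow> wt i' Nt \<Longrightarrow> wt a atm \<Longrightarrow> wt b' prp \<Longrightarrow>
      subst \<theta> i \<approx> sc i' \<Longrightarrow> subst \<theta> b \<approx> arrow a b' \<Longrightarrow>
      add_mset (seq i' (cons a (subst \<theta> l)) b') (image_mset (subst \<theta>) \<Gamma>) \<turnstile> subst \<theta> C"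
    and bigand: "\<And>\<theta> i' f. tsub \<theta> \<Longrightarrow> wt i' Nt \<Longrightarrow> wt f (ind \<rightarrow>\<^sub>t prp) \<Longrightarrow>
      subst \<theta> i \<approx> sc i' \<Longrightarrow> subst \<theta> b \<approx> bigand f \<Longrightarrow>
      add_mset (qAll ind (Lam (seq i' (subst \<theta> l) (App f (Bnd 0))))) (image_mset (subst \<theta>) \<Gamma>) \<turnstile> subst \<theta> C"
    and prog: "\<And>\<theta> i' a. tsub \<theta> \<Longrightarrow> wt i' Nt \<Longrightarrow> wt a atm \<Longrightarrow>
      subst \<theta> i \<approx> sc i' \<Longrightarrow> subst \<theta> b \<approx> ang a \<Longrightarrow>
      add_mset (qEx prp (Lam (prog a (Bnd 0) \<^bold>\<and> seq i' (subst \<theta> l) (Bnd 0)))) (image_mset (subst \<theta>) \<Gamma>) \<turnstile> subst \<theta> C"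
  shows "add_mset (seq i l b) \<Gamma> \<turnstile> C"
  unfolding seq_def
proof (rule defL_unifiers)
  fix c \<theta> \<sigma>
  assume c: "c \<in> DD" "cpred c = Seq" and \<theta>: "tsub \<theta>" and \<sigma>: "tsub \<sigma>"
    and eq: "list_all2 (\<approx>) (map (subst \<theta>) [i, l, b]) (map (subst \<sigma>) (cargs c))"
  note [simp] = typed_substD[OF \<sigma>]
  let ?I = "Var (0, Nt) :: 'k otm" and ?L = "Var (0, atmlst) :: 'k otm" and ?A = "Var (0, atm) :: 'k otm"
    and ?B = "Var (0, prp) :: 'k otm" and ?C = "Var (1, prp) :: 'k otm"
    and ?F = "Var (0, ind \<rightarrow>\<^sub>t prp) :: 'k otm"
  have cong: "seq i' l1 b' \<approx> seq i' l2 b'" "cons a l1 \<approx> cons a l2" "element a l1 \<approx> element a l2"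
    if "l1 \<approx> l2" for i' a b' l1 l2 :: "'k otm"
    using that by (auto intro: conv_object_cong conv_refl)
  from c consider
    (init) "c = Clause Seq [?I, Var (1, atm) \<^bold>:\<^bold>: ?L, Ang \<^bold>\<cdot> [?A]] (Element \<^bold>\<cdot> [?A, Var (1, atm) \<^bold>:\<^bold>: ?L])"
  | (tt) "c = Clause Seq [?I, ?L, TT \<^bold>\<cdot> []] \<^bold>\<top>"
  | (amp) "c = Clause Seq [sc ?I, ?L, Amp \<^bold>\<cdot> [?B, ?C]] (Seq \<^bold>\<cdot> [?I, ?L, ?B] \<^bold>\<and> Seq \<^bold>\<cdot> [?I, ?L, ?C])"
  | (arrow) "c = Clause Seq [sc ?I, ?L, Arrow \<^bold>\<cdot> [?A, ?B]] (Seq \<^bold>\<cdot> [?I, ?A \<^bold>:\<^bold>: ?L, ?B])"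
  | (bigand) "c = Clause Seq [sc ?I, ?L, BigAnd \<^bold>\<cdot> [?F]] (\<^bold>\<forall>(0, ind)\<^bold>. Seq \<^bold>\<cdot> [?I, ?L, App ?F (Var (0, ind))])"
  | (prog) "c = Clause Seq [sc ?I, ?L, Ang \<^bold>\<cdot> [?A]]
      (\<^bold>\<exists>(2, prp)\<^bold>. Prog \<^bold>\<cdot> [?A, Var (2, prp)] \<^bold>\<and> Seq \<^bold>\<cdot> [?I, ?L, Var (2, prp)])"
    by (auto simp: D_nat_def D_list_def D_intuit_def Let_def)
  then show "add_mset (subst \<sigma> (cbody c)) (image_mset (subst \<theta>) \<Gamma>) \<turnstile> subst \<theta> C"
  proof cases
    case init
    have "subst \<theta> b \<approx> ang (\<sigma> (0, atm))" and l: "subst \<theta> l \<approx> cons (\<sigma> (1, atm)) (\<sigma> (0, atmlst))"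
      using eq by (simp_all add: init cons_def ang_def)
    then have "add_mset (element (\<sigma> (0, atm)) (cons (\<sigma> (1, atm)) (\<sigma> (0, atmlst))))
        (image_mset (subst \<theta>) \<Gamma>) \<turnstile> subst \<theta> C"
      by (intro convL[OF assms(6)[OF \<theta>, of "\<sigma> (0, atm)"]] cong) simp_all
    then show ?thesis by (simp add: init element_def cons_def)
  next
    case tt
    have "subst \<theta> b \<approx> ott" using eq by (simp add: tt ott_def)
    then show ?thesis using assms(7)[OF \<theta>] by (simp add: tt derives_weaken_top)
  next
    case amp
    have "subst \<theta> i \<approx> sc (\<sigma> (0, Nt))" "subst \<theta> b \<approx> amp (\<sigma> (0, prp)) (\<sigma> (1, prp))"
      and l: "subst \<theta> l \<approx> \<sigma> (0, atmlst)"
      using eq by (simp_all add: amp amp_def)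
    then have "add_mset (seq (\<sigma> (0, Nt)) (\<sigma> (0, atmlst)) (\<sigma> (0, prp)) \<^bold>\<and>
        seq (\<sigma> (0, Nt)) (\<sigma> (0, atmlst)) (\<sigma> (1, prp))) (image_mset (subst \<theta>) \<Gamma>) \<turnstile> subst \<theta> C"
      by (intro convL[OF assms(8)[OF \<theta>, of "\<sigma> (0, Nt)" "\<sigma> (0, prp)" "\<sigma> (1, prp)"]] cong conv_App conv_refl)
        simp_all
    then show ?thesis by (simp add: amp seq_def)
  next
    case arrow
    have "subst \<theta> i \<approx> sc (\<sigma> (0, Nt))" "subst \<theta> b \<approx> arrow (\<sigma> (0, atm)) (\<sigma> (0, prp))"
      and l: "subst \<theta> l \<approx> \<sigma> (0, atmlst)"
      using eq by (simp_all add: arrow arrow_def)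
    then have "add_mset (seq (\<sigma> (0, Nt)) (cons (\<sigma> (0, atm)) (\<sigma> (0, atmlst))) (\<sigma> (0, prp)))
        (image_mset (subst \<theta>) \<Gamma>) \<turnstile> subst \<theta> C"
      by (intro convL[OF assms(9)[OF \<theta>, of "\<sigma> (0, Nt)" "\<sigma> (0, atm)" "\<sigma> (0, prp)"]] cong) simp_all
    then show ?thesis by (simp add: arrow seq_def cons_def)
  next
    case bigand
    have "subst \<theta> i \<approx> sc (\<sigma> (0, Nt))" "subst \<theta> b \<approx> bigand (\<sigma> (0, ind \<rightarrow>\<^sub>t prp))"
      and l: "subst \<theta> l \<approx> \<sigma> (0, atmlst)"
      using eq by (simp_all add: bigand bigand_def)
    then have "add_mset (qAll ind (Lam (seq (\<sigma> (0, Nt)) (\<sigma> (0, atmlst)) (App (\<sigma> (0, ind \<rightarrow>\<^sub>t prp)) (Bnd 0)))))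
        (image_mset (subst \<theta>) \<Gamma>) \<turnstile> subst \<theta> C"
      by (intro convL[OF assms(10)[OF \<theta>, of "\<sigma> (0, Nt)" "\<sigma> (0, ind \<rightarrow>\<^sub>t prp)"]] cong conv_App[OF conv_refl] conv_Lam)
        (simp_all add: has_ty_closed)
    then show ?thesis by (simp add: bigand seq_def lam_def)
  next
    case prog
    have "subst \<theta> i \<approx> sc (\<sigma> (0, Nt))" "subst \<theta> b \<approx> ang (\<sigma> (0, atm))"
      and l: "subst \<theta> l \<approx> \<sigma> (0, atmlst)"
      using eq by (simp_all add: prog ang_def)
    then have "add_mset (qEx prp (Lam (prog (\<sigma> (0, atm)) (Bnd 0) \<^bold>\<and>
        seq (\<sigma> (0, Nt)) (\<sigma> (0, atmlst)) (Bnd 0)))) (image_mset (subst \<theta>) \<Gamma>) \<turnstile> subst \<theta> C"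
      by (intro convL[OF assms(11)[OF \<theta>, of "\<sigma> (0, Nt)" "\<sigma> (0, atm)"]] cong conv_App[OF conv_refl] conv_Lam)
        (simp_all add: has_ty_closed)
    then show ?thesis by (simp add: prog seq_def prog_def lam_def)
  qed
qed (use ty \<Gamma> C in \<open>auto simp: fm_def seq_def\<close>)

end

subsection \<open>Transfer of derivations\<close>

text \<open>The hypothesis of \<open>transfer\<close>. For \<open>j = zr\<close> it amounts to
  inclusion of the elements of \<open>l\<close> in those of \<open>l'\<close>, by
  \<open>seq_element\<close> and \<open>element_seq_zr\<close>.\<close>

definition covers :: "'k otm \<Rightarrow> 'k otm \<Rightarrow> 'k otm \<Rightarrow> 'k otm" where
  "covers j l l' = qAll atm (Lam (element (Bnd 0) (lift 0 l) \<^bold>\<longrightarrow> seq (lift 0 j) (lift 0 l') (ang (Bnd 0))))"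

text \<open>Each quantifier of \<open>transfer\<close> gets its own definition, so that
  instantiating one layer gives a named formula again.\<close>

definition transfer2 :: "'k otm \<Rightarrow> 'k otm \<Rightarrow> 'k otm \<Rightarrow> 'k otm \<Rightarrow> 'k otm \<Rightarrow> 'k otm" where
  "transfer2 j i k b l = qAll atmlst (Lam (covers (lift 0 j) (lift 0 l) (Bnd 0) \<^bold>\<longrightarrow>
    seq (lift 0 i) (lift 0 l) (lift 0 b) \<^bold>\<longrightarrow> seq (lift 0 k) (Bnd 0) (lift 0 b)))"

definition transfer1 :: "'k otm \<Rightarrow> 'k otm \<Rightarrow> 'k otm \<Rightarrow> 'k otm \<Rightarrow> 'k otm" where
  "transfer1 j i k b = qAll atmlst (Lam (transfer2 (lift 0 j) (lift 0 i) (lift 0 k) (lift 0 b) (Bnd 0)))"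

definition transfer :: "'k otm \<Rightarrow> 'k otm \<Rightarrow> 'k otm \<Rightarrow> 'k otm" where
  "transfer j i k = qAll prp (Lam (transfer1 (lift 0 j) (lift 0 i) (lift 0 k) (Bnd 0)))"

lemmas transfer_defs = covers_def transfer2_def transfer1_def transfer_def

lemma inst_transfer [simp]:
  "inst n u (covers j l l') = covers (inst n u j) (inst n u l) (inst n u l')"
  "inst n u (transfer2 j i k b l) = transfer2 (inst n u j) (inst n u i) (inst n u k) (inst n u b) (inst n u l)"
  "inst n u (transfer1 j i k b) = transfer1 (inst n u j) (inst n u i) (inst n u k) (inst n u b)"
  "inst n u (transfer j i k) = transfer (inst n u j) (inst n u i) (inst n u k)"
  by (simp_all add: transfer_defs)

context object_logic
begin

lemma has_ty_transfer [simp]: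
  "has_ty (osig ext) \<Delta> j Nt \<Longrightarrow> has_ty (osig ext) \<Delta> l atmlst \<Longrightarrow> has_ty (osig ext) \<Delta> l' atmlst \<Longrightarrow>
    has_ty (osig ext) \<Delta> (covers j l l') Prop"
  "has_ty (osig ext) \<Delta> j Nt \<Longrightarrow> has_ty (osig ext) \<Delta> i Nt \<Longrightarrow> has_ty (osig ext) \<Delta> k Nt \<Longrightarrow>
    has_ty (osig ext) \<Delta> b prp \<Longrightarrow> has_ty (osig ext) \<Delta> l atmlst \<Longrightarrow>
    has_ty (osig ext) \<Delta> (transfer2 j i k b l) Prop"
  "has_ty (osig ext) \<Delta> j Nt \<Longrightarrow> has_ty (osig ext) \<Delta> i Nt \<Longrightarrow> has_ty (osig ext) \<Delta> k Nt \<Longrightarrow>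
    has_ty (osig ext) \<Delta> b prp \<Longrightarrow> has_ty (osig ext) \<Delta> (transfer1 j i k b) Prop"
  "has_ty (osig ext) \<Delta> j Nt \<Longrightarrow> has_ty (osig ext) \<Delta> i Nt \<Longrightarrow> has_ty (osig ext) \<Delta> k Nt \<Longrightarrow>
    has_ty (osig ext) \<Delta> (transfer j i k) Prop"
  by (simp_all add: transfer_defs)

text \<open>\<open>subst\<close> does not lift the terms that it places under binders. It commutes
  with the lifts in these formulas because locally closed terms are fixed by lifting.\<close>

lemma subst_transfer [simp]:
  assumes [simp]: "tsub \<theta>" "wt j Nt"
  shows "wt l atmlst \<Longrightarrow> wt l' atmlst \<Longrightarrow>
      subst \<theta> (covers j l l') = covers (subst \<theta> j) (subst \<theta> l) (subst \<theta> l')"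
    and "wt i Nt \<Longrightarrow> wt k Nt \<Longrightarrow>
      subst \<theta> (transfer j i k) = transfer (subst \<theta> j) (subst \<theta> i) (subst \<theta> k)"
proof -
  have closed: "lift n t = t" "lift n (subst \<theta> t) = subst \<theta> t" if "wt t \<tau>" for t \<tau> n
    using lift_closed[OF that] lift_closed[OF wt_subst[OF that assms(1)]] by simp_all
  show "wt l atmlst \<Longrightarrow> wt l' atmlst \<Longrightarrow>
      subst \<theta> (covers j l l') = covers (subst \<theta> j) (subst \<theta> l) (subst \<theta> l')"
    by (simp add: covers_def closed closed[OF assms(2)])
  show "wt i Nt \<Longrightarrow> wt k Nt \<Longrightarrow>
      subst \<theta> (transfer j i k) = transfer (subst \<theta> j) (subst \<theta> i) (subst \<theta> k)"
    by (simp add: transfer_defs closed closed[OF assms(2)])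
qed

lemma ok_transfer [simp]:
  assumes [simp]: "wt j Nt"
  shows "wt l atmlst \<Longrightarrow> wt l' atmlst \<Longrightarrow> ok (covers j l l')"
    and "wt i Nt \<Longrightarrow> wt k Nt \<Longrightarrow> wt b prp \<Longrightarrow> wt l atmlst \<Longrightarrow> ok (transfer2 j i k b l)"
    and "wt i Nt \<Longrightarrow> wt k Nt \<Longrightarrow> wt b prp \<Longrightarrow> ok (transfer1 j i k b)"
    and "wt i Nt \<Longrightarrow> wt k Nt \<Longrightarrow> ok (transfer j i k)"
proof -
  show covers: "wt l atmlst \<Longrightarrow> wt l' atmlst \<Longrightarrow> ok (covers j l l')" for l l'
    unfolding covers_def by (intro okf_all) (simp_all add: okf_imp)
  show t2: "wt i Nt \<Longrightarrow> wt k Nt \<Longrightarrow> wt b prp \<Longrightarrow> wt l atmlst \<Longrightarrow> ok (transfer2 j i k b l)" for i k b l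
    unfolding transfer2_def by (intro okf_all) (simp_all add: okf_imp covers)
  show t1: "wt i Nt \<Longrightarrow> wt k Nt \<Longrightarrow> wt b prp \<Longrightarrow> ok (transfer1 j i k b)" for i k b
    unfolding transfer1_def by (intro okf_all) (simp_all add: t2)
  show "wt i Nt \<Longrightarrow> wt k Nt \<Longrightarrow> ok (transfer j i k)"
    unfolding transfer_def by (intro okf_all) (simp_all add: t1)
qed

lemma fm_transfer [simp]:
  "wt j Nt \<Longrightarrow> wt l atmlst \<Longrightarrow> wt l' atmlst \<Longrightarrow> fm (osig ext) (covers j l l')"
  "wt j Nt \<Longrightarrow> wt i Nt \<Longrightarrow> wt k Nt \<Longrightarrow> fm (osig ext) (transfer j i k)"
  by (simp_all add: fm_def)

section \<open>Introduction and elimination of \<open>covers\<close> and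
  \<open>transfer\<close>\<close>

lemma coversI:
  assumes "fms (osig ext) \<Gamma>" "wt j Nt" "wt l atmlst" "wt l' atmlst"
    and "\<And>a. wt a atm \<Longrightarrow> add_mset (element a l) \<Gamma> \<turnstile> seq j l' (ang a)"
  shows "\<Gamma> \<turnstile> covers j l l'"
  unfolding covers_def by (rule allI_term) (use assms in \<open>simp_all add: impR\<close>)

lemma coversE:
  assumes "\<Gamma> \<turnstile> covers j l l'" "\<Gamma> \<turnstile> element a l" "wt j Nt" "wt l' atmlst"
  shows "\<Gamma> \<turnstile> seq j l' (ang a)"
proof -
  have ty: "wt a atm" "wt l atmlst" using derives_fm[OF assms(2)] by auto
  have "\<Gamma> \<turnstile> element a l \<^bold>\<longrightarrow> seq j l' (ang a)"
    using allE_term[OF assms(1)[unfolded covers_def] ty(1)] assms ty by (simp add: okf_imp)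
  then show ?thesis using assms(2) by (rule impE) (use assms ty in simp)
qed

lemma transferI:
  assumes \<Gamma>: "fms (osig ext) \<Gamma>" and [simp]: "wt j Nt" "wt i Nt" "wt k Nt"
    and "\<And>b l l'. wt b prp \<Longrightarrow> wt l atmlst \<Longrightarrow> wt l' atmlst \<Longrightarrow>
      add_mset (seq i l b) (add_mset (covers j l l') \<Gamma>) \<turnstile> seq k l' b"
  shows "\<Gamma> \<turnstile> transfer j i k"
proof -
  have "\<Gamma> \<turnstile> transfer2 j i k b l" if [simp]: "wt b prp" "wt l atmlst" for b l
    unfolding transfer2_def by (rule allI_term) (use assms in \<open>simp_all add: impR\<close>)
  then have "\<Gamma> \<turnstile> transfer1 j i k b" if [simp]: "wt b prp" for b
    unfolding transfer1_def by (intro allI_term) (use \<Gamma> in simp_all)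
  then show ?thesis
    unfolding transfer_def by (intro allI_term) (use \<Gamma> in simp_all)
qed

lemma transferE:
  assumes "\<Gamma> \<turnstile> transfer j i k" "\<Gamma> \<turnstile> covers j l l'" "\<Gamma> \<turnstile> seq i l b"
    and [simp]: "wt j Nt" "wt k Nt" "wt l' atmlst"
  shows "\<Gamma> \<turnstile> seq k l' b"
proof -
  have [simp]: "wt b prp" "wt l atmlst" "wt i Nt" using derives_fm[OF assms(3)] by auto
  have "\<Gamma> \<turnstile> transfer1 j i k b"
    using allE_term[OF assms(1)[unfolded transfer_def], of b] by simp
  then have "\<Gamma> \<turnstile> transfer2 j i k b l"
    unfolding transfer1_def by (drule_tac allE_term[where t = l]) simp_all
  then have "\<Gamma> \<turnstile> covers j l l' \<^bold>\<longrightarrow> seq i l b \<^bold>\<longrightarrow> seq k l' b"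
    unfolding transfer2_def by (drule_tac allE_term[where t = l']) (simp_all add: okf_imp)
  then have "\<Gamma> \<turnstile> seq i l b \<^bold>\<longrightarrow> seq k l' b"
    using assms(2) by (rule impE) (simp add: okf_imp)
  then show ?thesis using assms(3) by (rule impE) simp
qed

text \<open>The initial clause applies only to lists of the form \<open>cons x l'\<close>; the case
  analysis on membership supplies this form.\<close>

lemma seq_element:
  assumes "\<Gamma> \<turnstile> element a l" and [simp]: "wt k Nt"
  shows "\<Gamma> \<turnstile> seq k l (ang a)"
proof -
  have [simp]: "wt a atm" "wt l atmlst" using derives_fm[OF assms(1)] by auto
  have "add_mset (element a l) {#} \<turnstile> seq k l (ang a)"
  proof (rule element_L)
    fix \<theta> l' assume [simp]: "tsub \<theta>" "wt l' atmlst" and eq: "subst \<theta> l \<approx> cons (subst \<theta> a) l'"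
    have "{#} \<turnstile> seq (subst \<theta> k) (cons (subst \<theta> a) l') (ang (subst \<theta> a))"
      by (intro seq_R_element element_R_here) simp_all
    then show "image_mset (subst \<theta>) {#} \<turnstile> subst \<theta> (seq k l (ang a))"
      using eq by (auto intro!: convR[where C' = "seq (subst \<theta> k) (subst \<theta> l) (ang (subst \<theta> a))"]
          intro: conv_object_cong conv_refl conv_sym)
  next
    fix \<theta> x l' assume [simp]: "tsub \<theta>" "wt x atm" "wt l' atmlst" and eq: "subst \<theta> l \<approx> cons x l'"
    have "{#element (subst \<theta> a) l'#} \<turnstile> seq (subst \<theta> k) (cons x l') (ang (subst \<theta> a))"
      by (intro seq_R_element element_R_there derives_assm) simp_all
    then show "add_mset (element (subst \<theta> a) l') (image_mset (subst \<theta>) {#}) \<turnstile> subst \<theta> (seq k l (ang a))"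
      using eq by (auto intro!: convR[where C' = "seq (subst \<theta> k) (subst \<theta> l) (ang (subst \<theta> a))"]
          intro: conv_object_cong conv_refl conv_sym)
  qed simp_all
  then show ?thesis using assms(1) by (rule derives_trans)
qed

text \<open>At height zero the clause that consults \<open>prog\<close> is excluded by its
  successor, which leaves the initial clause. This is the converse of \<open>seq_element\<close> at
  that height.\<close>

lemma element_seq_zr:
  assumes "\<Gamma> \<turnstile> seq zr l (ang a)"
  shows "\<Gamma> \<turnstile> element a l"
proof -
  have [simp]: "wt a atm" "wt l atmlst" using derives_fm[OF assms(1)] by auto
  have "add_mset (seq zr l (ang a)) {#} \<turnstile> element a l"
  proof (rule seq_L)
    fix \<theta> a' assume [simp]: "tsub \<theta>" "wt a' atm" and "subst \<theta> (ang a) \<approx> ang a'"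
    then have eq: "a' \<approx> subst \<theta> a" by (simp add: conv_object_iff conv_sym)
    have "{#element a' (subst \<theta> l)#} \<turnstile> element a' (subst \<theta> l)"
      by (intro derives_assm) simp_all
    then have "{#element a' (subst \<theta> l)#} \<turnstile> element (subst \<theta> a) (subst \<theta> l)"
      using eq by (rule_tac convR) (auto intro: conv_object_cong conv_refl)
    then show "add_mset (element a' (subst \<theta> l)) (image_mset (subst \<theta>) {#}) \<turnstile> subst \<theta> (element a l)"
      by simp
  qed (simp_all add: conv_nt_iff conv_object_iff)
  then show ?thesis using assms by (rule derives_trans)
qed

lemma covers_refl:
  assumes "fms (osig ext) \<Gamma>" "wt l atmlst"
  shows "\<Gamma> \<turnstile> covers zr l l"
  using assms by (intro coversI seq_element derives_assm) auto

lemma covers_weaken: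
  assumes "fms (osig ext) \<Gamma>" "wt l atmlst" "wt x atm"
  shows "\<Gamma> \<turnstile> covers zr l (cons x l)"
  using assms by (intro coversI seq_element element_R_there derives_assm) auto

text \<open>The new head \<open>a\<close> is covered by an initial sequent. An old element is
  derivable from \<open>l'\<close> at height \<open>j\<close>, and \<open>transfer zr j j\<close>
  weakens this to \<open>cons a l'\<close> without raising the height.\<close>

lemma covers_cons:
  assumes "\<Gamma> \<turnstile> covers j l l'" "\<Gamma> \<turnstile> transfer zr j j"
    and [simp]: "wt j Nt" "wt l atmlst" "wt l' atmlst" "wt a atm"
  shows "\<Gamma> \<turnstile> covers j (cons a l) (cons a l')"
proof -
  have "{#covers j l l', transfer zr j j#} \<turnstile> covers j (cons a l) (cons a l')"
  proof (rule coversI)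
    fix x assume [simp]: "wt x atm"
    show "add_mset (element x (cons a l)) {#covers j l l', transfer zr j j#} \<turnstile> seq j (cons a l') (ang x)"
    proof (rule element_L)
      fix \<theta> m assume [simp]: "tsub \<theta>" "wt m atmlst" and "subst \<theta> (cons a l) \<approx> cons (subst \<theta> x) m"
      then have eq: "subst \<theta> a \<approx> subst \<theta> x" by (simp add: conv_object_iff)
      let ?\<Gamma> = "{#covers (subst \<theta> j) (subst \<theta> l) (subst \<theta> l'), transfer zr (subst \<theta> j) (subst \<theta> j)#}"
      have "?\<Gamma> \<turnstile> seq (subst \<theta> j) (cons (subst \<theta> a) (subst \<theta> l')) (ang (subst \<theta> a))"
        by (intro seq_element element_R_here) simp_all
      then have "?\<Gamma> \<turnstile> seq (subst \<theta> j) (cons (subst \<theta> a) (subst \<theta> l')) (ang (subst \<theta> x))"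
        by (rule convR) (simp_all add: eq conv_object_cong conv_refl)
      then show "image_mset (subst \<theta>) {#covers j l l', transfer zr j j#} \<turnstile> subst \<theta> (seq j (cons a l') (ang x))"
        by simp
    next
      fix \<theta> y m assume [simp]: "tsub \<theta>" "wt y atm" "wt m atmlst" and "subst \<theta> (cons a l) \<approx> cons y m"
      then have eq: "subst \<theta> l \<approx> m" by (simp add: conv_object_iff)
      let ?\<Gamma> = "{#element (subst \<theta> x) (subst \<theta> l), covers (subst \<theta> j) (subst \<theta> l) (subst \<theta> l'),
        transfer zr (subst \<theta> j) (subst \<theta> j)#}"
      have "?\<Gamma> \<turnstile> seq (subst \<theta> j) (subst \<theta> l') (ang (subst \<theta> x))"
        by (rule coversE[where l = "subst \<theta> l"]; (rule derives_assm)?) simp_all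
      then have "?\<Gamma> \<turnstile> seq (subst \<theta> j) (cons (subst \<theta> a) (subst \<theta> l')) (ang (subst \<theta> x))"
        by (rule_tac transferE[where j = zr and i = "subst \<theta> j" and l = "subst \<theta> l'"])
          (simp_all add: covers_weaken derives_assm)
      then show "add_mset (element (subst \<theta> x) m) (image_mset (subst \<theta>) {#covers j l l', transfer zr j j#})
          \<turnstile> subst \<theta> (seq j (cons a l') (ang x))"
        using convL[OF _ conv_object_cong(2)[OF conv_refl eq]] by simp
    qed simp_all
  qed simp_all
  then show ?thesis by (rule derives_multicut) (use assms derives_fm[OF assms(1)] in auto)
qed


text \<open>At height zero only the clauses for initial sequents and for \<open>ott\<close> apply,
  and the latter holds at every height, so the initial case is all that remains.\<close>

lemma transfer_zrI:
  assumes \<Gamma>: "fms (osig ext) \<Gamma>" and [simp]: "wt j Nt" "wt k Nt"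
    and init: "\<And>\<theta> l l' a. tsub \<theta> \<Longrightarrow> wt l atmlst \<Longrightarrow> wt l' atmlst \<Longrightarrow> wt a atm \<Longrightarrow>
      add_mset (element a l) (add_mset (covers (subst \<theta> j) l l') (image_mset (subst \<theta>) \<Gamma>))
        \<turnstile> seq (subst \<theta> k) l' (ang a)"
  shows "\<Gamma> \<turnstile> transfer j zr k"
proof (rule transferI)
  fix b l l' assume [simp]: "wt b prp" "wt l atmlst" "wt l' atmlst"
  show "add_mset (seq zr l b) (add_mset (covers j l l') \<Gamma>) \<turnstile> seq k l' b"
  proof (rule seq_L)
    fix \<theta> a assume [simp]: "tsub \<theta>" "wt a atm" and eq: "subst \<theta> b \<approx> ang a"
    show "add_mset (element a (subst \<theta> l)) (image_mset (subst \<theta>) (add_mset (covers j l l') \<Gamma>))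
        \<turnstile> subst \<theta> (seq k l' b)"
      using convR[OF init[of \<theta> "subst \<theta> l" "subst \<theta> l'" a]
          conv_object_cong(1)[OF conv_refl conv_refl conv_sym[OF eq]]] by simp
  next
    fix \<theta> assume [simp]: "tsub \<theta>" and eq: "subst \<theta> b \<approx> ott"
    have "fms (osig ext) (image_mset (subst \<theta>) \<Gamma>)" using \<Gamma> by (auto simp: fm_def)
    then show "image_mset (subst \<theta>) (add_mset (covers j l l') \<Gamma>) \<turnstile> subst \<theta> (seq k l' b)"
      using convR[OF seq_R_tt[of "image_mset (subst \<theta>) (add_mset (covers j l l') \<Gamma>)" "subst \<theta> k" "subst \<theta> l'"]
          conv_object_cong(1)[OF conv_refl conv_refl conv_sym[OF eq]]] by simp
  qed (use \<Gamma> in \<open>simp_all add: conv_nt_iff\<close>)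
qed (use \<Gamma> in simp_all)

text \<open>Coverage at height zero is membership, and an initial sequent has any height
  \<open>k\<close>. This gives the base case and both side conditions of the two inductions with
  \<open>j = zr\<close>.\<close>

lemma transfer_zr_zr:
  assumes "fms (osig ext) \<Gamma>" and [simp]: "wt k Nt"
  shows "\<Gamma> \<turnstile> transfer zr zr k"
proof (rule derives_mono[where \<Gamma> = "{#}"], rule transfer_zrI)
  fix \<theta> and l l' a :: "'k otm"
  assume [simp]: "tsub \<theta>" "wt l atmlst" "wt l' atmlst" "wt a atm"
  have "{#element a l, covers zr l l'#} \<turnstile> seq zr l' (ang a)"
    by (rule coversE[where l = l]; (rule derives_assm)?) simp_all
  then show "add_mset (element a l) (add_mset (covers (subst \<theta> zr) l l') (image_mset (subst \<theta>) {#}))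
      \<turnstile> seq (subst \<theta> k) l' (ang a)"
    by (simp add: element_seq_zr seq_element)
qed (use assms(1) in simp_all)

text \<open>An initial sequent on \<open>l\<close> is replaced by the covering derivation from
  \<open>l'\<close> at height \<open>j\<close>; the hypothesis, used with \<open>l'\<close> as both
  lists, raises it to \<open>k\<close>.\<close>

lemma transfer_zr:
  assumes "\<Gamma> \<turnstile> transfer zr j k" and [simp]: "wt j Nt" "wt k Nt"
  shows "\<Gamma> \<turnstile> transfer j zr k"
proof -
  have "{#transfer zr j k#} \<turnstile> transfer j zr k"
  proof (rule transfer_zrI)
    fix \<theta> and l l' a :: "'k otm"
    assume [simp]: "tsub \<theta>" "wt l atmlst" "wt l' atmlst" "wt a atm"
    let ?\<Gamma> = "{#element a l, covers (subst \<theta> j) l l', transfer zr (subst \<theta> j) (subst \<theta> k)#}"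
    have "?\<Gamma> \<turnstile> seq (subst \<theta> j) l' (ang a)"
      by (rule coversE[where l = l]; (rule derives_assm)?) simp_all
    then have "?\<Gamma> \<turnstile> seq (subst \<theta> k) l' (ang a)"
      by (rule_tac transferE[where j = zr and i = "subst \<theta> j" and l = l'])
        (simp_all add: covers_refl derives_assm)
    then show "add_mset (element a l) (add_mset (covers (subst \<theta> j) l l')
        (image_mset (subst \<theta>) {#transfer zr j k#})) \<turnstile> seq (subst \<theta> k) l' (ang a)"
      by simp
  qed simp_all
  then show ?thesis using assms(1) by (rule derives_trans)
qed

text \<open>The last clause is reapplied at the target height after its premises have been
  transferred by the first hypothesis. Only two cases differ: \<open>arrow\<close> changes the lists
  and needs \<open>covers_cons\<close>, and an initial sequent turns into a covering
  derivation.\<close>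

lemma transfer_sc:
  assumes "\<Gamma> \<turnstile> transfer j i k" "\<Gamma> \<turnstile> transfer zr j j" "\<Gamma> \<turnstile> transfer zr j (sc k)"
    and [simp]: "wt j Nt" "wt i Nt" "wt k Nt"
  shows "\<Gamma> \<turnstile> transfer j (sc i) (sc k)"
proof -
  have "{#transfer j i k, transfer zr j j, transfer zr j (sc k)#} \<turnstile> transfer j (sc i) (sc k)"
  proof (rule transferI)
    fix b l l' assume [simp]: "wt b prp" "wt l atmlst" "wt l' atmlst"
    let ?\<Gamma> = "{#covers j l l', transfer j i k, transfer zr j j, transfer zr j (sc k)#}"
    \<comment> \<open>A clause determines \<open>subst \<theta> b\<close> only up to conversion, so
      each case proves the goal for the formula in the clause head.\<close>
    have conv_goal: "G \<turnstile> seq (sc (subst \<theta> k)) (subst \<theta> l') (subst \<theta> b)"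
      if "G \<turnstile> seq (sc (subst \<theta> k)) (subst \<theta> l') b'" "subst \<theta> b \<approx> b'" "tsub \<theta>" for G \<theta> b'
      using convR[OF that(1) conv_object_cong(1)[OF conv_refl conv_refl conv_sym[OF that(2)]]] that(3) by simp
    \<comment> \<open>Every case comes with its own unifier; \<open>ctx\<close> is the corresponding
      instance of the hypotheses.\<close>
    define ctx where "ctx = (\<lambda>\<theta>. {#covers (subst \<theta> j) (subst \<theta> l) (subst \<theta> l'),
      transfer (subst \<theta> j) (subst \<theta> i) (subst \<theta> k), transfer zr (subst \<theta> j) (subst \<theta> j),
      transfer zr (subst \<theta> j) (sc (subst \<theta> k))#})"
    have ctx: "image_mset (subst \<theta>) ?\<Gamma> = ctx \<theta>" if "tsub \<theta>" for \<theta>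
      using that by (simp add: ctx_def)
    have fms_ctx: "fms (osig ext) (ctx \<theta>)" if "tsub \<theta>" for \<theta>
      using that by (simp add: ctx_def)
    have hyps: "add_mset A (ctx \<theta>) \<turnstile> covers (subst \<theta> j) (subst \<theta> l) (subst \<theta> l')"
      "add_mset A (ctx \<theta>) \<turnstile> transfer (subst \<theta> j) (subst \<theta> i) (subst \<theta> k)"
      "add_mset A (ctx \<theta>) \<turnstile> transfer zr (subst \<theta> j) (subst \<theta> j)"
      "add_mset A (ctx \<theta>) \<turnstile> transfer zr (subst \<theta> j) (sc (subst \<theta> k))"
      if "tsub \<theta>" "fm (osig ext) A" for \<theta> A
      using that fms_ctx[OF that(1)] by (auto intro!: derives_assm) (simp_all add: ctx_def)
    show "add_mset (seq (sc i) l b) ?\<Gamma> \<turnstile> seq (sc k) l' b"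
    proof (rule seq_L)
      fix \<theta> a assume \<theta>[simp]: "tsub \<theta>" and [simp]: "wt a atm" and eq: "subst \<theta> b \<approx> ang a"
      let ?G = "add_mset (element a (subst \<theta> l)) (ctx \<theta>)"
      have G: "fms (osig ext) ?G" using fms_ctx[OF \<theta>] by simp
      \<comment> \<open>The covering derivation at height \<open>j\<close> replaces the initial
        sequent, and the third hypothesis brings it to \<open>sc k\<close> over the same
        list.\<close>
      have "?G \<turnstile> element a (subst \<theta> l)" by (rule derives_assm) (use G in simp_all)
      then have "?G \<turnstile> seq (subst \<theta> j) (subst \<theta> l') (ang a)"
        by (rule_tac coversE[OF hyps(1)]) simp_all
      then have "?G \<turnstile> seq (sc (subst \<theta> k)) (subst \<theta> l') (ang a)"
        by (rule_tac transferE[OF hyps(4) covers_refl[OF G]]) simp_all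
      then show "add_mset (element a (subst \<theta> l)) (image_mset (subst \<theta>) ?\<Gamma>) \<turnstile> subst \<theta> (seq (sc k) l' b)"
        unfolding ctx[OF \<theta>] using conv_goal[OF _ eq \<theta>] by simp
    next
      fix \<theta> assume \<theta>[simp]: "tsub \<theta>" and eq: "subst \<theta> b \<approx> ott"
      have "ctx \<theta> \<turnstile> seq (sc (subst \<theta> k)) (subst \<theta> l') ott" by (rule seq_R_tt) (simp_all add: fms_ctx[OF \<theta>])
      then show "image_mset (subst \<theta>) ?\<Gamma> \<turnstile> subst \<theta> (seq (sc k) l' b)"
        unfolding ctx[OF \<theta>] using conv_goal[OF _ eq \<theta>] by simp
    next
      fix \<theta> i' b1 b2 assume \<theta>[simp]: "tsub \<theta>" and [simp]: "wt i' Nt" "wt b1 prp" "wt b2 prp"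
        and "subst \<theta> (sc i) \<approx> sc i'" and eq: "subst \<theta> b \<approx> amp b1 b2"
      then have i': "subst \<theta> i \<approx> i'" by (simp add: conv_nt_iff)
      \<comment> \<open>The clause supplies a predecessor \<open>i'\<close> that is merely
        convertible to \<open>subst \<theta> i\<close>. The argument uses
        \<open>subst \<theta> i\<close>, to which the transfer hypothesis applies, and
        \<open>convL\<close> exchanges the two at the end; the cases below do the same.\<close>
      let ?A = "\<lambda>i. seq i (subst \<theta> l) b1 \<^bold>\<and> seq i (subst \<theta> l) b2"
      let ?G = "add_mset (?A (subst \<theta> i)) (ctx \<theta>)"
      have "?G \<turnstile> ?A (subst \<theta> i)" by (rule derives_assm) (simp_all add: fms_ctx[OF \<theta>] okf_and)
      then have "?G \<turnstile> seq (subst \<theta> i) (subst \<theta> l) b1" "?G \<turnstile> seq (subst \<theta> i) (subst \<theta> l) b2"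
        by (auto intro: andE1 andE2)
      then have "?G \<turnstile> seq (sc (subst \<theta> k)) (subst \<theta> l') (amp b1 b2)"
        by (intro seq_R_amp; rule_tac transferE[OF hyps(2,1)]) simp_all
      then have "?G \<turnstile> seq (sc (subst \<theta> k)) (subst \<theta> l') (subst \<theta> b)" using eq \<theta> by (rule conv_goal)
      moreover have "?A (subst \<theta> i) \<approx> ?A i'" using i' by (intro conv_App conv_object_cong conv_refl)
      ultimately show "add_mset (?A i') (image_mset (subst \<theta>) ?\<Gamma>) \<turnstile> subst \<theta> (seq (sc k) l' b)"
        unfolding ctx[OF \<theta>] by (rule_tac convL[where B = "?A (subst \<theta> i)"]) simp_all
    next
      fix \<theta> i' a b' assume \<theta>[simp]: "tsub \<theta>" and [simp]: "wt i' Nt" "wt a atm" "wt b' prp"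
        and "subst \<theta> (sc i) \<approx> sc i'" and eq: "subst \<theta> b \<approx> arrow a b'"
      then have i': "subst \<theta> i \<approx> i'" by (simp add: conv_nt_iff)
      let ?A = "\<lambda>i. seq i (cons a (subst \<theta> l)) b'"
      let ?G = "add_mset (?A (subst \<theta> i)) (ctx \<theta>)"
      have "?G \<turnstile> ?A (subst \<theta> i)" by (rule derives_assm) (simp_all add: fms_ctx[OF \<theta>])
      then have "?G \<turnstile> seq (subst \<theta> k) (cons a (subst \<theta> l')) b'"
        by (rule_tac transferE[OF hyps(2) covers_cons[OF hyps(1,3)]]) simp_all
      then have "?G \<turnstile> seq (sc (subst \<theta> k)) (subst \<theta> l') (subst \<theta> b)"
        using conv_goal[OF seq_R_arrow eq \<theta>] by blast
      moreover have "?A (subst \<theta> i) \<approx> ?A i'" using i' by (intro conv_object_cong conv_refl)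
      ultimately show "add_mset (?A i') (image_mset (subst \<theta>) ?\<Gamma>) \<turnstile> subst \<theta> (seq (sc k) l' b)"
        unfolding ctx[OF \<theta>] by (rule_tac convL[where B = "?A (subst \<theta> i)"]) simp_all
    next
      fix \<theta> i' f assume \<theta>[simp]: "tsub \<theta>" and [simp]: "wt i' Nt" "wt f (ind \<rightarrow>\<^sub>t prp)"
        and "subst \<theta> (sc i) \<approx> sc i'" and eq: "subst \<theta> b \<approx> bigand f"
      then have i': "subst \<theta> i \<approx> i'" by (simp add: conv_nt_iff)
      let ?A = "\<lambda>i. qAll ind (Lam (seq i (subst \<theta> l) (App f (Bnd 0))))"
      let ?G = "add_mset (?A (subst \<theta> i)) (ctx \<theta>)"
      have ok: "ok (?A (subst \<theta> i))"
        by (rule okf_all) (simp_all add: has_ty_closed inst_closed[of "osig ext" _ atmlst]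
            inst_closed[of "osig ext" _ "ind \<rightarrow>\<^sub>t prp"] inst_closed[of "osig ext" _ Nt])
      have A: "?G \<turnstile> ?A (subst \<theta> i)" by (rule derives_assm) (simp_all add: fms_ctx[OF \<theta>] ok has_ty_closed)
      have "?G \<turnstile> seq (subst \<theta> i) (subst \<theta> l) (App f x)" if "wt x ind" for x
        using allE_term[OF A that] that by (simp add: inst_closed[of "osig ext" _ atmlst]
            inst_closed[of "osig ext" _ "ind \<rightarrow>\<^sub>t prp"] inst_closed[of "osig ext" _ Nt])
      then have "?G \<turnstile> seq (subst \<theta> k) (subst \<theta> l') (App f x)" if "wt x ind" for x
        by (rule_tac transferE[OF hyps(2,1)]) (simp_all add: that has_ty_closed)
      then have "?G \<turnstile> seq (sc (subst \<theta> k)) (subst \<theta> l') (subst \<theta> b)"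
        by (intro conv_goal[OF seq_R_bigand eq \<theta>]) (simp_all add: fms_ctx[OF \<theta>] has_ty_closed)
      moreover have "?A (subst \<theta> i) \<approx> ?A i'"
        using i' by (intro conv_App conv_Lam conv_object_cong conv_refl)
      ultimately show "add_mset (?A i') (image_mset (subst \<theta>) ?\<Gamma>) \<turnstile> subst \<theta> (seq (sc k) l' b)"
        unfolding ctx[OF \<theta>] by (rule_tac convL[where B = "?A (subst \<theta> i)"]) (simp_all add: has_ty_closed)
    next
      fix \<theta> i' a assume \<theta>[simp]: "tsub \<theta>" and [simp]: "wt i' Nt" "wt a atm"
        and "subst \<theta> (sc i) \<approx> sc i'" and eq: "subst \<theta> b \<approx> ang a"
      then have i': "subst \<theta> i \<approx> i'" by (simp add: conv_nt_iff)
      let ?A = "\<lambda>i. qEx prp (Lam (prog a (Bnd 0) \<^bold>\<and> seq i (subst \<theta> l) (Bnd 0)))"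
      let ?G = "add_mset (?A (subst \<theta> i)) (ctx \<theta>)"
      have [simp]: "inst 0 x (subst \<theta> l) = subst \<theta> l" "inst 0 x (subst \<theta> i) = subst \<theta> i"
        "inst 0 x a = a" for x
        using inst_closed[of "osig ext" "subst \<theta> l" atmlst] inst_closed[of "osig ext" "subst \<theta> i" Nt]
          inst_closed[of "osig ext" a atm] by simp_all
      have ok: "ok (?A (subst \<theta> i))"
        by (rule okf_ex) (simp_all add: has_ty_closed okf_and)
      have A: "?G \<turnstile> ?A (subst \<theta> i)" by (rule derives_assm) (simp_all add: fms_ctx[OF \<theta>] ok has_ty_closed)
      have "?G \<turnstile> seq (sc (subst \<theta> k)) (subst \<theta> l') (ang a)"
      proof (rule exE_term[OF A])
        fix x assume [simp]: "wt x prp"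
        let ?G' = "add_mset (prog a x \<^bold>\<and> seq (subst \<theta> i) (subst \<theta> l) x) (ctx \<theta>)"
        have "?G' \<turnstile> prog a x \<^bold>\<and> seq (subst \<theta> i) (subst \<theta> l) x"
          by (rule derives_assm) (simp_all add: fms_ctx[OF \<theta>] okf_and)
        then have prog: "?G' \<turnstile> prog a x" and "?G' \<turnstile> seq (subst \<theta> i) (subst \<theta> l) x"
          by (auto intro: andE1 andE2)
        \<comment> \<open>The formula \<open>x\<close> supplied by \<open>prog\<close> need not be
          smaller than \<open>ang a\<close>. Only the height decreases, hence the induction on
          heights and the quantifier over all formulas in \<open>transfer\<close>.\<close>
        then have "?G' \<turnstile> seq (subst \<theta> k) (subst \<theta> l') x"
          by (rule_tac transferE[OF hyps(2,1)]) simp_all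
        with prog have "?G' \<turnstile> seq (sc (subst \<theta> k)) (subst \<theta> l') (ang a)"
          by (rule seq_R_prog)
        then show "add_mset (inst 0 x (prog a (Bnd 0) \<^bold>\<and> seq (subst \<theta> i) (subst \<theta> l) (Bnd 0))) ?G
            \<turnstile> seq (sc (subst \<theta> k)) (subst \<theta> l') (ang a)"
          by (rule derives_mono) (auto simp: fms_ctx[OF \<theta>] has_ty_closed)
      qed simp
      then have "?G \<turnstile> seq (sc (subst \<theta> k)) (subst \<theta> l') (subst \<theta> b)" using eq \<theta> by (rule conv_goal)
      moreover have "?A (subst \<theta> i) \<approx> ?A i'"
        using i' by (intro conv_App conv_Lam conv_object_cong conv_refl)
      ultimately show "add_mset (?A i') (image_mset (subst \<theta>) ?\<Gamma>) \<turnstile> subst \<theta> (seq (sc k) l' b)"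
        unfolding ctx[OF \<theta>] by (rule_tac convL[where B = "?A (subst \<theta> i)"]) (simp_all add: has_ty_closed)
    qed simp_all
  qed simp_all
  then show ?thesis by (rule derives_multicut) (use assms derives_fm[OF assms(1)] in auto)
qed

end

text \<open>The conjunct \<open>transfer zr j k\<close> expresses \<open>j \<le> k\<close> in terms
  of derivations. It strengthens the invariant so that the step has the monotonicity condition which
  \<open>transfer_sc\<close> demands.\<close>

definition cut_bound1 :: "'k otm \<Rightarrow> 'k otm \<Rightarrow> 'k otm" where
  "cut_bound1 i j = qEx Nt (Lam (natp (Bnd 0) \<^bold>\<and> transfer zr (lift 0 j) (Bnd 0) \<^bold>\<and>
    transfer (lift 0 j) (lift 0 i) (Bnd 0)))"

text \<open>The bound \<open>k\<close> is chosen before the object-level formula, because the clause for \<open>\<And>\<close> needs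
  one bound for all instances.\<close>

definition cut_bound :: "'k otm \<Rightarrow> 'k otm" where
  "cut_bound i = qAll Nt (Lam (natp (Bnd 0) \<^bold>\<longrightarrow> cut_bound1 (lift 0 i) (Bnd 0)))"

lemma inst_cut_bound1 [simp]: "inst n u (cut_bound1 i j) = cut_bound1 (inst n u i) (inst n u j)"
  by (simp add: cut_bound1_def)

context object_logic
begin

lemma transfer_refl:
  assumes "\<Gamma> \<turnstile> natp i"
  shows "\<Gamma> \<turnstile> transfer zr i i"
proof (rule nat_induction[OF _ _ _ _ assms, where P = "\<lambda>i. transfer zr i i"])
  fix t assume [simp]: "wt t Nt"
  show "{#transfer zr t t#} \<turnstile> transfer zr (sc t) (sc t)"
    by (rule transfer_sc) (simp_all add: transfer_zr_zr derives_assm)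
qed (simp_all add: transfer_zr_zr)

lemma transfer_Suc:
  assumes "\<Gamma> \<turnstile> natp i"
  shows "\<Gamma> \<turnstile> transfer zr i (sc i)"
proof (rule nat_induction[OF _ _ _ _ assms, where P = "\<lambda>i. transfer zr i (sc i)"])
  fix t assume [simp]: "wt t Nt"
  show "{#transfer zr t (sc t)#} \<turnstile> transfer zr (sc t) (sc (sc t))"
    by (rule transfer_sc) (simp_all add: transfer_zr_zr derives_assm)
qed (simp_all add: transfer_zr_zr)

text \<open>The change of lists is made by the first transfer; the second only raises the height
  over \<open>l'\<close>, which covers itself.\<close>

lemma transfer_trans:
  assumes "\<Gamma> \<turnstile> transfer zr i j" "\<Gamma> \<turnstile> transfer zr j k"
    and [simp]: "wt i Nt" "wt j Nt" "wt k Nt"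
  shows "\<Gamma> \<turnstile> transfer zr i k"
proof (rule transferI)
  show \<Gamma>: "fms (osig ext) \<Gamma>" using derives_fm[OF assms(1)] by simp
  fix b l l' assume [simp]: "wt b prp" "wt l atmlst" "wt l' atmlst"
  let ?G = "add_mset (seq i l b) (add_mset (covers zr l l') \<Gamma>)"
  have G: "fms (osig ext) ?G" using \<Gamma> by simp
  have trans: "?G \<turnstile> transfer zr i j" "?G \<turnstile> transfer zr j k"
    by (rule derives_mono[OF assms(1)] derives_mono[OF assms(2)]; use G in auto)+
  have "?G \<turnstile> seq j l' b"
    by (rule transferE[OF trans(1), where l = l]; (rule derives_assm)?) (use G in simp_all)
  then show "?G \<turnstile> seq k l' b"
    by (rule_tac transferE[OF trans(2) covers_refl[OF G]]) simp_all
qed simp_all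

lemma has_ty_cut_bound1 [simp]:
  "has_ty (osig ext) \<Delta> i Nt \<Longrightarrow> has_ty (osig ext) \<Delta> j Nt \<Longrightarrow> has_ty (osig ext) \<Delta> (cut_bound1 i j) Prop"
  by (simp add: cut_bound1_def)

lemma ok_cut_bound1 [simp]: "wt i Nt \<Longrightarrow> wt j Nt \<Longrightarrow> ok (cut_bound1 i j)"
  unfolding cut_bound1_def by (intro okf_ex) (simp_all add: okf_and okf_nat)

lemma ok_cut_bound: "wt i Nt \<Longrightarrow> ok (cut_bound i)"
  unfolding cut_bound_def by (intro okf_all) (simp_all add: okf_imp okf_nat)

lemma subst_cut_bound:
  assumes "tsub \<theta>" "wt i Nt"
  shows "subst \<theta> (cut_bound i) = cut_bound (subst \<theta> i)"
  using lift_closed[OF assms(2)] lift_closed[OF wt_subst[OF assms(2,1)]]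
  by (simp add: cut_bound_def cut_bound1_def transfer_defs)

lemma cut_boundI:
  assumes "fms (osig ext) \<Gamma>" "wt i Nt"
    and "\<And>j. wt j Nt \<Longrightarrow> add_mset (natp j) \<Gamma> \<turnstile> cut_bound1 i j"
  shows "\<Gamma> \<turnstile> cut_bound i"
  unfolding cut_bound_def by (rule allI_term) (use assms in \<open>simp_all add: impR\<close>)

lemma cut_bound1I:
  assumes "\<Gamma> \<turnstile> natp k" "\<Gamma> \<turnstile> transfer zr j k" "\<Gamma> \<turnstile> transfer j i k" "wt i Nt" "wt j Nt"
  shows "\<Gamma> \<turnstile> cut_bound1 i j"
  unfolding cut_bound1_def
  by (rule exI_term[where t = k]) (use assms derives_fm[OF assms(1)] in \<open>simp_all add: andR\<close>)

lemma cut_boundE: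
  assumes "\<Gamma> \<turnstile> cut_bound i" "\<Gamma> \<turnstile> natp j" "wt i Nt" "fm (osig ext) C"
    and "\<And>k. wt k Nt \<Longrightarrow> add_mset (natp k) (add_mset (transfer zr j k) (add_mset (transfer j i k) \<Gamma>)) \<turnstile> C"
  shows "\<Gamma> \<turnstile> C"
proof -
  have \<Gamma>: "fms (osig ext) \<Gamma>" and [simp]: "wt j Nt" "wt i Nt" using derives_fm[OF assms(2)] assms(3) by simp_all
  have "\<Gamma> \<turnstile> natp j \<^bold>\<longrightarrow> cut_bound1 i j"
    using allE_term[OF assms(1)[unfolded cut_bound_def], of j] by (simp add: okf_imp okf_nat)
  then have "\<Gamma> \<turnstile> cut_bound1 i j" using assms(2) by (rule impE) simp
  then show ?thesis unfolding cut_bound1_def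
  proof (rule exE_term)
    fix k assume [simp]: "wt k Nt"
    let ?A = "natp k \<^bold>\<and> transfer zr j k \<^bold>\<and> transfer j i k"
    let ?G = "add_mset ?A \<Gamma>"
    have G: "fms (osig ext) ?G" using \<Gamma> by simp
    have A: "?G \<turnstile> ?A" by (rule derives_assm) (use G in \<open>simp_all add: okf_and okf_nat\<close>)
    have A1: "?G \<turnstile> natp k" using A by (rule andE1) (simp add: okf_nat)
    have A2: "?G \<turnstile> transfer zr j k \<^bold>\<and> transfer j i k" using A by (rule andE2) (simp add: okf_and)
    have A3: "?G \<turnstile> transfer zr j k" using A2 by (rule andE1) simp
    have A4: "?G \<turnstile> transfer j i k" using A2 by (rule andE2) simp
    have "add_mset (natp k) (add_mset (transfer zr j k) (add_mset (transfer j i k) ?G)) \<turnstile> C"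
      by (rule derives_mono[OF assms(5)[of k]]) (use G in auto)
    then have "add_mset (transfer zr j k) (add_mset (transfer j i k) ?G) \<turnstile> C"
      by (rule derives_cut[OF derives_mono[OF A1], rotated 2]) (use G in auto)
    then have "add_mset (transfer j i k) ?G \<turnstile> C"
      by (rule derives_cut[OF derives_mono[OF A3], rotated 2]) (use G in auto)
    then have "?G \<turnstile> C" by (rule derives_cut[OF A4])
    then show "add_mset (inst 0 k (natp (Bnd 0) \<^bold>\<and> transfer zr (lift 0 j) (Bnd 0) \<^bold>\<and>
        transfer (lift 0 j) (lift 0 i) (Bnd 0))) \<Gamma> \<turnstile> C"
      by simp
  qed (fact assms(4))
qed

lemma cut_bound_nat:
  assumes "\<Gamma> \<turnstile> natp i"
  shows "\<Gamma> \<turnstile> cut_bound i"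
proof (rule nat_induction[OF subst_cut_bound ok_cut_bound _ _ assms])
  show "{#} \<turnstile> cut_bound zr"
  proof (rule cut_boundI)
    fix j assume [simp]: "wt j Nt"
    have j: "{#natp j#} \<turnstile> natp j" by (rule derives_assm) (simp_all add: okf_nat)
    \<comment> \<open>The witness is \<open>j\<close>: at height zero only initial sequents are
      replaced, by derivations of height \<open>j\<close>.\<close>
    show "{#natp j#} \<turnstile> cut_bound1 zr j"
      by (rule cut_bound1I[OF j]) (simp_all add: transfer_refl[OF j] transfer_zr)
  qed simp_all
next
  fix t assume [simp]: "wt t Nt"
  show "{#cut_bound t#} \<turnstile> cut_bound (sc t)"
  proof (rule cut_boundI)
    fix j assume [simp]: "wt j Nt"
    let ?G = "{#natp j, cut_bound t#}"
    have fm: "fm (osig ext) (cut_bound t)" by (simp add: okf_fm[OF ok_cut_bound])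
    have t: "?G \<turnstile> cut_bound t" by (rule derives_assm) (simp_all add: ok_cut_bound fm)
    have "?G \<turnstile> natp j" by (rule derives_assm) (simp_all add: okf_nat fm)
    with t show "?G \<turnstile> cut_bound1 (sc t) j"
    proof (rule cut_boundE)
      fix k assume [simp]: "wt k Nt"
      let ?H = "add_mset (natp k) (add_mset (transfer zr j k) (add_mset (transfer j t k) ?G))"
      have H: "fms (osig ext) ?H" using fm by simp
      have j: "?H \<turnstile> natp j" by (rule derives_assm[OF _ H]) (simp_all add: okf_nat)
      have k: "?H \<turnstile> natp k" by (rule derives_assm[OF _ H]) (simp_all add: okf_nat)
      have jk: "?H \<turnstile> transfer zr j k" by (rule derives_assm[OF _ H]) simp_all
      \<comment> \<open>The new witness is \<open>sc k\<close>. This formula is used twice: as a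
        side condition of \<open>transfer_sc\<close> and as a conjunct of the new invariant.\<close>
      have jsk: "?H \<turnstile> transfer zr j (sc k)"
        by (rule transfer_trans[OF jk transfer_Suc[OF k]]) simp_all
      have "?H \<turnstile> transfer j t k" by (rule derives_assm[OF _ H]) simp_all
      then have "?H \<turnstile> transfer j (sc t) (sc k)"
        using transfer_refl[OF j] jsk by (rule transfer_sc) simp_all
      with jsk show "?H \<turnstile> cut_bound1 (sc t) j"
        by (rule cut_bound1I[OF natR_s[OF k]]) simp_all
    qed (simp_all add: fm_def)
  qed (simp_all add: okf_fm[OF ok_cut_bound])
qed

subsection \<open>The object-level properties\<close>

text \<open>The named quantifiers turned into indices: from outside in, \<open>Bnd 2\<close>,
  \<open>Bnd 1\<close> and \<open>Bnd 0\<close> stand for \<open>i\<close>, \<open>b\<close> and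
  \<open>l\<close>, shifted by one under the inner quantifier.\<close>

lemma specialization_eq:
  "specialization = qAll Nt (Lam (qAll (ind \<rightarrow>\<^sub>t prp) (Lam (qAll atmlst (Lam (natp (Bnd 2) \<^bold>\<longrightarrow>
    seq (sc (Bnd 2)) (Bnd 0) (bigand (Bnd 1)) \<^bold>\<longrightarrow>
    qAll ind (Lam (seq (Bnd 3) (Bnd 1) (App (Bnd 2) (Bnd 0))))))))))"
  by (simp add: specialization_def lam_def Let_def object_defs)

text \<open>A plain inversion: only the clause for \<open>bigand\<close> matches, and its body is
  the desired conclusion up to conversion of the height and of the abstraction.\<close>

lemma derives_specialization: "{#} \<turnstile> specialization"
proof -
  have main: "{#} \<turnstile> natp i \<^bold>\<longrightarrow> seq (sc i) l (bigand b) \<^bold>\<longrightarrow> qAll ind (Lam (seq i l (App b (Bnd 0))))"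
    if [simp]: "wt i Nt" "wt b (ind \<rightarrow>\<^sub>t prp)" "wt l atmlst" for i b l
  proof (intro impR, rule seq_L)
    fix \<theta> i' f
    assume [simp]: "tsub \<theta>" "wt i' Nt" "wt f (ind \<rightarrow>\<^sub>t prp)"
      and "subst \<theta> (sc i) \<approx> sc i'" "subst \<theta> (bigand b) \<approx> bigand f"
    then have eq: "i' \<approx> subst \<theta> i" "f \<approx> subst \<theta> b"
      by (simp_all add: conv_nt_iff conv_object_iff conv_sym)
    let ?A = "\<lambda>i f. qAll ind (Lam (seq i (subst \<theta> l) (App f (Bnd 0))))"
    have [simp]: "inst 0 x (subst \<theta> l) = subst \<theta> l" "inst 0 x i' = i'" "inst 0 x f = f" for x
      using inst_closed[of "osig ext" "subst \<theta> l" atmlst] inst_closed[of "osig ext" i' Nt]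
        inst_closed[of "osig ext" f "ind \<rightarrow>\<^sub>t prp"] by simp_all
    have "ok (?A i' f)" by (rule okf_all) (simp_all add: has_ty_closed)
    then have "{#?A i' f, natp (subst \<theta> i)#} \<turnstile> ?A i' f"
      by (rule derives_assm) (simp_all add: has_ty_closed)
    then have "{#?A i' f, natp (subst \<theta> i)#} \<turnstile> ?A (subst \<theta> i) (subst \<theta> b)"
      by (rule convR) (auto simp: has_ty_closed eq intro!: conv_App conv_Lam conv_object_cong conv_refl)
    then show "add_mset (?A i' f) (image_mset (subst \<theta>) {#natp i#}) \<turnstile>
        subst \<theta> (qAll ind (Lam (seq i l (App b (Bnd 0)))))"
      by simp
  qed (simp_all add: conv_object_iff has_ty_closed)
  \<comment> \<open>The outer quantifiers are restored innermost first. At each stage the variables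
    not yet bound are arbitrary locally closed terms, so only the bound ones appear as
    indices.\<close>
  have "{#} \<turnstile> qAll atmlst (Lam (natp i \<^bold>\<longrightarrow> seq (sc i) (Bnd 0) (bigand b) \<^bold>\<longrightarrow>
      qAll ind (Lam (seq i (Bnd 1) (App b (Bnd 0))))))"
    if "wt i Nt" "wt b (ind \<rightarrow>\<^sub>t prp)" for i b
    by (rule allI_term) (use that main in \<open>simp_all add: has_ty_closed inst_closed lift_closed\<close>)
  then have "{#} \<turnstile> qAll (ind \<rightarrow>\<^sub>t prp) (Lam (qAll atmlst (Lam (natp i \<^bold>\<longrightarrow>
      seq (sc i) (Bnd 0) (bigand (Bnd 1)) \<^bold>\<longrightarrow> qAll ind (Lam (seq i (Bnd 1) (App (Bnd 2) (Bnd 0))))))))"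
    if "wt i Nt" for i
    by (intro allI_term) (use that in \<open>simp_all add: has_ty_closed inst_closed lift_closed\<close>)
  then show ?thesis unfolding specialization_eq
    by (intro allI_term) (simp_all add: lift_closed)
qed

lemma structural_rules_eq:
  "structural_rules = qAll Nt (Lam (qAll prp (Lam (qAll atmlst (Lam (qAll atmlst (Lam (natp (Bnd 3) \<^bold>\<longrightarrow>
    qAll atm (Lam (element (Bnd 0) (Bnd 2) \<^bold>\<longrightarrow> element (Bnd 0) (Bnd 1))) \<^bold>\<longrightarrow>
    seq (Bnd 3) (Bnd 1) (Bnd 2) \<^bold>\<longrightarrow> seq (Bnd 3) (Bnd 0) (Bnd 2)))))))))"
  by (simp add: structural_rules_def lam_def Let_def object_defs)

lemma derives_structural_rules: "{#} \<turnstile> structural_rules"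
proof -
  let ?E = "\<lambda>l l'. qAll atm (Lam (element (Bnd 0) l \<^bold>\<longrightarrow> element (Bnd 0) l'))"
  have main: "{#} \<turnstile> natp i \<^bold>\<longrightarrow> ?E l l' \<^bold>\<longrightarrow> seq i l b \<^bold>\<longrightarrow> seq i l' b"
    if [simp]: "wt i Nt" "wt b prp" "wt l atmlst" "wt l' atmlst" for i b l l'
  proof (intro impR)
    let ?G = "{#seq i l b, ?E l l', natp i#}"
    have [simp]: "inst 0 x l = l" "inst 0 x l' = l'" for x
      using inst_closed[of "osig ext" l atmlst] inst_closed[of "osig ext" l' atmlst] by simp_all
    have G: "fms (osig ext) ?G" by (simp add: has_ty_closed)
    have ok: "ok (?E l l')" by (rule okf_all) (simp_all add: has_ty_closed okf_imp)
    \<comment> \<open>The hypothesis moves an element of \<open>l\<close> into \<open>l'\<close>,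
      and \<open>seq_element\<close> turns membership into a derivation of height zero.\<close>
    have c: "?G \<turnstile> covers zr l l'"
    proof (rule coversI[OF G])
      fix a assume [simp]: "wt a atm"
      let ?H = "add_mset (element a l) ?G"
      have H: "fms (osig ext) ?H" using G by simp
      have "?H \<turnstile> ?E l l'" by (rule derives_assm[OF ok H]) simp
      then have "?H \<turnstile> element a l \<^bold>\<longrightarrow> element a l'"
        by (drule_tac allE_term[where t = a]) (simp_all add: okf_imp)
      moreover have "?H \<turnstile> element a l" by (rule derives_assm[OF _ H]) simp_all
      ultimately have "?H \<turnstile> element a l'" by (rule impE) simp
      then show "?H \<turnstile> seq zr l' (ang a)" by (rule seq_element) simp
    qed simp_all
    have s: "?G \<turnstile> seq i l b" by (rule derives_assm[OF _ G]) simp_all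
    have "?G \<turnstile> transfer zr i i"
      by (rule transfer_refl, rule derives_assm[OF _ G]) (simp_all add: okf_nat)
    then show "?G \<turnstile> seq i l' b" by (rule transferE[OF _ c s]) simp_all
  qed
  have "{#} \<turnstile> qAll atmlst (Lam (natp i \<^bold>\<longrightarrow> ?E l (Bnd 1) \<^bold>\<longrightarrow> seq i l b \<^bold>\<longrightarrow> seq i (Bnd 0) b))"
    if "wt i Nt" "wt b prp" "wt l atmlst" for i b l
    by (rule allI_term) (use that main in \<open>simp_all add: has_ty_closed inst_closed lift_closed\<close>)
  then have "{#} \<turnstile> qAll atmlst (Lam (qAll atmlst (Lam (natp i \<^bold>\<longrightarrow> ?E (Bnd 2) (Bnd 1) \<^bold>\<longrightarrow>
      seq i (Bnd 1) b \<^bold>\<longrightarrow> seq i (Bnd 0) b))))"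
    if "wt i Nt" "wt b prp" for i b
    by (intro allI_term) (use that in \<open>simp_all add: has_ty_closed inst_closed lift_closed\<close>)
  then have "{#} \<turnstile> qAll prp (Lam (qAll atmlst (Lam (qAll atmlst (Lam (natp i \<^bold>\<longrightarrow> ?E (Bnd 2) (Bnd 1) \<^bold>\<longrightarrow>
      seq i (Bnd 1) (Bnd 2) \<^bold>\<longrightarrow> seq i (Bnd 0) (Bnd 2)))))))"
    if "wt i Nt" for i
    by (intro allI_term) (use that in \<open>simp_all add: has_ty_closed inst_closed lift_closed\<close>)
  then show ?thesis unfolding structural_rules_eq
    by (intro allI_term) (simp_all add: lift_closed)
qed

section \<open>Object-level provability and cut\<close>

lemma prv_eq: "prv l b = qEx Nt (Lam (natp (Bnd 0) \<^bold>\<and> seq (Bnd 0) (lift 0 l) (lift 0 b)))"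
  by (simp add: prv_def seq_def)

lemma inst_prv [simp]: "inst n u (prv l b) = prv (inst n u l) (inst n u b)"
  by (simp add: prv_eq)

lemma has_ty_prv [simp]:
  "has_ty (osig ext) \<Delta> l atmlst \<Longrightarrow> has_ty (osig ext) \<Delta> b prp \<Longrightarrow> has_ty (osig ext) \<Delta> (prv l b) Prop"
  by (simp add: prv_eq)

lemma ok_prv: "wt l atmlst \<Longrightarrow> wt b prp \<Longrightarrow> ok (prv l b)"
  unfolding prv_eq by (intro okf_ex) (simp_all add: okf_and okf_nat)

lemma prvI:
  assumes "\<Gamma> \<turnstile> natp i" "\<Gamma> \<turnstile> seq i l b"
  shows "\<Gamma> \<turnstile> prv l b"
  unfolding prv_eq
  by (rule exI_term[where t = i])
    (use assms derives_fm[OF assms(1)] derives_fm[OF assms(2)] in \<open>simp_all add: andR\<close>)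

lemma prvE:
  assumes "\<Gamma> \<turnstile> prv l b" "wt l atmlst" "wt b prp" "fm (osig ext) C"
    and "\<And>i. wt i Nt \<Longrightarrow> add_mset (natp i) (add_mset (seq i l b) \<Gamma>) \<turnstile> C"
  shows "\<Gamma> \<turnstile> C"
  using assms(1) unfolding prv_eq
proof (rule exE_term)
  fix i assume [simp]: "wt i Nt"
  let ?A = "natp i \<^bold>\<and> seq i l b"
  let ?G = "add_mset ?A \<Gamma>"
  have G: "fms (osig ext) ?G" using derives_fm[OF assms(1)] assms(2,3) by simp
  have A: "?G \<turnstile> ?A"
    by (rule derives_assm[OF _ G]) (use assms(2,3) in \<open>simp_all add: okf_and okf_nat\<close>)
  have A1: "?G \<turnstile> natp i" using A by (rule andE1) (simp add: okf_nat)
  have A2: "?G \<turnstile> seq i l b" using A by (rule andE2) (use assms(2,3) in simp)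
  have "add_mset (natp i) (add_mset (seq i l b) ?G) \<turnstile> C"
    by (rule derives_mono[OF assms(5)[of i]]) (use G in auto)
  then have "add_mset (seq i l b) ?G \<turnstile> C"
    by (rule derives_cut[OF derives_mono[OF A1], rotated 2]) (use G in auto)
  then have "?G \<turnstile> C" by (rule derives_cut[OF A2])
  then show "add_mset (inst 0 i (natp (Bnd 0) \<^bold>\<and> seq (Bnd 0) (lift 0 l) (lift 0 b))) \<Gamma> \<turnstile> C"
    by simp
qed (fact assms(4))

lemma object_cut_eq:
  "object_cut = qAll atm (Lam (qAll prp (Lam (qAll atmlst (Lam (prv (cons (Bnd 2) (Bnd 0)) (Bnd 1) \<^bold>\<longrightarrow>
    prv (Bnd 0) (ang (Bnd 2)) \<^bold>\<longrightarrow> prv (Bnd 0) (Bnd 1)))))))"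
  by (simp add: object_cut_def prv_def lam_def Let_def object_defs)

text \<open>The head \<open>a\<close> is covered by the hypothesis, an element of the tail by an
  initial sequent, which exists at height \<open>j\<close> too.\<close>

lemma covers_cut:
  assumes "\<Gamma> \<turnstile> seq j l (ang a)"
  shows "\<Gamma> \<turnstile> covers j (cons a l) l"
proof -
  have [simp]: "wt j Nt" "wt l atmlst" "wt a atm" using derives_fm[OF assms] by auto
  have "{#seq j l (ang a)#} \<turnstile> covers j (cons a l) l"
  proof (rule coversI)
    fix x assume [simp]: "wt x atm"
    show "add_mset (element x (cons a l)) {#seq j l (ang a)#} \<turnstile> seq j l (ang x)"
    proof (rule element_L)
      fix \<theta> m assume [simp]: "tsub \<theta>" "wt m atmlst" and "subst \<theta> (cons a l) \<approx> cons (subst \<theta> x) m"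
      then have eq: "subst \<theta> a \<approx> subst \<theta> x" by (simp add: conv_object_iff)
      let ?s = "\<lambda>a. seq (subst \<theta> j) (subst \<theta> l) (ang (subst \<theta> a))"
      have "{#?s a#} \<turnstile> ?s a" by (rule derives_assm) simp_all
      then have "{#?s a#} \<turnstile> ?s x"
        by (rule convR) (simp_all add: eq conv_object_cong conv_refl)
      then show "image_mset (subst \<theta>) {#seq j l (ang a)#} \<turnstile> subst \<theta> (seq j l (ang x))" by simp
    next
      fix \<theta> y m assume [simp]: "tsub \<theta>" "wt y atm" "wt m atmlst" and "subst \<theta> (cons a l) \<approx> cons y m"
      then have eq: "subst \<theta> l \<approx> m" by (simp add: conv_object_iff)
      let ?s = "\<lambda>a. seq (subst \<theta> j) (subst \<theta> l) (ang (subst \<theta> a))"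
      have "{#element (subst \<theta> x) (subst \<theta> l), ?s a#} \<turnstile> ?s x"
        by (rule seq_element, rule derives_assm) simp_all
      then show "add_mset (element (subst \<theta> x) m) (image_mset (subst \<theta>) {#seq j l (ang a)#})
          \<turnstile> subst \<theta> (seq j l (ang x))"
        using convL[OF _ conv_object_cong(2)[OF conv_refl eq]] by simp
    qed simp_all
  qed simp_all
  then show ?thesis using assms by (rule derives_trans)
qed

lemma derives_object_cut: "{#} \<turnstile> object_cut"
proof -
  have main: "{#} \<turnstile> prv (cons a l) b \<^bold>\<longrightarrow> prv l (ang a) \<^bold>\<longrightarrow> prv l b"
    if [simp]: "wt a atm" "wt b prp" "wt l atmlst" for a b l
  proof (intro impR)
    let ?G = "{#prv l (ang a), prv (cons a l) b#}"
    have G: "fms (osig ext) ?G" by (simp add: fm_def)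
    have goal: "fm (osig ext) (prv l b)" by (simp add: fm_def)
    have "?G \<turnstile> prv (cons a l) b" by (rule derives_assm[OF _ G]) (simp_all add: ok_prv)
    then show "?G \<turnstile> prv l b"
    proof (rule prvE[OF _ _ _ goal])
      fix i assume [simp]: "wt i Nt"
      let ?G1 = "add_mset (natp i) (add_mset (seq i (cons a l) b) ?G)"
      have G1: "fms (osig ext) ?G1" using G by simp
      have "?G1 \<turnstile> prv l (ang a)" by (rule derives_assm[OF _ G1]) (simp_all add: ok_prv)
      then show "?G1 \<turnstile> prv l b"
      proof (rule prvE[OF _ _ _ goal])
        fix j assume [simp]: "wt j Nt"
        let ?G2 = "add_mset (natp j) (add_mset (seq j l (ang a)) ?G1)"
        have G2: "fms (osig ext) ?G2" using G1 by simp
        \<comment> \<open>\<open>i\<close> is the height of the derivation from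
          \<open>cons a l\<close> and \<open>j\<close> that of the cut atom; the bound for
          \<open>i\<close> is used at \<open>j\<close>.\<close>
        have i: "?G2 \<turnstile> cut_bound i"
          by (rule cut_bound_nat, rule derives_assm[OF _ G2]) (simp_all add: okf_nat)
        have j: "?G2 \<turnstile> natp j" by (rule derives_assm[OF _ G2]) (simp_all add: okf_nat)
        show "?G2 \<turnstile> prv l b"
        proof (rule cut_boundE[OF i j _ goal])
          fix k assume [simp]: "wt k Nt"
          let ?H = "add_mset (natp k) (add_mset (transfer zr j k) (add_mset (transfer j i k) ?G2))"
          have H: "fms (osig ext) ?H" using G2 by simp
          have k: "?H \<turnstile> natp k" by (rule derives_assm[OF _ H]) (simp_all add: okf_nat)
          have t: "?H \<turnstile> transfer j i k" by (rule derives_assm[OF _ H]) simp_all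
          have "?H \<turnstile> seq j l (ang a)" by (rule derives_assm[OF _ H]) simp_all
          moreover have "?H \<turnstile> seq i (cons a l) b" by (rule derives_assm[OF _ H]) simp_all
          ultimately have "?H \<turnstile> seq k l b"
            by (rule_tac transferE[OF t covers_cut]) simp_all
          with k show "?H \<turnstile> prv l b" by (rule prvI)
        qed simp
      qed simp_all
    qed simp_all
  qed
  have "{#} \<turnstile> qAll atmlst (Lam (prv (cons a (Bnd 0)) b \<^bold>\<longrightarrow> prv (Bnd 0) (ang a) \<^bold>\<longrightarrow> prv (Bnd 0) b))"
    if "wt a atm" "wt b prp" for a b
    by (rule allI_term) (use that main in \<open>simp_all add: has_ty_closed inst_closed lift_closed\<close>)
  then have "{#} \<turnstile> qAll prp (Lam (qAll atmlst (Lam (prv (cons a (Bnd 0)) (Bnd 1) \<^bold>\<longrightarrow>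
      prv (Bnd 0) (ang a) \<^bold>\<longrightarrow> prv (Bnd 0) (Bnd 1)))))"
    if "wt a atm" for a
    by (intro allI_term) (use that in \<open>simp_all add: has_ty_closed inst_closed lift_closed\<close>)
  then show ?thesis unfolding object_cut_eq
    by (intro allI_term) (simp_all add: lift_closed)
qed

end

subsection \<open>The level condition\<close>

text \<open>The level rules for quantifiers speak of an application to a variable; for an
  abstraction \<open>level_conv\<close> absorbs the beta step.\<close>

lemma level_le_quantifier:
  assumes "level_le lv (inst 0 (Var (y, \<tau>)) B) n" "(y, \<tau>) \<notin> fvs B"
  shows "level_le lv (qAll \<tau> (Lam B)) n" "level_le lv (qEx \<tau> (Lam B)) n"
proof -
  have "level_le lv (App (Lam B) (Var (y, \<tau>))) n"
    using assms(1) conv_sym[OF conv_beta] by (rule level_conv)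
  then show "level_le lv (qAll \<tau> (Lam B)) n" "level_le lv (qEx \<tau> (Lam B)) n"
    using assms(2) by (auto intro: level_all level_ex)
qed

lemma level_le_atom:
  "level_le (\<lambda>_. 0) (App (App (Con (NL p)) t) u) n"
  "level_le (\<lambda>_. 0) (App (App (App (Con (NL p)) t) u) v) n"
  using level_atom[of "\<lambda>_. 0" p n "[t, u]"] level_atom[of "\<lambda>_. 0" p n "[t, u, v]"] by simp_all

lemma is_definition_object: "is_definition (osig ext) (D_nat \<union> D_list \<union> D_intuit)"
proof -
  \<comment> \<open>No clause body contains an implication, so level zero for every predicate
    satisfies the condition.\<close>
  have "level_le (\<lambda>_. 0) (cbody c) 0" if "c \<in> D_nat \<union> D_list \<union> D_intuit" for c :: "'a oclause"
    using that unfolding D_nat_def D_list_def D_intuit_def Let_def lam_def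
    \<comment> \<open>All variable names in the clauses are at most 4, so 9 is fresh.\<close>
    by (auto intro!: level_le_atom level_top level_nat level_and level_le_quantifier[where y = 9])
  moreover have "fm (osig ext) (chead c) \<and> fm (osig ext) (cbody c) \<and> fvs (cbody c) \<subseteq> fvs (chead c)"
    if "c \<in> D_nat \<union> D_list \<union> D_intuit" for c
    using that unfolding D_nat_def D_list_def D_intuit_def Let_def lam_def
    by (elim UnE insertE) (auto simp: fm_def chead_def has_ty_App_iff[of _ _ "Var _"])
  ultimately show ?thesis unfolding is_definition_def by blast
qed

theorem theorem5p2:
  fixes ext :: "'k \<Rightarrow> sort ty option"
  shows "derivable_using (osig ext) (D_nat \<union> D_list \<union> D_intuit) specialization \<and>
    derivable_using (osig ext) (D_nat \<union> D_list \<union> D_intuit) object_cut \<and>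
    derivable_using (osig ext) (D_nat \<union> D_list \<union> D_intuit) structural_rules"
  unfolding derivable_using_def
  using is_definition_object object_logic.derives_specialization object_logic.derives_object_cut
    object_logic.derives_structural_rules derives_fm
  by blast

end
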